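(* Consider the power network system (S) described in the context, and let $(\eta^*,\omega^*,x^{M,*},x^{c,*},x^{u,*})$ be an equilibrium of (S), with $\omega^{G,*}=[\omega_j^*]_{j\in G}$. Suppose that the following four assumptions (stated precisely in the context) hold for this equilibrium: (A1) the security constraint $|\eta^*_{ij}|<\pi/2$ for all $(i,j)\in E$; (A2) local input strict passivity of the net supply dynamics at every bus about the equilibrium values; (A3) strict local minima of the storage functions in (A2) at the equilibrium; (A4) local unique determination of $\omega^L$ by the system states. Then there exists an open neighbourhood $S$ of the point $(\eta^*,\omega^{G,*},x^{M,*},x^{c,*},x^{u,*})$ such that whenever the initial conditions satisfy $(\eta(0),\omega^G(0),x^M(0),x^c(0),x^u(0))\in S$, the solutions of (S) converge to an equilibrium of (S).
   Context: **Input-output systems.** All subsystems are of the form $\dot x=f(x,u)$, $y=g(x,u)$ with input $u(t)\in\mathbb R$, state $x(t)\in\mathbb R^m$, output $y(t)\in\mathbb R$, $f:\mathbb R^m\times\mathbb R\to\mathbb R^m$ locally Lipschitz and $g:\mathbb R^m\times\mathbb R\to\mathbb R$ continuous. It is assumed that for every constant input $u\equiv\bar u\in\mathbb R$ there is a unique locally asymptotically stable equilibrium point $\bar x$ (so $f(\bar x,\bar u)=0$, and $\bar x$ is the unique equilibrium point for that input). The static input-state characteristic is $k_x(\bar u):=\bar x$ and the static input-output characteristic is $k_y(\bar u):=g(k_x(\bar u),\bar u)$. **Network.** $(N,E)$ is a finite connected directed graph with arbitrary orientation ($(i,j)\in E\Rightarrow (j,i)\notin E$); $N=\{1,\dots,|N|\}$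 is the set of buses, partitioned into generation buses $G=\{1,\dots,|G|\}$ and load buses $L=\{|G|+1,\dots,|N|\}$. $i:i\to j$ and $k:j\to k$ denote predecessors and successors of $j$. Constants: $M_j>0$ ($j\in G$), $B_{ij}>0$ and $p^{nom}_{ij}\in\mathbb R$ ($(i,j)\in E$), $p^L_j\in\mathbb R$ ($j\in N$, step change in uncontrollable demand). **System (S).** $$\dot\eta_{ij}=\omega_i-\omega_j,\quad (i,j)\in E,$$ $$M_j\dot\omega_j=-p^L_j+p^M_j-(d^c_j+d^u_j)-\sum_{k:j\to k}p_{jk}+\sum_{i:i\to j}p_{ij},\quad j\in G,$$ $$0=-p^L_j-(d^c_j+d^u_j)-\sum_{k:j\to k}p_{jk}+\sum_{i:i\to j}p_{ij},\quad j\in L,$$ $$p_{ij}=B_{ij}\sin\eta_{ij}-p^{nom}_{ij},\quad (i,j)\in E,$$ where $\eta_{ij}=\theta_i-\theta_j$ are phase differences of bus angles, and $p^M_j$ ($j\in G$), $d^c_j,d^u_j$ ($j\in N$) are outputs of systems of the form $\dot x=f(x,u)$, $y=g(x,u)$ (with $f$ locally Lipschitz, $g$ continuous, and a unique locally asymptotically stable equilibrium point for every constant input) with input $-\omega_j$: $$\dot x^{M,j}=f^{M,j}(x^{M,j},-\omega_j),\ p^M_j=g^{M,j}(x^{M,j},-\omega_j)\ (j\in G);$$ $$\dot x^{c,j}=f^{c,j}(x^{c,j},-\omega_j),\ d^c_j=g^{c,j}(x^{c,j},-\omega_j)\ (j\in N);$$ $$\dot x^{u,j}=f^{u,j}(x^{u,j},-\omega_j),\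 d^u_j=g^{u,j}(x^{u,j},-\omega_j)\ (j\in N).$$ Write $x^M=[x^{M,j}]_{j\in G}$, $x^c=[x^{c,j}]_{j\in N}$, $x^u=[x^{u,j}]_{j\in N}$, $\omega^G=[\omega_j]_{j\in G}$, $\omega^L=[\omega_j]_{j\in L}$. **Equilibrium.** Constants $(\eta^*,\omega^*,x^{M,*},x^{c,*},x^{u,*})$ form an equilibrium of (S) if $\omega^*_i=\omega^*_j$ for $(i,j)\in E$; $0=-p^L_j+p^{M,*}_j-(d^{c,*}_j+d^{u,*}_j)-\sum_{k:j\to k}p^*_{jk}+\sum_{i:i\to j}p^*_{ij}$ for $j\in G$; $0=-p^L_j-(d^{c,*}_j+d^{u,*}_j)-\sum_{k:j\to k}p^*_{jk}+\sum_{i:i\to j}p^*_{ij}$ for $j\in L$; $x^{M,j,*}=k_{x^{M,j}}(-\omega^*_j)$ ($j\in G$), $x^{c,j,*}=k_{x^{c,j}}(-\omega_j^* )$, $x^{u,j,*}=k_{x^{u,j}}(-\omega_j^* )$ ($j\in N$); where $p^*_{ij}=B_{ij}\sin\eta^*_{ij}-p^{nom}_{ij}$, $p^{M,*}_j=k_{p^M_j}(-\omega_j^* )$, $d^{c,*}_j=k_{d^c_j}(-\omega_j^* )$, $d^{u,*}_j=k_{d^u_j}(-\omega_j^* )$. **Passivity.** A system $\dot x=f(x,u)$, $y=g(x,u)$ is locally input strictly passive about constant input value $\bar u$ and constant state value $\bar x$ if there are open neighbourhoods $U$ of $\bar u$ and $X$ of $\bar x$ and a continuously differentiable function $V$, positive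 semidefinite about $\bar x$ ($V(\bar x)=0$, $V\ge0$ on $X$), called the storage function, such that for all $u\in U$, $x\in X$: $\dot V(x)\le (u-\bar u)(y-\bar y)-\phi(u-\bar u)$, where $\dot V(x)=\nabla V(x)\cdot f(x,u)$, $y=g(x,u)$, $\bar y=k_y(\bar u)$ and $\phi$ is positive definite ($\phi(0)=0$, $\phi(z)>0$ for $z\neq0$). **Assumptions (relative to the given equilibrium).** (A1) $|\eta^*_{ij}|<\pi/2$ for all $(i,j)\in E$. (A2) For each $j\in G$, the combined system with input $-\omega_j$, state $(x^{M,j},x^{c,j},x^{u,j})$ and output $s^G_j=p^M_j-(d^c_j+d^u_j)$ is locally input strictly passive about $-\omega^*_j$ and $(x^{M,j,*},x^{c,j,*},x^{u,j,*})$; for each $j\in L$, the combined system with input $-\omega_j$, state $(x^{c,j},x^{u,j})$ and output $s^L_j=-(d^c_j+d^u_j)$ is locally input strictly passive about $-\omega^*_j$ and $(x^{c,j,*},x^{u,j,*})$. (A3) The storage functions in (A2) have strict local minima at $(x^{M,j,*},x^{c,j,*},x^{u,j,*})$ (for $j\in G$) and $(x^{c,j,*},x^{u,j,*})$ (for $j\in L$), respectively. (A4) There is an open neighbourhood $T$ of $(\eta^*,\omega^{G,*},x^{M,*},x^{c,*},x^{u,*})$ such that at any time instant $t$, $\omega^L(t)$ is uniquely determined by the system states $(\eta(t),\omega^G(t),x^M(t),x^c(t),x^u(t))\in T$ and the equations of (S). *)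

theory Defs
  imports "HOL-Analysis.Analysis"
begin

section \<open>Input-output systems\<close>

text \<open>
  The state space R^m of a system is represented by a linear subspace of an ambient Euclidean space.
  In this way the subsystems of a network may have different state dimensions (possibly 0) although
  they share one type. Topological notions and derivatives are taken relative to the subspace.
\<close>

record 'x io_system =
  io_states :: "'x set"
  io_dyn :: "'x \<Rightarrow> real \<Rightarrow> 'x"
  io_out :: "'x \<Rightarrow> real \<Rightarrow> real"

definition locally_lipschitz_on :: "'a::metric_space set \<Rightarrow> ('a \<Rightarrow> 'b::metric_space) \<Rightarrow> bool" where
  "locally_lipschitz_on S f \<longleftrightarrow> (\<forall>z\<in>S. \<exists>e>0. \<exists>K. K-lipschitz_on (cball z e \<inter> S) f)"

text \<open>The half-open time interval from 0 to \<open>\<tau>\<close>; it is {0..} for \<open>\<tau> = \<infinity>\<close>.\<close>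

definition time_interval :: "ereal \<Rightarrow> real set" where
  "time_interval \<tau> = {t. 0 \<le> t \<and> ereal t < \<tau>}"

definition const_input_solution ::
  "'x::euclidean_space io_system \<Rightarrow> real \<Rightarrow> ereal \<Rightarrow> (real \<Rightarrow> 'x) \<Rightarrow> bool" where
  "const_input_solution sys u \<tau> x \<longleftrightarrow>
     (\<forall>t\<in>time_interval \<tau>. x t \<in> io_states sys \<and>
        (x has_vector_derivative io_dyn sys (x t) u) (at t within time_interval \<tau>))"

definition is_equilibrium_point :: "'x::euclidean_space io_system \<Rightarrow> real \<Rightarrow> 'x \<Rightarrow> bool" where
  "is_equilibrium_point sys u x \<longleftrightarrow> x \<in> io_states sys \<and> io_dyn sys x u = 0"

definition locally_asymptotically_stable ::
  "'x::euclidean_space io_system \<Rightarrow> real \<Rightarrow> 'x \<Rightarrow> bool" where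
  "locally_asymptotically_stable sys u xb \<longleftrightarrow>
     is_equilibrium_point sys u xb \<and>
     (\<forall>e>0. \<exists>d>0. \<forall>\<tau> x. 0 < \<tau> \<and> const_input_solution sys u \<tau> x \<and> dist (x 0) xb < d \<longrightarrow>
        (\<forall>t\<in>time_interval \<tau>. dist (x t) xb < e)) \<and>
     (\<exists>d>0. \<forall>x. const_input_solution sys u \<infinity> x \<and> dist (x 0) xb < d \<longrightarrow>
        (x \<longlongrightarrow> xb) at_top)"

definition admissible_io_system :: "'x::euclidean_space io_system \<Rightarrow> bool" where
  "admissible_io_system sys \<longleftrightarrow>
     subspace (io_states sys) \<and>
     (\<forall>x\<in>io_states sys. \<forall>u. io_dyn sys x u \<in> io_states sys) \<and>
     locally_lipschitz_on (io_states sys \<times> UNIV) (\<lambda>(x, u). io_dyn sys x u) \<and>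
     continuous_on (io_states sys \<times> UNIV) (\<lambda>(x, u). io_out sys x u) \<and>
     (\<forall>u. \<exists>xb. locally_asymptotically_stable sys u xb \<and>
        (\<forall>x. is_equilibrium_point sys u x \<longrightarrow> x = xb))"

text \<open>Static input-state and input-output characteristics.\<close>

definition io_kx :: "'x::euclidean_space io_system \<Rightarrow> real \<Rightarrow> 'x" where
  "io_kx sys u = (THE x. is_equilibrium_point sys u x)"

definition io_ky :: "'x::euclidean_space io_system \<Rightarrow> real \<Rightarrow> real" where
  "io_ky sys u = io_out sys (io_kx sys u) u"

text \<open>
  Local input strict passivity about the input value \<open>ub\<close> and the state value \<open>xb\<close>, with storage
  function \<open>V\<close>. The vector field \<open>gradV\<close> represents the derivative of \<open>V\<close> along the state space; its
  component orthogonal to the state space is irrelevant, since \<open>io_dyn\<close> takes values in that space.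
\<close>

definition locally_input_strictly_passive ::
  "'x::euclidean_space io_system \<Rightarrow> real \<Rightarrow> 'x \<Rightarrow> ('x \<Rightarrow> real) \<Rightarrow> bool" where
  "locally_input_strictly_passive sys ub xb V \<longleftrightarrow>
     (\<exists>U X gradV \<phi>.
        open U \<and> ub \<in> U \<and>
        openin (top_of_set (io_states sys)) X \<and> xb \<in> X \<and>
        continuous_on X gradV \<and>
        (\<forall>x\<in>X. (V has_derivative (\<lambda>h. gradV x \<bullet> h)) (at x within X)) \<and>
        V xb = 0 \<and> (\<forall>x\<in>X. 0 \<le> V x) \<and>
        \<phi> 0 = (0::real) \<and> (\<forall>z::real. z \<noteq> 0 \<longrightarrow> 0 < \<phi> z) \<and>
        (\<forall>u\<in>U. \<forall>x\<in>X.
           gradV x \<bullet> io_dyn sys x u \<le> (u - ub) * (io_out sys x u - io_ky sys ub) - \<phi> (u - ub)))"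

definition strict_local_min_on :: "'a::topological_space set \<Rightarrow> ('a \<Rightarrow> real) \<Rightarrow> 'a \<Rightarrow> bool" where
  "strict_local_min_on S V xb \<longleftrightarrow>
     (\<exists>W. openin (top_of_set S) W \<and> xb \<in> W \<and> (\<forall>x\<in>W - {xb}. V xb < V x))"


section \<open>The power network\<close>

text \<open>
  The buses are the elements of the finite type \<open>'n\<close>; the load buses are those outside
  \<open>gen_buses\<close>. The systems \<open>sysM\<close>, \<open>sysC\<close>, \<open>sysU\<close> generate \<open>p\<^sup>M\<close>, \<open>d\<^sup>c\<close>, \<open>d\<^sup>u\<close>; the system
  \<open>sysM net j\<close> is only relevant for generation buses \<open>j\<close>.
\<close>

record ('n, 'x) power_network =
  gen_buses :: "'n set"
  edges :: "('n \<times> 'n) set"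
  inertia :: "'n \<Rightarrow> real"
  suscept :: "'n \<Rightarrow> 'n \<Rightarrow> real"
  pnom :: "'n \<Rightarrow> 'n \<Rightarrow> real"
  demand :: "'n \<Rightarrow> real"
  sysM :: "'n \<Rightarrow> 'x io_system"
  sysC :: "'n \<Rightarrow> 'x io_system"
  sysU :: "'n \<Rightarrow> 'x io_system"

abbreviation load_buses :: "('n, 'x) power_network \<Rightarrow> 'n set" where
  "load_buses net \<equiv> - gen_buses net"

definition admissible_network :: "('n::finite, 'x::euclidean_space) power_network \<Rightarrow> bool" where
  "admissible_network net \<longleftrightarrow>
     (\<forall>i j. (i, j) \<in> edges net \<longrightarrow> (j, i) \<notin> edges net) \<and>
     (\<forall>i j. (i, j) \<in> (edges net \<union> (edges net)\<inverse>)\<^sup>*) \<and>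
     (\<forall>j\<in>gen_buses net. 0 < inertia net j) \<and>
     (\<forall>(i, j)\<in>edges net. 0 < suscept net i j) \<and>
     (\<forall>j\<in>gen_buses net. admissible_io_system (sysM net j)) \<and>
     (\<forall>j. admissible_io_system (sysC net j)) \<and>
     (\<forall>j. admissible_io_system (sysU net j))"

text \<open>
  The vectors \<open>\<eta>\<close>, \<open>\<omega>\<close>, \<open>x\<^sup>M\<close>, \<open>x\<^sup>c\<close>, \<open>x\<^sup>u\<close> are indexed by all pairs of buses and all buses,
  respectively; components with an index outside the intended index set are required to be 0.
\<close>

type_synonym ('n, 'x) config =
  "(real ^ ('n \<times> 'n)) \<times> (real ^ 'n) \<times> ('x ^ 'n) \<times> ('x ^ 'n) \<times> ('x ^ 'n)"

definition restrict_vec :: "'n set \<Rightarrow> 'a::zero ^ 'n \<Rightarrow> 'a ^ 'n" where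
  "restrict_vec A v = (\<chi> j. if j \<in> A then v $ j else 0)"

definition network_configs ::
  "('n::finite, 'x::euclidean_space) power_network \<Rightarrow> ('n, 'x) config set" where
  "network_configs net = {(\<eta>, \<omega>, xM, xc, xu).
     (\<forall>e. e \<notin> edges net \<longrightarrow> \<eta> $ e = 0) \<and>
     (\<forall>j\<in>gen_buses net. xM $ j \<in> io_states (sysM net j)) \<and>
     (\<forall>j\<in>load_buses net. xM $ j = 0) \<and>
     (\<forall>j. xc $ j \<in> io_states (sysC net j)) \<and>
     (\<forall>j. xu $ j \<in> io_states (sysU net j))}"

text \<open>The states: here the second component is the vector of frequencies at generation buses only.\<close>

definition network_states ::
  "('n::finite, 'x::euclidean_space) power_network \<Rightarrow> ('n, 'x) config set" where
  "network_states net =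
     {(\<eta>, \<omega>G, xM, xc, xu) \<in> network_configs net. \<forall>j\<in>load_buses net. \<omega>G $ j = 0}"

definition line_flow ::
  "('n::finite, 'x) power_network \<Rightarrow> real ^ ('n \<times> 'n) \<Rightarrow> 'n \<Rightarrow> 'n \<Rightarrow> real" where
  "line_flow net \<eta> i j = suscept net i j * sin (\<eta> $ (i, j)) - pnom net i j"

text \<open>The right-hand side of the balance equations, in terms of \<open>\<eta>\<close> and the values of
  \<open>p\<^sup>M\<close> (0 at load buses), \<open>d\<^sup>c\<close> and \<open>d\<^sup>u\<close> at bus \<open>j\<close>.\<close>

definition power_balance ::
  "('n::finite, 'x) power_network \<Rightarrow> real ^ ('n \<times> 'n) \<Rightarrow> 'n \<Rightarrow> real \<Rightarrow> real \<Rightarrow> real \<Rightarrow> real" where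
  "power_balance net \<eta> j pM dc du =
     - demand net j + pM - (dc + du)
     - (\<Sum>k | (j, k) \<in> edges net. line_flow net \<eta> j k)
     + (\<Sum>i | (i, j) \<in> edges net. line_flow net \<eta> i j)"

definition load_balance ::
  "('n::finite, 'x) power_network \<Rightarrow> real ^ ('n \<times> 'n) \<Rightarrow> real ^ 'n \<Rightarrow> 'x ^ 'n \<Rightarrow> 'x ^ 'n \<Rightarrow> bool" where
  "load_balance net \<eta> \<omega> xc xu \<longleftrightarrow>
     (\<forall>j\<in>load_buses net.
        0 = power_balance net \<eta> j 0
              (io_out (sysC net j) (xc $ j) (- \<omega> $ j)) (io_out (sysU net j) (xu $ j) (- \<omega> $ j)))"

definition network_solution ::
  "('n::finite, 'x::euclidean_space) power_network \<Rightarrow> ereal \<Rightarrow>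
   (real \<Rightarrow> real ^ ('n \<times> 'n)) \<Rightarrow> (real \<Rightarrow> real ^ 'n) \<Rightarrow>
   (real \<Rightarrow> 'x ^ 'n) \<Rightarrow> (real \<Rightarrow> 'x ^ 'n) \<Rightarrow> (real \<Rightarrow> 'x ^ 'n) \<Rightarrow> bool" where
  "network_solution net \<tau> \<eta> \<omega> xM xc xu \<longleftrightarrow> 0 < \<tau> \<and>
     (\<forall>t\<in>time_interval \<tau>.
        (\<eta> t, \<omega> t, xM t, xc t, xu t) \<in> network_configs net \<and>
        (\<forall>(i, j)\<in>edges net.
           ((\<lambda>s. \<eta> s $ (i, j)) has_real_derivative \<omega> t $ i - \<omega> t $ j)
             (at t within time_interval \<tau>)) \<and>
        (\<forall>j\<in>gen_buses net. \<exists>\<omega>'.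
           ((\<lambda>s. \<omega> s $ j) has_real_derivative \<omega>') (at t within time_interval \<tau>) \<and>
           inertia net j * \<omega>' = power_balance net (\<eta> t) j
             (io_out (sysM net j) (xM t $ j) (- \<omega> t $ j))
             (io_out (sysC net j) (xc t $ j) (- \<omega> t $ j))
             (io_out (sysU net j) (xu t $ j) (- \<omega> t $ j))) \<and>
        load_balance net (\<eta> t) (\<omega> t) (xc t) (xu t) \<and>
        (\<forall>j\<in>gen_buses net.
           ((\<lambda>s. xM s $ j) has_vector_derivative io_dyn (sysM net j) (xM t $ j) (- \<omega> t $ j))
             (at t within time_interval \<tau>)) \<and>
        (\<forall>j. ((\<lambda>s. xc s $ j) has_vector_derivative io_dyn (sysC net j) (xc t $ j) (- \<omega> t $ j))
             (at t within time_interval \<tau>)) \<and>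
        (\<forall>j. ((\<lambda>s. xu s $ j) has_vector_derivative io_dyn (sysU net j) (xu t $ j) (- \<omega> t $ j))
             (at t within time_interval \<tau>)))"

text \<open>A solution that cannot be continued to a larger time interval.\<close>

definition maximal_network_solution ::
  "('n::finite, 'x::euclidean_space) power_network \<Rightarrow> ereal \<Rightarrow>
   (real \<Rightarrow> real ^ ('n \<times> 'n)) \<Rightarrow> (real \<Rightarrow> real ^ 'n) \<Rightarrow>
   (real \<Rightarrow> 'x ^ 'n) \<Rightarrow> (real \<Rightarrow> 'x ^ 'n) \<Rightarrow> (real \<Rightarrow> 'x ^ 'n) \<Rightarrow> bool" where
  "maximal_network_solution net \<tau> \<eta> \<omega> xM xc xu \<longleftrightarrow>
     network_solution net \<tau> \<eta> \<omega> xM xc xu \<and>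
     \<not> (\<exists>\<tau>' \<eta>' \<omega>' xM' xc' xu'. \<tau> < \<tau>' \<and> network_solution net \<tau>' \<eta>' \<omega>' xM' xc' xu' \<and>
          (\<forall>t\<in>time_interval \<tau>. (\<eta>' t, \<omega>' t, xM' t, xc' t, xu' t) = (\<eta> t, \<omega> t, xM t, xc t, xu t)))"

definition network_equilibrium ::
  "('n::finite, 'x::euclidean_space) power_network \<Rightarrow>
   real ^ ('n \<times> 'n) \<Rightarrow> real ^ 'n \<Rightarrow> 'x ^ 'n \<Rightarrow> 'x ^ 'n \<Rightarrow> 'x ^ 'n \<Rightarrow> bool" where
  "network_equilibrium net \<eta> \<omega> xM xc xu \<longleftrightarrow>
     (\<eta>, \<omega>, xM, xc, xu) \<in> network_configs net \<and>
     (\<forall>(i, j)\<in>edges net. \<omega> $ i = \<omega> $ j) \<and>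
     (\<forall>j\<in>gen_buses net. 0 = power_balance net \<eta> j
        (io_ky (sysM net j) (- \<omega> $ j)) (io_ky (sysC net j) (- \<omega> $ j)) (io_ky (sysU net j) (- \<omega> $ j))) \<and>
     (\<forall>j\<in>load_buses net. 0 = power_balance net \<eta> j 0
        (io_ky (sysC net j) (- \<omega> $ j)) (io_ky (sysU net j) (- \<omega> $ j))) \<and>
     (\<forall>j\<in>gen_buses net. xM $ j = io_kx (sysM net j) (- \<omega> $ j)) \<and>
     (\<forall>j. xc $ j = io_kx (sysC net j) (- \<omega> $ j)) \<and>
     (\<forall>j. xu $ j = io_kx (sysU net j) (- \<omega> $ j))"

text \<open>The net supply dynamics with outputs \<open>p\<^sup>M - (d\<^sup>c + d\<^sup>u)\<close> at a generation bus and
  \<open>- (d\<^sup>c + d\<^sup>u)\<close> at a load bus.\<close>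

definition gen_supply ::
  "('n, 'x::euclidean_space) power_network \<Rightarrow> 'n \<Rightarrow> ('x \<times> 'x \<times> 'x) io_system" where
  "gen_supply net j =
     \<lparr>io_states = io_states (sysM net j) \<times> io_states (sysC net j) \<times> io_states (sysU net j),
      io_dyn = (\<lambda>(xM, xc, xu) u.
        (io_dyn (sysM net j) xM u, io_dyn (sysC net j) xc u, io_dyn (sysU net j) xu u)),
      io_out = (\<lambda>(xM, xc, xu) u.
        io_out (sysM net j) xM u - (io_out (sysC net j) xc u + io_out (sysU net j) xu u))\<rparr>"

definition load_supply ::
  "('n, 'x::euclidean_space) power_network \<Rightarrow> 'n \<Rightarrow> ('x \<times> 'x) io_system" where
  "load_supply net j =
     \<lparr>io_states = io_states (sysC net j) \<times> io_states (sysU net j),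
      io_dyn = (\<lambda>(xc, xu) u. (io_dyn (sysC net j) xc u, io_dyn (sysU net j) xu u)),
      io_out = (\<lambda>(xc, xu) u. - (io_out (sysC net j) xc u + io_out (sysU net j) xu u))\<rparr>"

text \<open>
  For every state near the given one, the equations of the system admit exactly one vector of
  frequencies at the load buses. Only the balance equations at load buses constrain these
  frequencies, and the equation at bus \<open>j\<close> involves no frequency other than the one at \<open>j\<close>.
\<close>

definition load_freq_determined_near ::
  "('n::finite, 'x::euclidean_space) power_network \<Rightarrow> ('n, 'x) config \<Rightarrow> bool" where
  "load_freq_determined_near net z \<longleftrightarrow>
     (\<exists>T. openin (top_of_set (network_states net)) T \<and> z \<in> T \<and>
        (\<forall>(\<eta>, \<omega>G, xM, xc, xu)\<in>T. \<exists>!\<omega>L.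
           (\<forall>j\<in>gen_buses net. \<omega>L $ j = 0) \<and> load_balance net \<eta> \<omega>L xc xu))"

end

theory Submission
  imports Defs "HOL-Complex_Analysis.Great_Picard"
begin

text \<open>
  The proof is a Lyapunov argument with LaSalle's invariance principle. Let a star denote values at the
  given equilibrium. The Lyapunov function adds the kinetic energy of the generators,
  the sum over the generation buses of \<open>M\<^sub>j (\<omega>\<^sub>j - \<omega>\<^sub>j*)\<^sup>2 / 2\<close>, the potential energy of the lines, the sum
  over the edges of the integral of \<open>B\<^sub>i\<^sub>j (sin \<theta> - sin \<eta>\<^sub>i\<^sub>j*)\<close> for \<open>\<theta>\<close> from \<open>\<eta>\<^sub>i\<^sub>j*\<close> to \<open>\<eta>\<^sub>i\<^sub>j\<close>, and the storage
  functions of all buses. Phase differences of absolute value below \<open>\<pi>/2\<close> and the strict minima of the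
  storage functions make the equilibrium a strict local minimum. Along solutions the power exchanged over the lines
  cancels (\<open>energy_balance\<close>) and the power exchanged with the supply dynamics is dominated by input
  strict passivity, so that the energy is nonincreasing, and strictly decreasing unless all frequencies
  have their equilibrium values (\<open>energy_derivative\<close>).

  The frequencies at load buses are not states. Their uniqueness alone does not make them
  continuous functions of the state; passivity does. At the equilibrium state a storage function
  has gradient zero, hence the supply at a bus, as a function of the frequency there, passes through its
  equilibrium value with a change of sign. By the intermediate value theorem the balance equation
  keeps a solution near the equilibrium frequency when the state is perturbed
  (\<open>passive_network_ball_exists\<close>); by uniqueness it is the load frequency, and
  a function with compact range and closed graph is continuous (\<open>continuous_on_bus_freq\<close>). The network
  therefore becomes an autonomous differential equation whose right-hand side is continuous near the
  equilibrium, but not locally Lipschitz, since the outputs of the subsystems are only continuous.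

  For such equations Peano's theorem is proved here by Tonelli's delayed approximations and the
  compactness of equi-Lipschitz families. It continues a solution that stays in a compact set
  (\<open>solution_continuation\<close>), so that maximal solutions starting in a small sublevel set of the energy
  exist for all times. The same compactness shows that every limit point of a
  solution lies on a solution defined for all real times along which the energy is constant
  (\<open>omega_limit_complete_solution\<close>). On it all frequencies are the equilibrium ones, so
  each subsystem has a constant input and a bounded complete solution near its asymptotically stable
  equilibrium, which must then be that equilibrium (\<open>complete_solution_near_stable_equilibrium\<close>);
  constancy of the generator frequencies makes all buses balanced.

  Limit points are thus equilibria, but equilibria need not be isolated. The solution still converges
  to a single one. Phases change only by differences of bus angles, and two balanced phase
  vectors that differ by differences of bus angles and have entries of absolute value below \<open>\<pi>/2\<close> are equal because the
  sine is strictly increasing there (\<open>phase_difference_unique\<close>).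
\<close>

section \<open>Solutions of autonomous differential equations\<close>

definition solves :: "('a::real_normed_vector \<Rightarrow> 'a) \<Rightarrow> real set \<Rightarrow> (real \<Rightarrow> 'a) \<Rightarrow> bool" where
  "solves F I y \<longleftrightarrow> (\<forall>t\<in>I. (y has_vector_derivative F (y t)) (at t within I))"

lemma solves_subset: "solves F J y" if "solves F I y" "J \<subseteq> I"
  using that unfolding solves_def by (blast intro: has_vector_derivative_within_subset)

lemma solves_continuous_on: "continuous_on I y" if "solves F I y"
  using that unfolding solves_def
  by (meson continuous_on_eq_continuous_within has_vector_derivative_continuous)

lemma solves_shift:
  assumes "solves F UNIV y"
  shows "solves F UNIV (\<lambda>s. y (s + c))"
  unfolding solves_def
proof
  fix t :: real
  have "((\<lambda>s. s + c) has_vector_derivative 1) (at t)"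
    by (auto intro!: derivative_eq_intros)
  moreover have "(y has_vector_derivative F (y (t + c))) (at (t + c))"
    using assms unfolding solves_def by auto
  ultimately show "((\<lambda>s. y (s + c)) has_vector_derivative F (y (t + c))) (at t)"
    using vector_diff_chain_at[of "\<lambda>s. s + c" 1 t y "F (y (t + c))"] by (simp add: o_def)
qed

lemma solves_has_integral:
  fixes y :: "real \<Rightarrow> 'a::banach"
  assumes "solves F I y" "{a..b} \<subseteq> I" "a \<le> b"
  shows "((\<lambda>s. F (y s)) has_integral y b - y a) {a..b}"
  using solves_subset[OF assms(1,2)] assms(3) unfolding solves_def
  by (intro fundamental_theorem_of_calculus) auto

lemma solves_if_integral_equation:
  fixes y :: "real \<Rightarrow> 'a::banach"
  assumes "continuous_on {a..b} (\<lambda>s. F (y s))"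
    and "\<And>t. t \<in> {a..b} \<Longrightarrow> ((\<lambda>s. F (y s)) has_integral y t - c) {a..t}"
  shows "solves F {a..b} y"
  unfolding solves_def
proof
  fix t assume t: "t \<in> {a..b}"
  have "((\<lambda>u. c + integral {a..u} (\<lambda>s. F (y s))) has_vector_derivative F (y t)) (at t within {a..b})"
    using integral_has_vector_derivative[OF assms(1) t] by (auto intro!: derivative_eq_intros)
  moreover have "y u = c + integral {a..u} (\<lambda>s. F (y s))" if "u \<in> {a..b}" for u
    using integral_unique[OF assms(2)[OF that]] by simp
  ultimately show "(y has_vector_derivative F (y t)) (at t within {a..b})"
    by (rule has_vector_derivative_transform[OF t, rotated])
qed

lemma solves_UNIV_if_integral_equation:
  fixes y :: "real \<Rightarrow> 'a::banach"
  assumes "continuous_on UNIV (\<lambda>s. F (y s))"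
    and "\<And>a b. a \<le> b \<Longrightarrow> ((\<lambda>s. F (y s)) has_integral y b - y a) {a..b}"
  shows "solves F UNIV y"
  unfolding solves_def
proof
  fix t :: real
  have "solves F {t-1..t+1} y"
    by (rule solves_if_integral_equation[where c = "y (t-1)"])
       (auto intro: continuous_on_subset[OF assms(1)] assms(2))
  then have "(y has_vector_derivative F (y t)) (at t within {t-1..t+1})"
    unfolding solves_def by auto
  then show "(y has_vector_derivative F (y t)) (at t)"
    by (subst (asm) at_within_interior) auto
qed

lemma Icc_subset_interval: "{a..b} \<subseteq> I" if "is_interval I" "a \<in> I" "b \<in> I" for a b :: real
  using that unfolding is_interval_1 by (meson atLeastAtMost_iff subsetI)

lemma solves_lipschitz:
  fixes y :: "real \<Rightarrow> 'a::banach"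
  assumes sol: "solves F I y" and I: "is_interval I"
    and M: "\<And>t. t \<in> I \<Longrightarrow> norm (F (y t)) \<le> M" "0 \<le> M"
  shows "M-lipschitz_on I y"
proof (rule lipschitz_onI)
  have le: "norm (y b - y a) \<le> M * (b - a)" if "a \<in> I" "b \<in> I" "a \<le> b" for a b
  proof -
    have sub: "{a..b} \<subseteq> I" using I that by (simp add: Icc_subset_interval)
    have "((\<lambda>s. F (y s)) has_integral y b - y a) (cbox a b)"
      using solves_has_integral[OF sol sub \<open>a \<le> b\<close>] by simp
    then have "norm (y b - y a) \<le> M * measure lborel (cbox a b)"
      by (rule has_integral_bound[OF M(2)]) (use M(1) sub in auto)
    then show ?thesis using \<open>a \<le> b\<close> by simp
  qed
  show "dist (y a) (y b) \<le> M * dist a b" if "a \<in> I" "b \<in> I" for a b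
    using le[of a b] le[of b a] that
    by (cases "a \<le> b") (auto simp: dist_norm norm_minus_commute abs_if)
qed (rule M)

text \<open>
  The integral of the velocity is orthogonal to the orthogonal complement of \<open>A\<close>. This serves for the
  linear constraints on states and for phases that are differences of bus angles.
\<close>

lemma solves_increment_in_subspace:
  fixes y :: "real \<Rightarrow> 'a::euclidean_space"
  assumes sol: "solves F I y" and I: "is_interval I" "a \<in> I" "b \<in> I"
    and A: "subspace A" "\<And>t. t \<in> I \<Longrightarrow> F (y t) \<in> A"
  shows "y b - y a \<in> A"
proof -
  have le: "y b - y a \<in> A" if "a \<in> I" "b \<in> I" "a \<le> b" for a b
  proof -
    have sub: "{a..b} \<subseteq> I" using I that by (simp add: Icc_subset_interval)
    have "((\<lambda>s. F (y s)) has_integral y b - y a) {a..b}"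
      by (rule solves_has_integral[OF sol sub \<open>a \<le> b\<close>])
    moreover have "v \<bullet> (y b - y a) = 0" if "v \<in> A\<^sup>\<bottom>" for v
    proof -
      have "((\<lambda>s. v \<bullet> F (y s)) has_integral v \<bullet> (y b - y a)) {a..b}"
        using has_integral_linear[OF calculation bounded_linear_inner_right[of v]]
        by (simp add: o_def)
      moreover have "v \<bullet> F (y s) = 0" if "s \<in> {a..b}" for s
        using \<open>v \<in> A\<^sup>\<bottom>\<close> A(2) sub that unfolding orthogonal_comp_def orthogonal_def
        by (auto simp: inner_commute subset_iff)
      ultimately have "((\<lambda>s. 0) has_integral v \<bullet> (y b - y a)) {a..b}"
        by (subst has_integral_cong) auto
      then show ?thesis by (simp add: has_integral_0_eq)
    qed
    then have "y b - y a \<in> A\<^sup>\<bottom>\<^sup>\<bottom>"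
      unfolding orthogonal_comp_def[of "A\<^sup>\<bottom>"] orthogonal_def by simp
    then show ?thesis by (simp add: orthogonal_comp_self A)
  qed
  show ?thesis
  proof (cases "a \<le> b")
    case False
    with le[OF I(3,2)] have "- (y a - y b) \<in> A" by (intro subspace_neg A) auto
    then show ?thesis by simp
  qed (use le I in auto)
qed

section \<open>Compactness of families of solutions\<close>

text \<open>
  A diagonal subsequence converges at all rational times; the common Lipschitz constant carries the
  Cauchy property to all other times. Pointwise convergence on the whole line suffices below, because
  limits of solutions are taken in integral equations, by dominated convergence.
\<close>

lemma equi_lipschitz_convergent_subsequence:
  fixes x :: "nat \<Rightarrow> real \<Rightarrow> 'a::euclidean_space"
  assumes lip: "\<And>n. M-lipschitz_on UNIV (x n)" and bd: "\<And>n t. norm (x n t) \<le> B"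
  obtains k y where "strict_mono (k :: nat \<Rightarrow> nat)" "M-lipschitz_on UNIV y"
    "\<And>t. (\<lambda>n. x (k n) t) \<longlonglongrightarrow> y t"
proof -
  obtain k where k: "strict_mono (k::nat\<Rightarrow>nat)" "\<And>q. q \<in> \<rat> \<Longrightarrow> \<exists>l. (\<lambda>n. x (k n) q) \<longlonglongrightarrow> l"
    using function_convergent_subsequence[of "\<rat> :: real set" x B] bd countable_rat by blast
  have "M \<ge> 0" using lip lipschitz_on_nonneg by blast
  have "Cauchy (\<lambda>n. x (k n) t)" for t
  proof (rule metric_CauchyI)
    fix e :: real assume "e > 0"
    define d where "d = e / (3 * (M + 1))"
    have "d > 0" using \<open>e > 0\<close> \<open>M \<ge> 0\<close> by (auto simp: d_def)
    obtain q where q: "q \<in> \<rat>" "t < q" "q < t + d" using Rats_dense_in_real[of t "t + d"] \<open>d > 0\<close> by auto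
    have near: "dist (x n t) (x n q) < e / 3" for n
    proof -
      have "dist (x n t) (x n q) \<le> M * dist t q" by (rule lipschitz_onD[OF lip]) auto
      also have "\<dots> \<le> M * d" using q \<open>M \<ge> 0\<close> by (intro mult_left_mono) (auto simp: dist_real_def)
      also have "\<dots> < (M + 1) * d" using \<open>d > 0\<close> by (simp add: algebra_simps)
      also have "\<dots> = e / 3" using \<open>M \<ge> 0\<close> by (simp add: d_def field_simps)
      finally show ?thesis .
    qed
    have "Cauchy (\<lambda>n. x (k n) q)" using k(2)[OF q(1)] LIMSEQ_imp_Cauchy by blast
    then obtain N where N: "\<And>m n. m \<ge> N \<Longrightarrow> n \<ge> N \<Longrightarrow> dist (x (k m) q) (x (k n) q) < e / 3"
      using metric_CauchyD[of _ "e / 3"] \<open>e > 0\<close> by (metis zero_less_divide_iff zero_less_numeral)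
    have "dist (x (k m) t) (x (k n) t) < e" if "m \<ge> N" "n \<ge> N" for m n
      using near[of "k m"] near[of "k n"] N[OF that]
        dist_triangle[of "x (k m) t" "x (k n) t" "x (k m) q"]
        dist_triangle[of "x (k m) q" "x (k n) t" "x (k n) q"]
      by (simp add: dist_commute)
    then show "\<exists>N. \<forall>m\<ge>N. \<forall>n\<ge>N. dist (x (k m) t) (x (k n) t) < e" by blast
  qed
  then have "\<exists>l. (\<lambda>n. x (k n) t) \<longlonglongrightarrow> l" for t
    by (simp add: convergent_eq_Cauchy)
  then obtain y where y: "\<And>t. (\<lambda>n. x (k n) t) \<longlonglongrightarrow> y t" by metis
  have "M-lipschitz_on UNIV y"
  proof (rule lipschitz_onI)
    fix a b :: real
    have "(\<lambda>n. dist (x (k n) a) (x (k n) b)) \<longlonglongrightarrow> dist (y a) (y b)"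
      by (intro tendsto_dist y)
    then show "dist (y a) (y b) \<le> M * dist a b"
      by (rule LIMSEQ_le_const2) (auto intro: lipschitz_onD[OF lip])
  qed fact
  with k(1) y show ?thesis using that by blast
qed

lemma integral_equation_limit:
  fixes F :: "'a::euclidean_space \<Rightarrow> 'a" and x :: "nat \<Rightarrow> real \<Rightarrow> 'a"
  assumes F: "continuous_on K F" "compact K"
    and ev: "\<forall>\<^sub>F n in sequentially.
      ((\<lambda>s. F (x n s)) has_integral x n b - x n a) {a..b} \<and> x n ` {a..b} \<subseteq> K"
    and x: "\<And>s. (\<lambda>n. x n s) \<longlonglongrightarrow> y s"
  shows "((\<lambda>s. F (y s)) has_integral y b - y a) {a..b}"
proof -
  obtain N where N: "\<And>n. n \<ge> N \<Longrightarrow>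
      ((\<lambda>s. F (x n s)) has_integral x n b - x n a) {a..b} \<and> x n ` {a..b} \<subseteq> K"
    using ev unfolding eventually_sequentially by blast
  have "bounded (F ` K)" by (intro compact_imp_bounded compact_continuous_image F)
  then obtain B where B: "\<And>z. z \<in> K \<Longrightarrow> norm (F z) \<le> B" unfolding bounded_iff by auto
  show ?thesis
  proof (rule has_integral_dominated_convergence[where f = "\<lambda>n s. F (x (n + N) s)" and h = "\<lambda>_. B"])
    show "((\<lambda>s. F (x (n + N) s)) has_integral x (n + N) b - x (n + N) a) {a..b}" for n
      using N[of "n + N"] by auto
    show "\<forall>s\<in>{a..b}. norm (F (x (n + N) s)) \<le> B" for n
      using N[of "n + N"] by (intro ballI B) auto
    show "\<forall>s\<in>{a..b}. (\<lambda>n. F (x (n + N) s)) \<longlonglongrightarrow> F (y s)"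
    proof
      fix s assume s: "s \<in> {a..b}"
      have xN: "(\<lambda>n. x (n + N) s) \<longlonglongrightarrow> y s" by (rule LIMSEQ_ignore_initial_segment[OF x])
      have inK: "x (n + N) s \<in> K" for n using N[of "n + N"] s by auto
      have "y s \<in> K" using closed_sequentially[OF compact_imp_closed[OF F(2)] _ xN] inK by auto
      then show "(\<lambda>n. F (x (n + N) s)) \<longlonglongrightarrow> F (y s)"
        using continuous_on_tendsto_compose[OF F(1) xN] inK by auto
    qed
    show "(\<lambda>n. x (n + N) b - x (n + N) a) \<longlonglongrightarrow> y b - y a"
      using LIMSEQ_ignore_initial_segment[OF tendsto_diff[OF x x]] .
  qed (intro integrable_continuous_real continuous_on_const)
qed

lemma complete_solution_limit:
  fixes F :: "'a::euclidean_space \<Rightarrow> 'a"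
  assumes F: "continuous_on K F" "compact K"
    and lip: "\<And>n. M-lipschitz_on UNIV (x n)" and K: "\<And>n t. x n t \<in> K"
    and sol: "\<And>a b. \<forall>\<^sub>F n in sequentially. solves F {a..b} (x n)"
  obtains k y where "strict_mono (k :: nat \<Rightarrow> nat)" "solves F UNIV y"
    "\<And>t. y t \<in> K" "\<And>t. (\<lambda>n. x (k n) t) \<longlonglongrightarrow> y t"
proof -
  obtain B where "\<And>z. z \<in> K \<Longrightarrow> norm z \<le> B"
    using compact_imp_bounded[OF F(2)] unfolding bounded_iff by auto
  then have bd: "norm (x n t) \<le> B" for n t using K by auto
  obtain k y where k: "strict_mono (k :: nat \<Rightarrow> nat)" and y: "M-lipschitz_on UNIV y"
    "\<And>t. (\<lambda>n. x (k n) t) \<longlonglongrightarrow> y t"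
    using equi_lipschitz_convergent_subsequence[of M x B, OF lip bd] by blast
  have yK: "y t \<in> K" for t
    using closed_sequentially[OF compact_imp_closed[OF F(2)] _ y(2)] K by auto
  have "solves F UNIV y"
  proof (rule solves_UNIV_if_integral_equation)
    show "continuous_on UNIV (\<lambda>s. F (y s))"
      using lipschitz_on_continuous_on[OF y(1)] yK
      by (intro continuous_on_compose2[OF F(1)]) auto
    fix a b :: real assume "a \<le> b"
    show "((\<lambda>s. F (y s)) has_integral y b - y a) {a..b}"
    proof (rule integral_equation_limit[OF F, where x = "\<lambda>n. x (k n)"])
      have "\<forall>\<^sub>F n in sequentially. solves F {a..b} (x (k n))"
        using eventually_subseq[OF k sol] .
      then show "\<forall>\<^sub>F n in sequentially. ((\<lambda>s. F (x (k n) s)) has_integral x (k n) b - x (k n) a) {a..b}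
          \<and> x (k n) ` {a..b} \<subseteq> K"
      proof eventually_elim
        case (elim n)
        show ?case using K solves_has_integral[OF elim order.refl \<open>a \<le> b\<close>] by blast
      qed
    qed (rule y)+
  qed
  with k yK y(2) show ?thesis using that by blast
qed

section \<open>Existence and continuation of solutions\<close>

text \<open>
  For negative \<open>t\<close> the interval is empty and the integral is 0, so the function is constant there. The
  delayed approximations below rely on this convention for their history before time 0.
\<close>

lemma integral_lipschitz:
  fixes g :: "real \<Rightarrow> 'a::euclidean_space"
  assumes g: "continuous_on UNIV g" and M: "\<And>t. norm (g t) \<le> M"
  shows "M-lipschitz_on UNIV (\<lambda>t. integral {0..t} g)"
proof (rule lipschitz_onI)
  have "0 \<le> norm (g 0)" by simp
  then show "0 \<le> M" using M[of 0] by linarith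
  have int: "g integrable_on {a..b}" for a b
    by (intro integrable_continuous_real continuous_on_subset[OF g]) auto
  have le: "norm (integral {0..b} g - integral {0..a} g) \<le> M * (b - a)" if "a \<le> b" for a b
  proof -
    have bound: "norm (integral {c..d} g) \<le> M * (d - c)" if "c \<le> d" for c d
      using integral_bound[of c d g M] that M continuous_on_subset[OF g] by auto
    consider "b < 0" | "a < 0" "0 \<le> b" | "0 \<le> a" by linarith
    then show ?thesis
    proof cases
      case 1
      then show ?thesis using \<open>a \<le> b\<close> \<open>0 \<le> M\<close> by simp
    next
      case 2
      have "M * b \<le> M * (b - a)" using 2 \<open>0 \<le> M\<close> by (intro mult_left_mono) auto
      then show ?thesis using 2 bound[of 0 b] by simp
    next
      case 3
      then have "integral {0..a} g + integral {a..b} g = integral {0..b} g"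
        using \<open>a \<le> b\<close> by (intro Henstock_Kurzweil_Integration.integral_combine int) auto
      then have "integral {0..b} g - integral {0..a} g = integral {a..b} g"
        by (simp add: algebra_simps)
      then show ?thesis using bound[OF \<open>a \<le> b\<close>] by simp
    qed
  qed
  show "dist (integral {0..a} g) (integral {0..b} g) \<le> M * dist a b" for a b
    using le[of a b] le[of b a]
    by (cases "a \<le> b") (auto simp: dist_norm norm_minus_commute abs_if)
qed

text \<open>
  With a delay \<open>h\<close> the integral equation determines \<open>x\<close> on one interval of length \<open>h\<close> after the other.
\<close>

lemma delayed_solution:
  fixes F :: "'a::euclidean_space \<Rightarrow> 'a"
  assumes F: "continuous_on UNIV F" "\<And>z. norm (F z) \<le> M" and h: "0 < h"
  obtains x :: "real \<Rightarrow> 'a" where "M-lipschitz_on UNIV x" "\<And>t. t \<le> 0 \<Longrightarrow> x t = x0"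
    "\<And>t. t \<le> 1 \<Longrightarrow> x t = x0 + integral {0..t} (\<lambda>s. F (x (s - h)))"
proof -
  define step :: "(real \<Rightarrow> 'a) \<Rightarrow> real \<Rightarrow> 'a" where "step x = (\<lambda>t. x0 + integral {0..t} (\<lambda>s. F (x (s - h))))" for x
  define X where "X k = (step ^^ k) (\<lambda>_. x0)" for k
  have X_Suc: "X (Suc k) = step (X k)" for k by (simp add: X_def)
  have "0 \<le> norm (F 0)" by simp
  then have M: "0 \<le> M" using F(2)[of 0] by linarith
  have lip: "M-lipschitz_on UNIV (X k)" for k
  proof (induction k)
    case 0
    show ?case using M by (simp add: X_def lipschitz_on_def)
  next
    case (Suc k)
    have "continuous_on UNIV (\<lambda>s. F (X k (s - h)))"
      by (intro continuous_on_compose2[OF F(1)] continuous_on_compose2[OF lipschitz_on_continuous_on[OF Suc]]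
        continuous_intros) auto
    from integral_lipschitz[OF this, of M] F(2)
    show ?case by (simp add: X_Suc step_def lipschitz_on_def dist_norm)
  qed
  \<comment> \<open>The value at \<open>t\<close> depends on earlier values up to \<open>t - h\<close> only, so the \<open>k\<close>-th iterate is final up to time \<open>k h\<close>.\<close>
  have fixed: "X (Suc k) t = X k t" if "t \<le> real k * h" for k t
    using that
  proof (induction k arbitrary: t)
    case 0
    have "integral {0..t} g = 0" for g :: "real \<Rightarrow> 'a"
      using 0 by (cases "t = 0") auto
    then show ?case by (simp add: X_Suc step_def) (simp add: X_def)
  next
    case (Suc k)
    have "integral {0..t} (\<lambda>s. F (X (Suc k) (s - h))) = integral {0..t} (\<lambda>s. F (X k (s - h)))"
    proof (rule integral_cong)
      fix s assume "s \<in> {0..t}"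
      then have "s - h \<le> real k * h" using Suc.prems by (simp add: algebra_simps)
      then show "F (X (Suc k) (s - h)) = F (X k (s - h))" using Suc.IH by simp
    qed
    then show ?case by (subst (1 2) X_Suc) (simp add: step_def)
  qed
  obtain k where "1 < real k * h" using ex_less_of_nat_mult[OF h] by blast
  then have "X k t = x0 + integral {0..t} (\<lambda>s. F (X k (s - h)))" if "t \<le> 1" for t
    using fixed[of t k] that by (simp add: X_Suc step_def)
  moreover have "X k t = x0" if "t \<le> 0" for t
  proof -
    have "integral {0..t} g = 0" for g :: "real \<Rightarrow> 'a"
      using that by (cases "t = 0") auto
    then show ?thesis by (cases k) (simp_all add: X_Suc step_def, simp add: X_def)
  qed
  ultimately show ?thesis using that lip by blast
qed

text \<open>
  Peano's theorem. The delayed approximations are equi-Lipschitz; a limit along delays tending to 0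
  solves the equation. They are stopped at time 1 to make them uniformly bounded.
\<close>

theorem peano_bounded:
  fixes F :: "'a::euclidean_space \<Rightarrow> 'a"
  assumes F: "continuous_on UNIV F" "\<And>z. norm (F z) \<le> M"
  obtains y where "y 0 = x0" "solves F {0..1} y"
proof -
  have "0 \<le> norm (F 0)" by simp
  then have M: "0 \<le> M" using F(2)[of 0] by linarith
  have "\<exists>x. M-lipschitz_on UNIV x \<and> (\<forall>t\<le>0. x t = x0) \<and>
      (\<forall>t\<le>1. x t = x0 + integral {0..t} (\<lambda>s. F (x (s - inverse (real (Suc n))))))" for n
    by (rule delayed_solution[OF F, of "inverse (real (Suc n))" x0]) auto
  then obtain x where lip: "\<And>n. M-lipschitz_on UNIV (x n)" and init: "\<And>n t. t \<le> 0 \<Longrightarrow> x n t = x0"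
    and eq: "\<And>n t. t \<le> 1 \<Longrightarrow> x n t = x0 + integral {0..t} (\<lambda>s. F (x n (s - inverse (real (Suc n)))))"
    by metis
  have bd: "norm (x n (min 1 t)) \<le> norm x0 + M" for n t
  proof (cases "t \<le> 0")
    case True
    then show ?thesis using init[of "min 1 t"] M by simp
  next
    case False
    have "dist (x n (min 1 t)) (x n 0) \<le> M * dist (min 1 t) 0"
      by (rule lipschitz_onD[OF lip]) auto
    also have "\<dots> \<le> M * 1" using M False by (intro mult_left_mono) (auto simp: dist_real_def)
    finally show ?thesis using init[of 0 n] norm_triangle_sub[of "x n (min 1 t)" x0]
      by (simp add: dist_norm)
  qed
  have "M-lipschitz_on UNIV (\<lambda>t. x n (min 1 t))" for n
  proof (rule lipschitz_onI)
    fix a b :: real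
    have "dist (x n (min 1 a)) (x n (min 1 b)) \<le> M * dist (min 1 a) (min 1 b)"
      by (rule lipschitz_onD[OF lip]) auto
    also have "\<dots> \<le> M * dist a b" using M by (intro mult_left_mono) (auto simp: dist_real_def)
    finally show "dist (x n (min 1 a)) (x n (min 1 b)) \<le> M * dist a b" .
  qed fact
  from equi_lipschitz_convergent_subsequence[of M "\<lambda>n t. x n (min 1 t)", OF this bd]
  obtain k y where k: "strict_mono (k :: nat \<Rightarrow> nat)" and y: "M-lipschitz_on UNIV y"
    and lim: "\<And>t. (\<lambda>n. x (k n) (min 1 t)) \<longlonglongrightarrow> y t" by blast
  have lim1: "(\<lambda>n. x (k n) t) \<longlonglongrightarrow> y t" if "t \<le> 1" for t
    using lim[of t] that by (simp add: min_def)
  have y0: "y 0 = x0" using lim1[of 0] init[of 0] LIMSEQ_unique[OF tendsto_const] by auto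
  have delayed: "(\<lambda>n. x (k n) (s - inverse (real (Suc (k n))))) \<longlonglongrightarrow> y s" if "s \<le> 1" for s
  proof -
    have h: "(\<lambda>n. inverse (real (Suc (k n)))) \<longlonglongrightarrow> 0"
      using LIMSEQ_subseq_LIMSEQ[OF LIMSEQ_inverse_real_of_nat k] by (simp add: o_def)
    have "(\<lambda>n. M * inverse (real (Suc (k n)))) \<longlonglongrightarrow> 0" using tendsto_mult_right_zero[OF h] .
    moreover have "dist (x (k n) (s - inverse (real (Suc (k n))))) (x (k n) s)
        \<le> M * inverse (real (Suc (k n)))" for n
      using lipschitz_onD[OF lip, of "s - inverse (real (Suc (k n)))" s "k n"] by (simp add: dist_real_def)
    ultimately have "(\<lambda>n. x (k n) (s - inverse (real (Suc (k n)))) - x (k n) s) \<longlonglongrightarrow> 0"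
      unfolding dist_norm by (metis (no_types, lifting) Lim_null_comparison always_eventually)
    from tendsto_add[OF this lim1[OF that]] show ?thesis by simp
  qed
  have cont: "continuous_on A (\<lambda>s. F (y s))" for A
    by (intro continuous_on_compose2[OF F(1)] lipschitz_on_continuous_on[OF lipschitz_on_subset[OF y]]) auto
  have "((\<lambda>s. F (y s)) has_integral y t - x0) {0..t}" if t: "t \<in> {0..1}" for t
  proof (rule has_integral_dominated_convergence)
    let ?h = "\<lambda>n. inverse (real (Suc (k n)))"
    show "((\<lambda>s. F (x (k n) (s - ?h n))) has_integral x (k n) t - x0) {0..t}" for n
    proof -
      have "continuous_on {0..t} (\<lambda>s. F (x (k n) (s - ?h n)))"
        by (intro continuous_on_compose2[OF F(1)]
          continuous_on_compose2[OF lipschitz_on_continuous_on[OF lip]] continuous_intros) auto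
      from integrable_integral[OF integrable_continuous_real[OF this]] show ?thesis
        using eq[of t "k n"] t by simp
    qed
    show "\<forall>s\<in>{0..t}. norm (F (x (k n) (s - ?h n))) \<le> M" for n using F(2) by simp
    show "\<forall>s\<in>{0..t}. (\<lambda>n. F (x (k n) (s - ?h n))) \<longlonglongrightarrow> F (y s)"
      using t by (intro ballI continuous_on_tendsto_compose[OF F(1) delayed]) auto
    show "(\<lambda>n. x (k n) t - x0) \<longlonglongrightarrow> y t - x0"
      using lim1 t by (intro tendsto_intros) auto
  qed (intro integrable_continuous_real continuous_on_const)
  then have "solves F {0..1} y"
    using solves_if_integral_equation[where F = F and y = y and c = x0, OF cont[of "{0..1}"]] by blast
  with y0 show ?thesis using that by blast
qed

text \<open>
  Composition with the nearest-point projection onto the compact convex set \<open>N \<inter> cball p r\<close> extends the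
  vector field to a bounded continuous one on the whole space; a solution of the extended equation
  stays in the ball for a short time, where the two equations agree.
\<close>

lemma peano_in_ball:
  fixes F :: "'a::euclidean_space \<Rightarrow> 'a"
  assumes N: "subspace N" and F: "continuous_on (N \<inter> cball p r) F" "F ` (N \<inter> cball p r) \<subseteq> N"
    and x0: "x0 \<in> N \<inter> ball p r"
  obtains y d where "0 < d" "y 0 = x0" "solves F {0..d} y" "\<And>t. t \<in> {0..d} \<Longrightarrow> y t \<in> N \<inter> ball p r"
proof -
  define C where "C = N \<inter> cball p r"
  have C: "compact C" "convex C" "C \<noteq> {}"
    using closed_subspace[OF N] subspace_imp_convex[OF N] x0
    by (auto simp: C_def closed_Int_compact convex_Int)
  define G where "G z = F (closest_point C z)" for z
  have cp: "closest_point C z \<in> C" for z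
    using closest_point_in_set C compact_imp_closed by blast
  have "bounded (F ` C)" using F(1) C(1) unfolding C_def[symmetric]
    by (intro compact_imp_bounded compact_continuous_image)
  then obtain M where M: "\<And>z. z \<in> C \<Longrightarrow> norm (F z) \<le> M" unfolding bounded_iff by auto
  have G: "continuous_on UNIV G" unfolding G_def[abs_def]
  proof (rule continuous_on_compose2[where g = F and f = "closest_point C"])
    show "continuous_on C F" using F(1) by (simp add: C_def)
    show "continuous_on UNIV (closest_point C)"
      by (rule continuous_on_closest_point) (use C compact_imp_closed in auto)
  qed (use cp in auto)
  have GM: "norm (G z) \<le> M" for z unfolding G_def using M cp by blast
  obtain y where y: "y 0 = x0" "solves G {0..1} y"
    by (rule peano_bounded[OF G GM])
  have GN: "G z \<in> N" for z using F(2) cp unfolding G_def C_def by blast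
  have yN: "y t \<in> N" if "t \<in> {0..1}" for t
  proof -
    have "y t - y 0 \<in> N"
      by (rule solves_increment_in_subspace[OF y(2) _ _ that N]) (use GN in auto)
    from subspace_add[OF N this, of x0] show ?thesis using x0 y(1) by simp
  qed
  have "0 \<le> norm (G 0)" by simp
  then have M0: "0 \<le> M" using GM[of 0] by linarith
  have lip: "M-lipschitz_on {0..1} y"
    by (rule solves_lipschitz[OF y(2)]) (use GM M0 in auto)
  define d where "d = min 1 ((r - dist p x0) / (2 * (M + 1)))"
  have r: "dist p x0 < r" using x0 by simp
  have d: "0 < d" "d \<le> 1" "M * d < r - dist p x0"
  proof -
    show "0 < d" "d \<le> 1" using r M0 by (auto simp: d_def)
    have "M * d < (M + 1) * d" using \<open>0 < d\<close> by (simp add: algebra_simps)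
    also have "\<dots> \<le> (M + 1) * ((r - dist p x0) / (2 * (M + 1)))"
      using M0 by (intro mult_left_mono) (auto simp: d_def)
    also have "\<dots> = (r - dist p x0) / 2" using M0 by (simp add: field_simps)
    also have "\<dots> < r - dist p x0" using r by simp
    finally show "M * d < r - dist p x0" .
  qed
  have ball: "y t \<in> N \<inter> ball p r" if t: "t \<in> {0..d}" for t
  proof -
    have "dist (y t) (y 0) \<le> M * dist t 0" by (rule lipschitz_onD[OF lip]) (use t d in auto)
    also have "\<dots> \<le> M * d" using t M0 by (intro mult_left_mono) (auto simp: dist_real_def)
    finally have "dist p (y t) < r" using d(3) y(1) dist_triangle[of p "y t" x0]
      by (simp add: dist_commute)
    then show ?thesis using yN t d by auto
  qed
  have "solves F {0..d} y"
    unfolding solves_def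
  proof
    fix t assume t: "t \<in> {0..d}"
    have "y t \<in> C" using ball[OF t] by (auto simp: C_def)
    then have "G (y t) = F (y t)" by (simp add: G_def closest_point_self)
    moreover have "solves G {0..d} y" using solves_subset[OF y(2)] d by simp
    ultimately show "(y has_vector_derivative F (y t)) (at t within {0..d})"
      using t unfolding solves_def by metis
  qed
  with d(1) y(1) ball show ?thesis using that by blast
qed

text \<open>
  A bounded velocity makes \<open>z\<close> Lipschitz, so it has a limit at time \<open>T\<close>, in \<open>K\<close> and therefore inside the
  open ball. A solution starting there is appended.
\<close>

lemma solution_continuation:
  fixes F :: "'a::euclidean_space \<Rightarrow> 'a"
  assumes N: "subspace N" and F: "continuous_on (N \<inter> cball p r) F" "F ` (N \<inter> cball p r) \<subseteq> N"
    and K: "compact K" "K \<subseteq> N \<inter> ball p r"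
    and z: "0 < T" "solves F {0..<T} z" "z ` {0..<T} \<subseteq> K"
  obtains w d where "0 < d" "solves F {0..<T+d} w" "\<And>t. t \<in> {0..<T} \<Longrightarrow> w t = z t"
    "w ` {0..<T+d} \<subseteq> N \<inter> ball p r"
proof -
  have "compact (F ` (N \<inter> cball p r))"
    using closed_subspace[OF N] F by (intro compact_continuous_image closed_Int_compact) auto
  then have "bounded (F ` (N \<inter> cball p r))" by (rule compact_imp_bounded)
  then obtain M0 where M0: "\<And>z. z \<in> N \<inter> cball p r \<Longrightarrow> norm (F z) \<le> M0"
    unfolding bounded_iff image_iff by blast
  have KN: "u \<in> N \<inter> cball p r" if "u \<in> K" for u using that K(2) by auto
  have zK: "z t \<in> K" if "t \<in> {0..<T}" for t using z(3) that by blast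
  have "(max 0 M0)-lipschitz_on {0..<T} z"
  proof (rule solves_lipschitz[OF z(2)])
    show "norm (F (z t)) \<le> max 0 M0" if "t \<in> {0..<T}" for t
      using M0[OF KN[OF zK[OF that]]] by simp
  qed (auto simp: is_interval_co)
  then have "uniformly_continuous_on {0..<T} z" by (rule lipschitz_on_uniformly_continuous)
  then obtain g where g: "uniformly_continuous_on (closure {0..<T}) g" "\<And>t. t \<in> {0..<T} \<Longrightarrow> z t = g t"
    by (rule uniformly_continuous_on_extension_on_closure) blast
  have gc: "continuous_on {0..T} g"
    using uniformly_continuous_imp_continuous[OF g(1)] z(1) by simp
  have "g ` closure {0..<T} \<subseteq> K"
    using z(3) g(2) uniformly_continuous_imp_continuous[OF g(1)]
    by (intro image_closure_subset compact_imp_closed[OF K(1)]) auto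
  moreover have "T \<in> closure {0..<T}" using z(1) by simp
  ultimately have gT: "g T \<in> N \<inter> ball p r" using K(2) by blast
  obtain y d where d: "0 < d" and y: "y 0 = g T" "solves F {0..d} y"
    "\<And>t. t \<in> {0..d} \<Longrightarrow> y t \<in> N \<inter> ball p r"
    by (rule peano_in_ball[OF N F gT]) (iprover)
  define w where "w t = (if t \<le> T then g t else y (t - T))" for t
  have wz: "w t = z t" if "t \<in> {0..<T}" for t using that g(2) by (simp add: w_def)
  have wy: "w t = y (t - T)" if "T \<le> t" for t
    using that y(1) by (cases "t = T") (auto simp: w_def)
  have wball: "w t \<in> N \<inter> ball p r" if "t \<in> {0..T+d}" for t
  proof (cases "t < T")
    case True
    then show ?thesis using wz[of t] zK[of t] K(2) that by auto
  next
    case False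
    then show ?thesis using wy[of t] y(3)[of "t - T"] that by auto
  qed
  have "continuous_on ({0..T} \<union> {T..T+d}) w"
  proof (rule continuous_on_closed_Un)
    show "continuous_on {0..T} w"
      using gc by (rule continuous_on_eq) (simp add: w_def)
    have "continuous_on {T..T+d} (\<lambda>t. y (t - T))"
      by (intro continuous_on_compose2[OF solves_continuous_on[OF y(2)]] continuous_intros) auto
    then show "continuous_on {T..T+d} w" by (rule continuous_on_eq) (simp add: wy)
  qed auto
  moreover have "{0..T} \<union> {T..T+d} = {0..T+d}" using z(1) d by auto
  ultimately have wc: "continuous_on {0..T+d} w" by simp
  have Fw: "continuous_on {0..T+d} (\<lambda>t. F (w t))"
    by (rule continuous_on_compose2[OF F(1) wc]) (use wball ball_subset_cball in blast)
  have deriv: "(w has_vector_derivative F (w t)) (at t)" if "t \<in> {0<..<T+d} - {T}" for t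
  proof (cases "t < T")
    case True
    have "(z has_vector_derivative F (z t)) (at t within {0..<T})"
      using z(2) True that unfolding solves_def by auto
    then have "(z has_vector_derivative F (z t)) (at t)"
      using True that by (subst (asm) at_within_interior) (auto simp: interior_atLeastLessThan)
    then have "(w has_vector_derivative F (z t)) (at t)"
      by (rule has_vector_derivative_transform_within_open[of _ _ _ "{0<..<T}"])
         (use True that wz in auto)
    then show ?thesis using wz[of t] True that by simp
  next
    case False
    then have t: "T < t" "t < T + d" using that by auto
    have "(y has_vector_derivative F (y (t - T))) (at (t - T) within {0..d})"
      using y(2) t unfolding solves_def by auto
    then have "(y has_vector_derivative F (y (t - T))) (at (t - T))"
      using t by (subst (asm) at_within_interior) auto
    moreover have "((\<lambda>s. s - T) has_vector_derivative 1) (at t)"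
      by (auto intro!: derivative_eq_intros)
    ultimately have "((\<lambda>s. y (s - T)) has_vector_derivative F (y (t - T))) (at t)"
      using vector_diff_chain_at[of "\<lambda>s. s - T" 1 t y "F (y (t - T))"] by (simp add: o_def)
    then have "(w has_vector_derivative F (y (t - T))) (at t)"
      by (rule has_vector_derivative_transform_within_open[of _ _ _ "{T<..}"])
         (use t wy in auto)
    then show ?thesis using wy[of t] t by simp
  qed
  \<comment> \<open>At the junction \<open>T\<close> no derivative is known; the integral equation, which tolerates one exceptional point, supplies it.\<close>
  have "solves F {0..T+d} w"
  proof (rule solves_if_integral_equation[where c = "w 0"])
    show "continuous_on {0..T+d} (\<lambda>t. F (w t))" by (rule Fw)
    fix t assume t: "t \<in> {0..T+d}"
    show "((\<lambda>s. F (w s)) has_integral w t - w 0) {0..t}"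
    proof (rule fundamental_theorem_of_calculus_interior_strong[where S = "{T}"])
      show "continuous_on {0..t} w" by (rule continuous_on_subset[OF wc]) (use t in auto)
    qed (use t deriv in auto)
  qed
  then have "solves F {0..<T+d} w" by (rule solves_subset) auto
  then show ?thesis using that[OF d _ wz] wball by force
qed

section \<open>Lyapunov functions and limit sets\<close>

text \<open>
  Take for \<open>m\<close> the minimum of \<open>V\<close> on the sphere: a curve that starts in the ball below the level \<open>m\<close> would
  have to reach that level when it first meets the sphere. Monotonicity of \<open>V\<close> along the curve is only
  assumed up to times before which the curve stays in the closed ball, where solutions are under control.
\<close>

lemma lyapunov_trapping:
  fixes V :: "'a::euclidean_space \<Rightarrow> real"
  assumes N: "closed N" and V: "continuous_on (N \<inter> cball p r) V"
    and pos: "\<And>z. z \<in> N \<inter> cball p r \<Longrightarrow> z \<noteq> p \<Longrightarrow> V p < V z" and r: "0 < r"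
  obtains m where "V p < m" "\<And>u. u \<in> N \<inter> cball p r \<Longrightarrow> V u < m \<Longrightarrow> u \<in> ball p r"
    "\<And>(T::real) z. \<lbrakk>0 \<le> T; continuous_on {0..T} z; z ` {0..T} \<subseteq> N; z 0 \<in> ball p r; V (z 0) < m;
       \<And>s. 0 \<le> s \<Longrightarrow> s \<le> T \<Longrightarrow> z ` {0..s} \<subseteq> cball p r \<Longrightarrow> V (z s) \<le> V (z 0)\<rbrakk>
      \<Longrightarrow> z T \<in> ball p r \<and> V (z T) \<le> V (z 0)"
proof -
  have "\<exists>m>V p. \<forall>z\<in>N \<inter> sphere p r. m \<le> V z"
  proof (cases "N \<inter> sphere p r = {}")
    case True
    then show ?thesis by (intro exI[of _ "V p + 1"]) auto
  next
    case False
    have "continuous_on (N \<inter> sphere p r) V" by (rule continuous_on_subset[OF V]) auto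
    moreover have "compact (N \<inter> sphere p r)" using N by (simp add: closed_Int_compact)
    ultimately obtain u where u: "u \<in> N \<inter> sphere p r" "\<forall>z\<in>N \<inter> sphere p r. V u \<le> V z"
      using continuous_attains_inf[of "N \<inter> sphere p r" V] False by blast
    then have "V p < V u" using r by (intro pos) auto
    with u(2) show ?thesis by blast
  qed
  then obtain m where m: "V p < m" "\<And>z. z \<in> N \<inter> sphere p r \<Longrightarrow> m \<le> V z" by blast
  show ?thesis
  proof (rule that[OF m(1)])
    show "u \<in> ball p r" if "u \<in> N \<inter> cball p r" "V u < m" for u
      using that m(2)[of u] by fastforce
  next
    fix T :: real and z :: "real \<Rightarrow> 'a"
    assume T: "0 \<le> T" and z: "continuous_on {0..T} z" "z ` {0..T} \<subseteq> N" "z 0 \<in> ball p r" "V (z 0) < m"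
      and dec: "\<And>s. 0 \<le> s \<Longrightarrow> s \<le> T \<Longrightarrow> z ` {0..s} \<subseteq> cball p r \<Longrightarrow> V (z s) \<le> V (z 0)"
    define f where "f s = dist p (z s)" for s
    have f: "continuous_on {0..T} f" unfolding f_def by (intro continuous_intros z)
    have "f s < r" if s: "s \<in> {0..T}" for s
    proof (rule ccontr)
      assume "\<not> f s < r"
      define A where "A = {s \<in> {0..T}. f s = r}"
      have ivt: "\<exists>s'\<in>A. s' \<le> s" if "s \<in> {0..T}" "r \<le> f s" for s
      proof -
        have "\<exists>x\<ge>0. x \<le> s \<and> f x = r"
          using that z(3) by (intro IVT' continuous_on_subset[OF f]) (auto simp: f_def)
        then show ?thesis using that by (auto simp: A_def)
      qed
      have "compact A"
      proof -
        have "closed A" unfolding A_def using continuous_closed_preimage_constant[OF f] by simp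
        moreover have "A = A \<inter> {0..T}" by (auto simp: A_def)
        ultimately show ?thesis by (metis closed_Int_compact compact_Icc)
      qed
      moreover have "A \<noteq> {}" using ivt[OF s] \<open>\<not> f s < r\<close> by auto
      ultimately have "\<exists>s1\<in>A. \<forall>s\<in>A. s1 \<le> s" by (rule compact_attains_inf)
      then obtain s1 where s1: "s1 \<in> A" "\<And>s. s \<in> A \<Longrightarrow> s1 \<le> s" by blast
      have "f s \<le> r" if "s \<in> {0..s1}" for s
      proof (rule ccontr)
        assume "\<not> f s \<le> r"
        moreover have "s \<in> {0..T}" using that s1(1) by (auto simp: A_def)
        ultimately obtain s' where "s' \<in> A" "s' \<le> s" using ivt[of s] by auto
        then have "s = s1" using s1(2)[of s'] that by auto
        then show False using s1(1) \<open>\<not> f s \<le> r\<close> by (simp add: A_def)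
      qed
      then have "z ` {0..s1} \<subseteq> cball p r" by (auto simp: f_def)
      then have "V (z s1) \<le> V (z 0)" using s1(1) by (intro dec) (simp_all add: A_def)
      moreover have "z s1 \<in> N" using s1(1) z(2) by (auto simp: A_def)
      then have "m \<le> V (z s1)" using s1(1) by (intro m(2)) (simp add: A_def f_def)
      ultimately show False using z(4) by simp
    qed
    then have "z ` {0..T} \<subseteq> ball p r" by (auto simp: f_def)
    moreover from this have "z ` {0..T} \<subseteq> cball p r" using ball_subset_cball by blast
    ultimately show "z T \<in> ball p r \<and> V (z T) \<le> V (z 0)"
      using dec[of T] T by (auto simp: image_subset_iff)
  qed
qed

text \<open>
  The invariance principle. The solution seen from the times \<open>\<sigma> n\<close> is defined on intervals
  \<open>[-\<sigma> n, \<infinity>)\<close> that exhaust the line, so a subsequence converges to a complete solution. On the limit \<open>V\<close> is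
  constant because along \<open>z\<close> it is nonincreasing.
\<close>

lemma omega_limit_complete_solution:
  fixes F :: "'a::euclidean_space \<Rightarrow> 'a" and V :: "'a \<Rightarrow> real"
  assumes F: "continuous_on K F" "compact K" and z: "solves F {0..} z" "z ` {0..} \<subseteq> K"
    and V: "continuous_on K V" "\<And>s t. 0 \<le> s \<Longrightarrow> s \<le> t \<Longrightarrow> V (z t) \<le> V (z s)"
    and \<sigma>: "filterlim \<sigma> at_top sequentially" "(\<lambda>n. z (\<sigma> n)) \<longlonglongrightarrow> q"
  obtains y where "solves F UNIV y" "y 0 = q" "\<And>t. y t \<in> K" "\<And>t. V (y t) = V q"
proof -
  have zK: "z t \<in> K" if "0 \<le> t" for t using z(2) that by auto
  have "bounded (F ` K)" by (intro compact_imp_bounded compact_continuous_image F)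
  then obtain M0 where M0: "\<And>u. u \<in> K \<Longrightarrow> norm (F u) \<le> M0" unfolding bounded_iff image_iff by blast
  define M where "M = max 0 M0"
  have lz: "M-lipschitz_on {0..} z"
  proof (rule solves_lipschitz[OF z(1)])
    show "norm (F (z t)) \<le> M" if "t \<in> {0..}" for t
      using M0[OF zK[of t]] that by (simp add: M_def)
  qed (auto simp: is_interval_ci M_def)
  define x where "x n s = z (max 0 (\<sigma> n + s))" for n s
  have lip: "M-lipschitz_on UNIV (x n)" for n
  proof (rule lipschitz_onI)
    fix a b :: real
    have "dist (x n a) (x n b) \<le> M * dist (max 0 (\<sigma> n + a)) (max 0 (\<sigma> n + b))"
      unfolding x_def by (rule lipschitz_onD[OF lz]) auto
    also have "\<dots> \<le> M * dist a b" by (intro mult_left_mono) (auto simp: dist_real_def M_def)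
    finally show "dist (x n a) (x n b) \<le> M * dist a b" .
  qed (simp add: M_def)
  have xK: "x n s \<in> K" for n s unfolding x_def by (rule zK) simp
  have large: "\<forall>\<^sub>F n in sequentially. c \<le> \<sigma> n" for c
    using \<sigma>(1) unfolding filterlim_at_top by blast
  have sol: "\<forall>\<^sub>F n in sequentially. solves F {a..b} (x n)" for a b
    using large[of "- a"]
  proof eventually_elim
    case (elim n)
    have xz: "x n s = z (\<sigma> n + s)" if "s \<in> {a..b}" for s using that elim by (simp add: x_def)
    show ?case unfolding solves_def
    proof
      fix s assume s: "s \<in> {a..b}"
      have "((\<lambda>s. \<sigma> n + s) has_vector_derivative 1) (at s within {a..b})"
        by (auto intro!: derivative_eq_intros)
      moreover have "(z has_vector_derivative F (z (\<sigma> n + s))) (at (\<sigma> n + s) within (\<lambda>s. \<sigma> n + s) ` {a..b})"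
        using solves_subset[OF z(1), of "(\<lambda>s. \<sigma> n + s) ` {a..b}"] s elim unfolding solves_def by auto
      ultimately have "((\<lambda>s. z (\<sigma> n + s)) has_vector_derivative F (z (\<sigma> n + s))) (at s within {a..b})"
        using vector_diff_chain_within[of "\<lambda>s. \<sigma> n + s" 1 s "{a..b}" z] by (simp add: o_def)
      then show "(x n has_vector_derivative F (x n s)) (at s within {a..b})"
        unfolding xz[OF s] by (rule has_vector_derivative_transform[OF s xz, rotated])
    qed
  qed
  obtain k y where k: "strict_mono (k :: nat \<Rightarrow> nat)" and y: "solves F UNIV y"
    "\<And>t. y t \<in> K" "\<And>t. (\<lambda>n. x (k n) t) \<longlonglongrightarrow> y t"
    by (rule complete_solution_limit[OF F lip xK sol]) (iprover)
  have \<sigma>k: "\<forall>\<^sub>F n in sequentially. c \<le> \<sigma> (k n)" for c by (rule eventually_subseq[OF k large])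
  have "(\<lambda>n. x (k n) 0) \<longlonglongrightarrow> q"
  proof (rule Lim_transform_eventually)
    show "(\<lambda>n. z (\<sigma> (k n))) \<longlonglongrightarrow> q" using LIMSEQ_subseq_LIMSEQ[OF \<sigma>(2) k] by (simp add: o_def)
    show "\<forall>\<^sub>F n in sequentially. z (\<sigma> (k n)) = x (k n) 0"
      using \<sigma>k[of 0] by eventually_elim (simp add: x_def)
  qed
  then have y0: "y 0 = q" using y(3) LIMSEQ_unique by blast
  have Vlim: "(\<lambda>n. V (x (k n) s)) \<longlonglongrightarrow> V (y s)" for s
    using continuous_on_tendsto_compose[OF V(1) y(3) y(2)] xK by simp
  \<comment> \<open>Whatever the order of \<open>s\<close> and \<open>s'\<close>, the time \<open>\<sigma> n' + s'\<close> is later than \<open>\<sigma> n + s\<close> for all large \<open>n'\<close>.\<close>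
  have le: "V (y s') \<le> V (y s)" for s s'
  proof -
    have "V (y s') \<le> V (x (k n) s)" for n
    proof (rule tendsto_upperbound[OF Vlim])
      show "\<forall>\<^sub>F n' in sequentially. V (x (k n') s') \<le> V (x (k n) s)"
        using \<sigma>k[of "max 0 (\<sigma> (k n) + s) - s'"]
        by eventually_elim (auto simp: x_def intro!: V(2))
    qed simp
    then show ?thesis by (intro tendsto_lowerbound[OF Vlim]) auto
  qed
  have "V (y t) = V q" for t using le[of t 0] le[of 0 t] y0 by simp
  with y(1,2) y0 show ?thesis using that by blast
qed

lemma tendsto_if_unique_limit_point:
  fixes z :: "real \<Rightarrow> 'a::metric_space"
  assumes K: "compact K" "\<And>t. 0 \<le> t \<Longrightarrow> z t \<in> K"
    and uniq: "\<And>\<sigma> q. filterlim \<sigma> at_top sequentially \<Longrightarrow> (\<lambda>n. z (\<sigma> n)) \<longlonglongrightarrow> q \<Longrightarrow> q = p"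
  shows "(z \<longlongrightarrow> p) at_top"
proof (rule tendstoI, rule ccontr)
  fix e :: real
  assume e: "0 < e" and "\<not> (\<forall>\<^sub>F t in at_top. dist (z t) p < e)"
  then have "\<exists>t\<ge>real n. e \<le> dist (z t) p" for n
    unfolding eventually_at_top_linorder by (auto simp: not_less)
  then obtain \<sigma> where \<sigma>: "\<And>n. real n \<le> \<sigma> n" "\<And>n. e \<le> dist (z (\<sigma> n)) p" by metis
  have \<sigma>_top: "filterlim \<sigma> at_top sequentially"
    by (rule filterlim_at_top_mono[OF filterlim_real_sequentially]) (simp add: \<sigma>)
  have "0 \<le> \<sigma> n" for n using \<sigma>(1)[of n] by (rule order_trans[rotated]) simp
  then have "\<forall>n. z (\<sigma> n) \<in> K" using K(2) by blast
  then obtain q k where k: "strict_mono (k :: nat \<Rightarrow> nat)" "((\<lambda>n. z (\<sigma> n)) \<circ> k) \<longlonglongrightarrow> q"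
    using K(1) unfolding compact_def by meson
  have "q = p"
  proof (rule uniq)
    show "filterlim (\<lambda>n. \<sigma> (k n)) at_top sequentially"
      using filterlim_compose[OF \<sigma>_top filterlim_subseq[OF k(1)]] .
    show "(\<lambda>n. z (\<sigma> (k n))) \<longlonglongrightarrow> q" using k(2) by (simp add: o_def)
  qed
  then have "(\<lambda>n. dist (z (\<sigma> (k n))) p) \<longlonglongrightarrow> 0"
    using k(2) tendsto_dist[of _ q sequentially "\<lambda>_. p" p] by (simp add: o_def)
  then have "e \<le> 0" by (rule LIMSEQ_le_const) (use \<sigma>(2) in auto)
  then show False using e by simp
qed

section \<open>Input-output systems\<close>

lemma locally_lipschitz_imp_continuous_on:
  assumes "locally_lipschitz_on S f"
  shows "continuous_on S f"
  unfolding continuous_on_eq_continuous_within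
proof
  fix z assume "z \<in> S"
  with assms obtain e K where e: "e > 0" "K-lipschitz_on (cball z e \<inter> S) f"
    unfolding locally_lipschitz_on_def by blast
  have "continuous (at z within cball z e \<inter> S) f"
    using lipschitz_on_continuous_on[OF e(2)] \<open>z \<in> S\<close> e(1)
    by (simp add: continuous_on_eq_continuous_within)
  moreover have "at z within (cball z e \<inter> S) = at z within S"
    by (rule at_within_nhd[of z "ball z e"]) (use e(1) in auto)
  ultimately show "continuous (at z within S) f" by (simp add: continuous_within)
qed

lemma admissible_io_systemD:
  assumes "admissible_io_system sys"
  shows "subspace (io_states sys)"
    and "x \<in> io_states sys \<Longrightarrow> io_dyn sys x u \<in> io_states sys"
    and "continuous_on (io_states sys \<times> UNIV) (\<lambda>(x, u). io_dyn sys x u)"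
    and "continuous_on (io_states sys \<times> UNIV) (\<lambda>(x, u). io_out sys x u)"
    and "locally_asymptotically_stable sys u (io_kx sys u)"
    and "is_equilibrium_point sys u x \<longleftrightarrow> x = io_kx sys u"
proof -
  show "subspace (io_states sys)" "x \<in> io_states sys \<Longrightarrow> io_dyn sys x u \<in> io_states sys"
    "continuous_on (io_states sys \<times> UNIV) (\<lambda>(x, u). io_dyn sys x u)"
    "continuous_on (io_states sys \<times> UNIV) (\<lambda>(x, u). io_out sys x u)"
    using assms unfolding admissible_io_system_def
    by (auto intro: locally_lipschitz_imp_continuous_on)
  obtain xb where xb: "locally_asymptotically_stable sys u xb"
    "\<And>x. is_equilibrium_point sys u x \<Longrightarrow> x = xb"
    using assms unfolding admissible_io_system_def by blast
  then have eq: "is_equilibrium_point sys u x \<longleftrightarrow> x = xb" for x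
    unfolding locally_asymptotically_stable_def by blast
  then have "io_kx sys u = xb" unfolding io_kx_def by (intro the_equality) auto
  with xb(1) eq show "locally_asymptotically_stable sys u (io_kx sys u)"
    "is_equilibrium_point sys u x \<longleftrightarrow> x = io_kx sys u" by simp_all
qed

lemma continuous_on_io:
  assumes "admissible_io_system sys" "continuous_on A x" "continuous_on A u"
    "\<And>a. a \<in> A \<Longrightarrow> x a \<in> io_states sys"
  shows "continuous_on A (\<lambda>a. io_dyn sys (x a) (u a))"
    and "continuous_on A (\<lambda>a. io_out sys (x a) (u a))"
proof -
  have *: "continuous_on A (\<lambda>a. (x a, u a))" by (intro continuous_intros assms)
  have im: "(\<lambda>a. (x a, u a)) ` A \<subseteq> io_states sys \<times> UNIV" using assms(4) by auto
  show "continuous_on A (\<lambda>a. io_dyn sys (x a) (u a))"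
    using continuous_on_compose2[OF admissible_io_systemD(3)[OF assms(1)] * im] by simp
  show "continuous_on A (\<lambda>a. io_out sys (x a) (u a))"
    using continuous_on_compose2[OF admissible_io_systemD(4)[OF assms(1)] * im] by simp
qed

text \<open>
  If a complete solution is off the equilibrium at some time then, by stability, it has been
  bounded away from it at all earlier times. The solution seen from times tending to \<open>-\<infinity>\<close> then
  has a limit that is a solution near the equilibrium, bounded away from it for ever, in contradiction
  to attractivity.
\<close>

lemma complete_solution_near_stable_equilibrium:
  assumes sys: "admissible_io_system sys"
  obtains d where "0 < d"
    "\<And>y t. \<lbrakk>solves (\<lambda>x. io_dyn sys x u) UNIV y; \<And>t. y t \<in> io_states sys;
       \<And>t. dist (y t) (io_kx sys u) \<le> d\<rbrakk> \<Longrightarrow> y t = io_kx sys u"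
proof -
  define p where "p = io_kx sys u"
  define F where "F x = io_dyn sys x u" for x
  have las: "locally_asymptotically_stable sys u p"
    unfolding p_def by (rule admissible_io_systemD(5)[OF sys])
  then obtain a where a: "0 < a" "\<And>x. const_input_solution sys u \<infinity> x \<Longrightarrow> dist (x 0) p < a \<Longrightarrow> (x \<longlongrightarrow> p) at_top"
    unfolding locally_asymptotically_stable_def by blast
  define K where "K = io_states sys \<inter> cball p (a / 2)"
  have K: "compact K" unfolding K_def
    using closed_subspace[OF admissible_io_systemD(1)[OF sys]] by (simp add: closed_Int_compact)
  have F: "continuous_on K F" unfolding F_def[abs_def]
    by (rule continuous_on_io(1)[OF sys]) (auto simp: K_def intro: continuous_intros)
  then have "bounded (F ` K)" using K by (intro compact_imp_bounded compact_continuous_image)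
  then obtain M0 where M0: "\<And>x. x \<in> K \<Longrightarrow> norm (F x) \<le> M0" unfolding bounded_iff image_iff by blast
  have const: "const_input_solution sys u \<infinity> (\<lambda>t. y (t + c))"
    if "solves F UNIV y" "\<And>t. y t \<in> K" for y c
  proof -
    have "solves F {0..} (\<lambda>t. y (t + c))"
      using solves_subset[OF solves_shift[OF that(1)]] by simp
    moreover have "time_interval \<infinity> = {0..}" by (auto simp: time_interval_def)
    ultimately show ?thesis using that(2)
      by (auto simp: const_input_solution_def solves_def F_def K_def)
  qed
  have main: "y s0 = p" if y: "solves F UNIV y" and yK: "\<And>t. y t \<in> K" for y s0
  proof (rule ccontr)
    assume "y s0 \<noteq> p"
    define e where "e = dist (y s0) p"
    have "e > 0" using \<open>y s0 \<noteq> p\<close> by (simp add: e_def)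
    moreover have "\<forall>e>0. \<exists>d>0. \<forall>\<tau> x. 0 < \<tau> \<and> const_input_solution sys u \<tau> x \<and> dist (x 0) p < d \<longrightarrow>
        (\<forall>t\<in>time_interval \<tau>. dist (x t) p < e)"
      using las unfolding locally_asymptotically_stable_def by (elim conjE)
    ultimately obtain d where d: "0 < d" "\<And>\<tau> x t. \<lbrakk>0 < \<tau>; const_input_solution sys u \<tau> x; dist (x 0) p < d;
        t \<in> time_interval \<tau>\<rbrakk> \<Longrightarrow> dist (x t) p < e"
      by meson
    have away: "d \<le> dist (y s) p" if "s \<le> s0" for s
    proof (rule ccontr)
      assume "\<not> d \<le> dist (y s) p"
      then have "dist (y ((s0 - s) + s)) p < e"
        using that by (intro d(2)[OF _ const[OF y yK, of s]]) (auto simp: time_interval_def)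
      then show False by (simp add: e_def)
    qed
    define x where "x n t = y (t + (s0 - real n))" for n t
    have "solves F UNIV (x n)" for n unfolding x_def by (rule solves_shift[OF y])
    moreover have xK: "x n t \<in> K" for n t by (simp add: x_def yK)
    moreover have "(max 0 M0)-lipschitz_on UNIV (x n)" for n
      by (rule solves_lipschitz[OF calculation(1)]) (use M0[OF xK] in \<open>auto intro: max.coboundedI2\<close>)
    ultimately obtain k Y where k: "strict_mono (k :: nat \<Rightarrow> nat)" and Y: "solves F UNIV Y"
      "\<And>t. Y t \<in> K" "\<And>t. (\<lambda>n. x (k n) t) \<longlonglongrightarrow> Y t"
      using complete_solution_limit[OF F K, of "max 0 M0" x] solves_subset[of F UNIV]
      by (smt (verit, best) always_eventually subset_UNIV)
    have Y_away: "d \<le> dist (Y t) p" for t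
    proof (rule tendsto_lowerbound)
      show "(\<lambda>n. dist (x (k n) t) p) \<longlonglongrightarrow> dist (Y t) p" by (intro tendsto_intros Y)
      obtain m where "t \<le> real m" using real_arch_simple by blast
      have "\<forall>\<^sub>F n in sequentially. m \<le> k n"
        using eventually_subseq[OF k eventually_ge_at_top[of m]] .
      then show "\<forall>\<^sub>F n in sequentially. d \<le> dist (x (k n) t) p"
      proof eventually_elim
        case (elim n)
        then have "t \<le> real (k n)" using \<open>t \<le> real m\<close> by linarith
        then show ?case unfolding x_def by (intro away) simp
      qed
    qed simp
    have "dist (Y 0) p < a" using Y(2)[of 0] a(1) by (simp add: K_def dist_commute)
    then have "(Y \<longlongrightarrow> p) at_top" using a(2)[OF const[OF Y(1,2), of 0]] by simp
    then have "((\<lambda>t. dist (Y t) p) \<longlongrightarrow> dist p p) at_top" by (intro tendsto_intros)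
    then have "d \<le> dist p p" by (rule tendsto_lowerbound) (use Y_away in auto)
    then show False using d(1) by simp
  qed
  show ?thesis
  proof (rule that[of "a / 2"])
    fix y t assume "solves (\<lambda>x. io_dyn sys x u) UNIV y" "\<And>t. y t \<in> io_states sys"
      "\<And>t. dist (y t) (io_kx sys u) \<le> a / 2"
    then show "y t = io_kx sys u" unfolding p_def[symmetric]
      by (intro main) (auto simp: F_def[abs_def] K_def dist_commute)
  qed (use a(1) in simp)
qed

section \<open>Storage functions of passive systems\<close>

text \<open>
  Only directions in the subspace are tested, since \<open>V\<close> is differentiable relative to it.
\<close>

lemma gradient_zero_at_min:
  fixes V :: "'x::euclidean_space \<Rightarrow> real"
  assumes S: "subspace S" "openin (top_of_set S) X" "xb \<in> X" "v \<in> S"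
    and V: "(V has_derivative (\<lambda>h. g \<bullet> h)) (at xb within X)" "\<And>x. x \<in> X \<Longrightarrow> V xb \<le> V x"
  shows "g \<bullet> v = 0"
proof -
  have xbS: "xb \<in> S" using S openin_imp_subset by blast
  obtain e where e: "e > 0" "\<And>x. x \<in> S \<Longrightarrow> dist x xb < e \<Longrightarrow> x \<in> X"
    using S(2,3) unfolding openin_euclidean_subtopology_iff by blast
  define d where "d = e / (norm v + 1)"
  have d: "d > 0" using e(1) by (simp add: d_def add_nonneg_pos)
  have X: "xb + t *\<^sub>R v \<in> X" if "\<bar>t\<bar> < d" for t
  proof (rule e(2))
    show "xb + t *\<^sub>R v \<in> S" using S xbS by (simp add: subspace_add subspace_scale)
    have "\<bar>t\<bar> * norm v \<le> \<bar>t\<bar> * (norm v + 1)" by (simp add: mult_left_mono)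
    also have "\<dots> < d * (norm v + 1)" using that by (intro mult_strict_right_mono) (auto simp: add_nonneg_pos)
    also have "\<dots> = e" by (simp add: d_def add_nonneg_eq_0_iff)
    finally show "dist (xb + t *\<^sub>R v) xb < e" by (simp add: dist_norm)
  qed
  have line: "((\<lambda>t. xb + t *\<^sub>R v) has_derivative (\<lambda>t. t *\<^sub>R v)) (at 0 within ball 0 d)"
    by (auto intro!: derivative_eq_intros)
  have "(V has_derivative (\<lambda>h. g \<bullet> h)) (at (xb + 0 *\<^sub>R v) within (\<lambda>t. xb + t *\<^sub>R v) ` ball 0 d)"
  proof -
    have "(\<lambda>t. xb + t *\<^sub>R v) ` ball 0 d \<subseteq> X" using X by auto
    then show ?thesis using has_derivative_subset[OF V(1)] by simp
  qed
  from has_derivative_in_compose[OF line this]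
  have "((\<lambda>t. V (xb + t *\<^sub>R v)) has_derivative (\<lambda>t. g \<bullet> (t *\<^sub>R v))) (at 0 within ball 0 d)" .
  moreover have "at 0 within ball 0 d = at (0::real)" using d by (intro at_within_open) auto
  moreover have "(\<lambda>t. t * (g \<bullet> v)) = (*) (g \<bullet> v)" by (auto simp: mult.commute)
  ultimately have "((\<lambda>t. V (xb + t *\<^sub>R v)) has_real_derivative g \<bullet> v) (at 0)"
    by (simp add: has_field_derivative_def)
  then show ?thesis
    by (rule DERIV_local_min[OF _ d]) (use X V(2) in auto)
qed

text \<open>
  Passivity and strict minimality in terms of a larger space \<open>N\<close>, of which the state of \<open>sys\<close> is a linear
  image, with one radius for states and inputs. The last
  conclusion is the dissipation inequality at the equilibrium state, where the gradient of the
  storage function vanishes: the output lies on the same side of its equilibrium value as the input.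
\<close>

lemma passive_storage_near:
  fixes sys :: "'s::euclidean_space io_system" and \<pi> :: "'z::euclidean_space \<Rightarrow> 's"
  assumes psv: "locally_input_strictly_passive sys ub xb V"
    and min: "strict_local_min_on (io_states sys) V xb"
    and sys: "subspace (io_states sys)" "\<And>x u. x \<in> io_states sys \<Longrightarrow> io_dyn sys x u \<in> io_states sys"
    and \<pi>: "bounded_linear \<pi>" "\<pi> ` N \<subseteq> io_states sys" "\<pi> zs = xb"
  obtains \<rho> where "0 < \<rho>" "continuous_on (N \<inter> cball zs \<rho>) (\<lambda>z. V (\<pi> z))" "V xb = 0"
    "\<And>z. z \<in> N \<inter> cball zs \<rho> \<Longrightarrow> 0 \<le> V (\<pi> z)"
    "\<And>z. z \<in> N \<inter> cball zs \<rho> \<Longrightarrow> V (\<pi> z) = 0 \<Longrightarrow> \<pi> z = xb"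
    "\<And>I y t v u. \<lbrakk>y ` I \<subseteq> N \<inter> cball zs \<rho>; t \<in> I; (y has_vector_derivative v) (at t within I);
        \<pi> v = io_dyn sys (\<pi> (y t)) u; \<bar>u - ub\<bar> \<le> \<rho>\<rbrakk> \<Longrightarrow>
      \<exists>D. ((\<lambda>s. V (\<pi> (y s))) has_real_derivative D) (at t within I) \<and>
        D \<le> (u - ub) * (io_out sys (\<pi> (y t)) u - io_ky sys ub) \<and>
        (u \<noteq> ub \<longrightarrow> D < (u - ub) * (io_out sys (\<pi> (y t)) u - io_ky sys ub))"
    "\<And>u. \<bar>u - ub\<bar> \<le> \<rho> \<Longrightarrow> u \<noteq> ub \<Longrightarrow> 0 < (u - ub) * (io_out sys xb u - io_ky sys ub)"
proof -
  obtain U X g \<phi> where *: "open U \<and> ub \<in> U \<and> openin (top_of_set (io_states sys)) X \<and> xb \<in> X \<and>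
      continuous_on X g \<and> (\<forall>x\<in>X. (V has_derivative (\<lambda>h. g x \<bullet> h)) (at x within X)) \<and>
      V xb = 0 \<and> (\<forall>x\<in>X. 0 \<le> V x) \<and> \<phi> 0 = (0::real) \<and> (\<forall>z::real. z \<noteq> 0 \<longrightarrow> 0 < \<phi> z) \<and>
      (\<forall>u\<in>U. \<forall>x\<in>X.
        g x \<bullet> io_dyn sys x u \<le> (u - ub) * (io_out sys x u - io_ky sys ub) - \<phi> (u - ub))"
    using psv unfolding locally_input_strictly_passive_def by (elim exE) (rule that)
  then have U: "open U" "ub \<in> U" and X: "openin (top_of_set (io_states sys)) X" "xb \<in> X"
    and V: "\<And>x. x \<in> X \<Longrightarrow> (V has_derivative (\<lambda>h. g x \<bullet> h)) (at x within X)" "V xb = 0"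
      "\<And>x. x \<in> X \<Longrightarrow> 0 \<le> V x"
    and \<phi>: "\<phi> 0 = (0::real)" "\<And>z::real. z \<noteq> 0 \<Longrightarrow> 0 < \<phi> z"
    and diss: "\<And>u x. u \<in> U \<Longrightarrow> x \<in> X \<Longrightarrow>
      g x \<bullet> io_dyn sys x u \<le> (u - ub) * (io_out sys x u - io_ky sys ub) - \<phi> (u - ub)"
    by simp_all
  obtain W where W: "openin (top_of_set (io_states sys)) W" "xb \<in> W" "\<And>x. x \<in> W - {xb} \<Longrightarrow> V xb < V x"
    using min unfolding strict_local_min_on_def by blast
  have "openin (top_of_set (io_states sys)) (X \<inter> W)" using X W by blast
  then obtain e where e: "e > 0" "\<And>x. x \<in> io_states sys \<Longrightarrow> dist x xb < e \<Longrightarrow> x \<in> X \<inter> W"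
    using X(2) W(2) unfolding openin_euclidean_subtopology_iff by blast
  obtain a where a: "a > 0" "\<And>u. dist u ub < a \<Longrightarrow> u \<in> U"
    using U unfolding open_dist by blast
  obtain B where B: "B > 0" "\<And>z. norm (\<pi> z) \<le> norm z * B"
    using bounded_linear.pos_bounded[OF \<pi>(1)] by blast
  define \<rho> where "\<rho> = min (a / 2) (e / (2 * B))"
  have \<rho>: "0 < \<rho>" "\<rho> < a" "\<rho> * B < e"
  proof -
    show "0 < \<rho>" "\<rho> < a" using a e B by (auto simp: \<rho>_def)
    have "\<rho> * B \<le> e / (2 * B) * B" using B by (intro mult_right_mono) (auto simp: \<rho>_def)
    also have "\<dots> < e" using B e by simp
    finally show "\<rho> * B < e" .
  qed
  have near: "\<pi> z \<in> X \<inter> W" if "z \<in> N \<inter> cball zs \<rho>" for z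
  proof (rule e(2))
    show "\<pi> z \<in> io_states sys" using \<pi>(2) that by auto
    have "dist (\<pi> z) xb = norm (\<pi> (z - zs))"
      using \<pi>(3) bounded_linear.linear[OF \<pi>(1)] by (simp add: dist_norm linear_diff)
    also have "\<dots> \<le> norm (z - zs) * B" by (rule B)
    also have "\<dots> \<le> \<rho> * B" using that B by (intro mult_right_mono) (auto simp: dist_norm norm_minus_commute)
    finally show "dist (\<pi> z) xb < e" using \<rho>(3) by simp
  qed
  have u_in: "u \<in> U" if "\<bar>u - ub\<bar> \<le> \<rho>" for u using a(2)[of u] that \<rho>(2) by (simp add: dist_real_def)
  have Vc: "continuous_on X V"
    using V(1) has_derivative_continuous unfolding continuous_on_eq_continuous_within by blast
  show ?thesis
  proof (rule that[of \<rho>])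
    show "continuous_on (N \<inter> cball zs \<rho>) (\<lambda>z. V (\<pi> z))"
      by (rule continuous_on_compose2[OF Vc linear_continuous_on[OF \<pi>(1)]]) (use near in auto)
    show "0 \<le> V (\<pi> z)" if "z \<in> N \<inter> cball zs \<rho>" for z using near[OF that] V(3) by auto
    show "\<pi> z = xb" if "z \<in> N \<inter> cball zs \<rho>" "V (\<pi> z) = 0" for z
      using near[OF that(1)] W(3)[of "\<pi> z"] V(2) that(2) by auto
    show "\<exists>D. ((\<lambda>s. V (\<pi> (y s))) has_real_derivative D) (at t within I) \<and>
        D \<le> (u - ub) * (io_out sys (\<pi> (y t)) u - io_ky sys ub) \<and>
        (u \<noteq> ub \<longrightarrow> D < (u - ub) * (io_out sys (\<pi> (y t)) u - io_ky sys ub))"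
      if y: "y ` I \<subseteq> N \<inter> cball zs \<rho>" "t \<in> I" "(y has_vector_derivative v) (at t within I)"
        "\<pi> v = io_dyn sys (\<pi> (y t)) u" "\<bar>u - ub\<bar> \<le> \<rho>" for I y t v u
    proof (intro exI conjI)
      have "((\<lambda>s. \<pi> (y s)) has_vector_derivative \<pi> v) (at t within I)"
        by (rule bounded_linear.has_vector_derivative[OF \<pi>(1) y(3)])
      moreover have "(V has_derivative (\<lambda>h. g (\<pi> (y t)) \<bullet> h)) (at (\<pi> (y t)) within (\<lambda>s. \<pi> (y s)) ` I)"
        by (rule has_derivative_subset[OF V(1)]) (use near y in blast)+
      ultimately show "((\<lambda>s. V (\<pi> (y s))) has_real_derivative g (\<pi> (y t)) \<bullet> \<pi> v) (at t within I)"
        using vector_derivative_diff_chain_within[of "\<lambda>s. \<pi> (y s)" "\<pi> v" t I V]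
        by (simp add: has_real_derivative_iff_has_vector_derivative o_def)
      have "\<pi> (y t) \<in> X" using near y by blast
      from diss[OF u_in[OF y(5)] this]
      have le: "g (\<pi> (y t)) \<bullet> \<pi> v \<le> (u - ub) * (io_out sys (\<pi> (y t)) u - io_ky sys ub) - \<phi> (u - ub)"
        using y(4) by simp
      then show "g (\<pi> (y t)) \<bullet> \<pi> v \<le> (u - ub) * (io_out sys (\<pi> (y t)) u - io_ky sys ub)"
        using \<phi>(1) \<phi>(2)[of "u - ub"] by (cases "u = ub") auto
      show "u \<noteq> ub \<longrightarrow> g (\<pi> (y t)) \<bullet> \<pi> v < (u - ub) * (io_out sys (\<pi> (y t)) u - io_ky sys ub)"
        using le \<phi>(2)[of "u - ub"] by auto
    qed
    show "0 < (u - ub) * (io_out sys xb u - io_ky sys ub)" if "\<bar>u - ub\<bar> \<le> \<rho>" "u \<noteq> ub" for u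
    proof -
      have "xb \<in> io_states sys" using X openin_imp_subset by blast
      then have "g xb \<bullet> io_dyn sys xb u = 0"
        using V X sys by (intro gradient_zero_at_min[OF sys(1) X, of _ V]) auto
      with diss[OF u_in[OF that(1)] X(2)] \<phi>(2)[of "u - ub"] that(2) show ?thesis by simp
    qed
  qed (use \<rho>(1) V(2) in auto)
qed

section \<open>The network as a vector field\<close>

lemma has_vector_derivative_vec_iff:
  fixes f :: "real \<Rightarrow> 'a::real_normed_vector ^ 'n"
  shows "(f has_vector_derivative f') (at t within S) \<longleftrightarrow>
    (\<forall>i. ((\<lambda>s. f s $ i) has_vector_derivative f' $ i) (at t within S))"
proof
  assume "(f has_vector_derivative f') (at t within S)"
  then show "\<forall>i. ((\<lambda>s. f s $ i) has_vector_derivative f' $ i) (at t within S)"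
    using bounded_linear.has_vector_derivative[OF bounded_linear_vec_nth] by blast
next
  assume *: "\<forall>i. ((\<lambda>s. f s $ i) has_vector_derivative f' $ i) (at t within S)"
  have "((\<lambda>y. (1 / norm (y - t)) *\<^sub>R (f y - (f t + (y - t) *\<^sub>R f'))) \<longlongrightarrow> 0) (at t within S)"
    using * by (intro vec_tendstoI) (simp add: has_vector_derivative_def has_derivative_within)
  then show "(f has_vector_derivative f') (at t within S)"
    by (simp add: has_vector_derivative_def has_derivative_within bounded_linear_scaleR_left)
qed

abbreviation phase :: "('n::finite, 'x) config \<Rightarrow> real ^ ('n \<times> 'n)" where "phase c \<equiv> fst c"
abbreviation freq :: "('n::finite, 'x) config \<Rightarrow> real ^ 'n" where "freq c \<equiv> fst (snd c)"
abbreviation stM :: "('n::finite, 'x) config \<Rightarrow> 'x ^ 'n" where "stM c \<equiv> fst (snd (snd c))"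
abbreviation stC :: "('n::finite, 'x) config \<Rightarrow> 'x ^ 'n" where "stC c \<equiv> fst (snd (snd (snd c)))"
abbreviation stU :: "('n::finite, 'x) config \<Rightarrow> 'x ^ 'n" where "stU c \<equiv> snd (snd (snd (snd c)))"

definition net_supply :: "('n::finite, 'x::euclidean_space) power_network \<Rightarrow> ('n, 'x) config \<Rightarrow> 'n \<Rightarrow> real" where
  "net_supply net c j =
     (if j \<in> gen_buses net then io_out (sysM net j) (stM c $ j) (- freq c $ j) else 0)
     - (io_out (sysC net j) (stC c $ j) (- freq c $ j) + io_out (sysU net j) (stU c $ j) (- freq c $ j))"

text \<open>
  The divergence of a function \<open>p\<close> on the edges.
\<close>

definition net_outflow :: "('n \<times> 'n) set \<Rightarrow> ('n::finite \<Rightarrow> 'n \<Rightarrow> real) \<Rightarrow> 'n \<Rightarrow> real" where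
  "net_outflow E p j = (\<Sum>k | (j, k) \<in> E. p j k) - (\<Sum>i | (i, j) \<in> E. p i j)"

definition surplus :: "('n::finite, 'x::euclidean_space) power_network \<Rightarrow> ('n, 'x) config \<Rightarrow> 'n \<Rightarrow> real" where
  "surplus net c j = - demand net j + net_supply net c j - net_outflow (edges net) (line_flow net (phase c)) j"

definition velocity ::
  "('n::finite, 'x::euclidean_space) power_network \<Rightarrow> ('n, 'x) config \<Rightarrow> ('n, 'x) config" where
  "velocity net c =
     (\<chi> e. if e \<in> edges net then freq c $ fst e - freq c $ snd e else 0,
      \<chi> j. if j \<in> gen_buses net then surplus net c j / inertia net j else 0,
      \<chi> j. if j \<in> gen_buses net then io_dyn (sysM net j) (stM c $ j) (- freq c $ j) else 0,
      \<chi> j. io_dyn (sysC net j) (stC c $ j) (- freq c $ j),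
      \<chi> j. io_dyn (sysU net j) (stU c $ j) (- freq c $ j))"

definition with_freq :: "('n::finite, 'x) config \<Rightarrow> real ^ 'n \<Rightarrow> ('n, 'x) config" where
  "with_freq z \<omega> = (phase z, \<omega>, snd (snd z))"

definition state_part :: "('n::finite, 'x) power_network \<Rightarrow> ('n, 'x) config \<Rightarrow> ('n, 'x) config" where
  "state_part net c = with_freq c (restrict_vec (gen_buses net) (freq c))"

definition balanced :: "('n::finite, 'x::euclidean_space) power_network \<Rightarrow> ('n, 'x) config \<Rightarrow> bool" where
  "balanced net c \<longleftrightarrow> (\<forall>j\<in>load_buses net. surplus net c j = 0)"

text \<open>
  All frequencies as a function of the state: \<open>vec w\<close> assigns the frequency \<open>w\<close> to every bus, but only its
  component at \<open>j\<close> enters the surplus at \<open>j\<close>.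
\<close>

definition bus_freq :: "('n::finite, 'x::euclidean_space) power_network \<Rightarrow> ('n, 'x) config \<Rightarrow> real ^ 'n" where
  "bus_freq net z = (\<chi> j. if j \<in> gen_buses net then freq z $ j
     else (THE w. surplus net (with_freq z (vec w)) j = 0))"

definition vector_field ::
  "('n::finite, 'x::euclidean_space) power_network \<Rightarrow> ('n, 'x) config \<Rightarrow> ('n, 'x) config" where
  "vector_field net z = velocity net (with_freq z (bus_freq net z))"

lemma with_freq_simps [simp]:
  "phase (with_freq z \<omega>) = phase z" "freq (with_freq z \<omega>) = \<omega>" "stM (with_freq z \<omega>) = stM z"
  "stC (with_freq z \<omega>) = stC z" "stU (with_freq z \<omega>) = stU z"
  "with_freq (with_freq z \<omega>) \<omega>' = with_freq z \<omega>'" "with_freq z (freq z) = z"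
  by (simp_all add: with_freq_def)

lemma surplus_with_freq_cong:
  "\<omega> $ j = \<omega>' $ j \<Longrightarrow> surplus net (with_freq z \<omega>) j = surplus net (with_freq z \<omega>') j"
  by (simp add: surplus_def net_supply_def)

lemma power_balance_eq:
  "power_balance net \<eta> j pM dc du
     = - demand net j + (pM - (dc + du)) - net_outflow (edges net) (line_flow net \<eta>) j"
  by (simp add: power_balance_def net_outflow_def)

lemma load_balance_iff: "load_balance net \<eta> \<omega> xc xu \<longleftrightarrow> balanced net (\<eta>, \<omega>, xM, xc, xu)"
  unfolding load_balance_def balanced_def
  by (auto simp: power_balance_eq surplus_def net_supply_def)

lemma network_configs_iff:
  "c \<in> network_configs net \<longleftrightarrow> (\<forall>e. e \<notin> edges net \<longrightarrow> phase c $ e = 0) \<and>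
     (\<forall>j\<in>gen_buses net. stM c $ j \<in> io_states (sysM net j)) \<and> (\<forall>j\<in>load_buses net. stM c $ j = 0) \<and>
     (\<forall>j. stC c $ j \<in> io_states (sysC net j)) \<and> (\<forall>j. stU c $ j \<in> io_states (sysU net j))"
  by (cases c) (simp add: network_configs_def)

lemma network_states_iff:
  "z \<in> network_states net \<longleftrightarrow> z \<in> network_configs net \<and> (\<forall>j\<in>load_buses net. freq z $ j = 0)"
  by (cases z) (auto simp: network_states_def)

text \<open>
  The componentwise equations with side conditions amount to one differential equation for the state,
  because the components outside the intended index sets vanish identically.
\<close>

lemma network_solution_iff:
  fixes net :: "('n::finite, 'x::euclidean_space) power_network"
  assumes inertia: "\<And>j. j \<in> gen_buses net \<Longrightarrow> 0 < inertia net j"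
  shows "network_solution net \<tau> (\<lambda>t. phase (c t)) (\<lambda>t. freq (c t)) (\<lambda>t. stM (c t)) (\<lambda>t. stC (c t)) (\<lambda>t. stU (c t))
    \<longleftrightarrow> 0 < \<tau> \<and> (\<forall>t\<in>time_interval \<tau>. c t \<in> network_configs net \<and> balanced net (c t) \<and>
      ((\<lambda>s. state_part net (c s)) has_vector_derivative velocity net (c t)) (at t within time_interval \<tau>))"
  (is "?L \<longleftrightarrow> _ \<and> (\<forall>t\<in>?I. ?R t)")
proof -
  let ?G = "gen_buses net" and ?E = "edges net"
  have "?L \<longleftrightarrow> 0 < \<tau> \<and> (\<forall>t\<in>?I. c t \<in> network_configs net \<and>
        (\<forall>(i, j)\<in>?E. ((\<lambda>s. phase (c s) $ (i, j)) has_real_derivative freq (c t) $ i - freq (c t) $ j) (at t within ?I)) \<and>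
        (\<forall>j\<in>?G. ((\<lambda>s. freq (c s) $ j) has_real_derivative surplus net (c t) j / inertia net j) (at t within ?I)) \<and>
        balanced net (c t) \<and>
        (\<forall>j\<in>?G. ((\<lambda>s. stM (c s) $ j) has_vector_derivative
           io_dyn (sysM net j) (stM (c t) $ j) (- freq (c t) $ j)) (at t within ?I)) \<and>
        (\<forall>j. ((\<lambda>s. stC (c s) $ j) has_vector_derivative
           io_dyn (sysC net j) (stC (c t) $ j) (- freq (c t) $ j)) (at t within ?I)) \<and>
        (\<forall>j. ((\<lambda>s. stU (c s) $ j) has_vector_derivative
           io_dyn (sysU net j) (stU (c t) $ j) (- freq (c t) $ j)) (at t within ?I)))"
    (is "_ \<longleftrightarrow> _ \<and> (\<forall>t\<in>_. ?A t)")
  proof -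
    have gen: "(\<exists>w. P w \<and> inertia net j * w = q) \<longleftrightarrow> P (q / inertia net j)" if "j \<in> ?G" for P j q
      using inertia[OF that] by (auto simp: field_simps)
    have bal: "power_balance net (phase (c t)) j (io_out (sysM net j) (stM (c t) $ j) (- freq (c t) $ j))
             (io_out (sysC net j) (stC (c t) $ j) (- freq (c t) $ j))
             (io_out (sysU net j) (stU (c t) $ j) (- freq (c t) $ j)) = surplus net (c t) j"
      if "j \<in> ?G" for t j
      using that by (simp add: power_balance_eq surplus_def net_supply_def)
    have load: "load_balance net (phase (c t)) (freq (c t)) (stC (c t)) (stU (c t)) \<longleftrightarrow> balanced net (c t)" for t
      using load_balance_iff[of net "phase (c t)" "freq (c t)" "stC (c t)" "stU (c t)" "stM (c t)"] by simp
    show ?thesis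
      unfolding network_solution_def load
      by (simp add: gen bal cong: ball_cong_simp)
  qed
  also have "\<dots> \<longleftrightarrow> 0 < \<tau> \<and> (\<forall>t\<in>?I. ?R t)"
  proof (cases "\<forall>t\<in>?I. c t \<in> network_configs net")
    case True
    have "?A t \<longleftrightarrow> ?R t" if t: "t \<in> ?I" for t
    proof -
      let ?D = "\<lambda>f f'. (f has_vector_derivative f') (at t within ?I)"
      have trivial: "?D f 0" if "\<And>s. s \<in> ?I \<Longrightarrow> f s = 0" for f :: "real \<Rightarrow> 'z::real_normed_vector"
        by (rule has_vector_derivative_transform[OF t _ has_vector_derivative_const[of 0]]) (use that in auto)
      have 1: "?D (\<lambda>s. phase (c s) $ e) 0" if "e \<notin> ?E" for e
        using True that unfolding network_configs_iff by (intro trivial) blast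
      have 3: "?D (\<lambda>s. stM (c s) $ j) 0" if "j \<notin> ?G" for j
        using True that unfolding network_configs_iff by (intro trivial) blast
      have pair: "?D h h' \<longleftrightarrow> ?D (\<lambda>s. fst (h s)) (fst h') \<and> ?D (\<lambda>s. snd (h s)) (snd h')"
        for h :: "real \<Rightarrow> 'y::real_normed_vector \<times> 'z::real_normed_vector" and h'
        using has_vector_derivative_Pair[of "\<lambda>s. fst (h s)" "fst h'" t ?I "\<lambda>s. snd (h s)" "snd h'"]
          bounded_linear.has_vector_derivative[OF bounded_linear_fst, of h h']
          bounded_linear.has_vector_derivative[OF bounded_linear_snd, of h h'] by auto
      have parts: "?D h h' \<longleftrightarrow> ?D (\<lambda>s. phase (h s)) (phase h') \<and> ?D (\<lambda>s. freq (h s)) (freq h') \<and>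
          ?D (\<lambda>s. stM (h s)) (stM h') \<and> ?D (\<lambda>s. stC (h s)) (stC h') \<and> ?D (\<lambda>s. stU (h s)) (stU h')"
        for h :: "real \<Rightarrow> ('n, 'x) config" and h'
        by (simp only: pair[of h] pair[of "\<lambda>s. snd (h s)"] pair[of "\<lambda>s. snd (snd (h s))"]
          pair[of "\<lambda>s. snd (snd (snd (h s)))"])
      have "?D (\<lambda>s. state_part net (c s)) (velocity net (c t)) \<longleftrightarrow>
        (\<forall>e. ?D (\<lambda>s. phase (c s) $ e) (if e \<in> ?E then freq (c t) $ fst e - freq (c t) $ snd e else 0)) \<and>
        (\<forall>j. ?D (\<lambda>s. if j \<in> ?G then freq (c s) $ j else 0) (if j \<in> ?G then surplus net (c t) j / inertia net j else 0)) \<and>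
        (\<forall>j. ?D (\<lambda>s. stM (c s) $ j) (if j \<in> ?G then io_dyn (sysM net j) (stM (c t) $ j) (- freq (c t) $ j) else 0)) \<and>
        (\<forall>j. ?D (\<lambda>s. stC (c s) $ j) (io_dyn (sysC net j) (stC (c t) $ j) (- freq (c t) $ j))) \<and>
        (\<forall>j. ?D (\<lambda>s. stU (c s) $ j) (io_dyn (sysU net j) (stU (c t) $ j) (- freq (c t) $ j)))"
        unfolding parts[of "\<lambda>s. state_part net (c s)"] has_vector_derivative_vec_iff
        by (simp add: state_part_def velocity_def restrict_vec_def)
      also have "\<dots> \<longleftrightarrow>
        (\<forall>(i, j)\<in>?E. ?D (\<lambda>s. phase (c s) $ (i, j)) (freq (c t) $ i - freq (c t) $ j)) \<and>
        (\<forall>j\<in>?G. ?D (\<lambda>s. freq (c s) $ j) (surplus net (c t) j / inertia net j)) \<and>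
        (\<forall>j\<in>?G. ?D (\<lambda>s. stM (c s) $ j) (io_dyn (sysM net j) (stM (c t) $ j) (- freq (c t) $ j))) \<and>
        (\<forall>j. ?D (\<lambda>s. stC (c s) $ j) (io_dyn (sysC net j) (stC (c t) $ j) (- freq (c t) $ j))) \<and>
        (\<forall>j. ?D (\<lambda>s. stU (c s) $ j) (io_dyn (sysU net j) (stU (c t) $ j) (- freq (c t) $ j)))"
      proof (intro arg_cong2[of _ _ _ _ "(\<and>)"] refl)
        show "(\<forall>e. ?D (\<lambda>s. phase (c s) $ e) (if e \<in> ?E then freq (c t) $ fst e - freq (c t) $ snd e else 0)) \<longleftrightarrow>
          (\<forall>(i, j)\<in>?E. ?D (\<lambda>s. phase (c s) $ (i, j)) (freq (c t) $ i - freq (c t) $ j))"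
          using 1 by (auto split: if_splits)
      next
        show "(\<forall>j. ?D (\<lambda>s. if j \<in> ?G then freq (c s) $ j else 0) (if j \<in> ?G then surplus net (c t) j / inertia net j else 0))
          \<longleftrightarrow> (\<forall>j\<in>?G. ?D (\<lambda>s. freq (c s) $ j) (surplus net (c t) j / inertia net j))"
          by auto
      next
        show "(\<forall>j. ?D (\<lambda>s. stM (c s) $ j) (if j \<in> ?G then io_dyn (sysM net j) (stM (c t) $ j) (- freq (c t) $ j) else 0))
          \<longleftrightarrow> (\<forall>j\<in>?G. ?D (\<lambda>s. stM (c s) $ j) (io_dyn (sysM net j) (stM (c t) $ j) (- freq (c t) $ j)))"
          using 3 by auto
      qed
      finally show ?thesis
        by (auto simp: has_real_derivative_iff_has_vector_derivative)
    qed
    then show ?thesis by auto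
  next
    case False
    then show ?thesis by blast
  qed
  finally show ?thesis .
qed

section \<open>Flows and phase differences\<close>

text \<open>
  Summation by parts: the divergence is adjoint to the difference operator on the edges.
\<close>

lemma sum_bus_net_outflow:
  fixes \<theta> :: "'n::finite \<Rightarrow> real"
  shows "(\<Sum>j\<in>UNIV. \<theta> j * net_outflow E p j) = (\<Sum>(i, j)\<in>E. (\<theta> i - \<theta> j) * p i j)"
proof -
  have out: "(\<Sum>j\<in>UNIV. \<Sum>k | (j, k) \<in> E. f j k) = (\<Sum>(i, j)\<in>E. f i j)" for f :: "'n \<Rightarrow> 'n \<Rightarrow> real"
    by (subst sum.Sigma) (auto intro!: sum.cong)
  have "inj_on prod.swap A" for A :: "('n \<times> 'n) set" by (auto simp: inj_on_def)
  then have inn: "(\<Sum>j\<in>UNIV. \<Sum>i | (i, j) \<in> E. f i j) = (\<Sum>(i, j)\<in>E. f i j)" for f :: "'n \<Rightarrow> 'n \<Rightarrow> real"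
    by (subst sum.Sigma) (auto intro!: sum.reindex_bij_witness[of _ prod.swap prod.swap])
  have "(\<Sum>j\<in>UNIV. \<theta> j * net_outflow E p j)
      = (\<Sum>j\<in>UNIV. \<Sum>k | (j, k) \<in> E. \<theta> j * p j k) - (\<Sum>j\<in>UNIV. \<Sum>i | (i, j) \<in> E. \<theta> j * p i j)"
    by (simp add: net_outflow_def right_diff_distrib sum_distrib_left sum_subtractf)
  also have "\<dots> = (\<Sum>(i, j)\<in>E. \<theta> i * p i j) - (\<Sum>(i, j)\<in>E. \<theta> j * p i j)"
    using out[of "\<lambda>j k. \<theta> j * p j k"] inn[of "\<lambda>i j. \<theta> j * p i j"] by simp
  also have "\<dots> = (\<Sum>(i, j)\<in>E. (\<theta> i - \<theta> j) * p i j)"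
    by (simp add: sum_subtractf[symmetric] left_diff_distrib split_beta)
  finally show ?thesis .
qed

lemma net_outflow_diff: "net_outflow E p j - net_outflow E q j = net_outflow E (\<lambda>i k. p i k - q i k) j"
  by (simp add: net_outflow_def sum_subtractf)

lemma sin_strict_mono_mult:
  assumes "\<bar>x\<bar> < pi / 2" "\<bar>y\<bar> < pi / 2" "x \<noteq> y"
  shows "0 < (x - y) * (sin x - sin y)"
proof (cases "x < y")
  case True
  then have "sin x < sin y" using assms by (intro sin_monotone_2pi) auto
  then show ?thesis using True by (intro mult_neg_neg) auto
next
  case False
  then have "y < x" using assms(3) by simp
  moreover from this have "sin y < sin x" using assms by (intro sin_monotone_2pi) auto
  ultimately show ?thesis by simp
qed

text \<open>
  As a function of \<open>x\<close> the expression vanishes at \<open>a\<close>, and its derivative \<open>sin x - sin a\<close> has the sign of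
  \<open>x - a\<close>.
\<close>

lemma phase_potential_pos:
  fixes a x :: real
  assumes "\<bar>a\<bar> < pi / 2" "\<bar>x\<bar> < pi / 2" "x \<noteq> a"
  shows "0 < cos a - cos x - sin a * (x - a)"
proof -
  define g where "g x = cos a - cos x - sin a * (x - a)" for x
  have g: "(g has_real_derivative sin x - sin a) (at x)" for x
    unfolding g_def by (auto intro!: derivative_eq_intros)
  have "g a < g x"
  proof (cases "a < x")
    case True
    show ?thesis
    proof (rule DERIV_pos_imp_increasing_open[OF True])
      fix y assume "a < y" "y < x"
      then have "sin a < sin y" using assms by (intro sin_monotone_2pi) auto
      then show "\<exists>d. (g has_real_derivative d) (at y) \<and> 0 < d" using g by force
    qed (meson g DERIV_isCont continuous_at_imp_continuous_on)
  next
    case False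
    then have "x < a" using assms(3) by simp
    then show ?thesis
    proof (rule DERIV_neg_imp_decreasing_open)
      fix y assume "x < y" "y < a"
      then have "sin y < sin a" using assms by (intro sin_monotone_2pi) auto
      then show "\<exists>d. (g has_real_derivative d) (at y) \<and> d < 0" using g by force
    qed (meson g DERIV_isCont continuous_at_imp_continuous_on)
  qed
  then show ?thesis by (simp add: g_def)
qed

text \<open>
  Pairing the equal outflows with \<open>\<theta>\<close> and summing by parts gives a vanishing sum over the edges of the terms
  \<open>B (\<eta> - \<eta>') (sin \<eta> - sin \<eta>')\<close>, each of which is positive unless the phases agree.
\<close>

lemma phase_difference_unique:
  fixes net :: "('n::finite, 'x::euclidean_space) power_network"
  assumes B: "\<And>i j. (i, j) \<in> edges net \<Longrightarrow> 0 < suscept net i j"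
    and small: "\<And>e. e \<in> edges net \<Longrightarrow> \<bar>\<eta> $ e\<bar> < pi / 2 \<and> \<bar>\<eta>' $ e\<bar> < pi / 2"
    and outflow: "\<And>j. net_outflow (edges net) (line_flow net \<eta>) j = net_outflow (edges net) (line_flow net \<eta>') j"
    and \<theta>: "\<And>i j. (i, j) \<in> edges net \<Longrightarrow> \<eta> $ (i, j) - \<eta>' $ (i, j) = \<theta> i - \<theta> j"
    and e: "e \<in> edges net"
  shows "\<eta> $ e = \<eta>' $ e"
proof (rule ccontr)
  assume ne: "\<eta> $ e \<noteq> \<eta>' $ e"
  define f where "f i j = (\<eta> $ (i, j) - \<eta>' $ (i, j)) * (suscept net i j * (sin (\<eta> $ (i, j)) - sin (\<eta>' $ (i, j))))" for i j
  have pos: "0 < f i j" if "(i, j) \<in> edges net" "\<eta> $ (i, j) \<noteq> \<eta>' $ (i, j)" for i j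
    using mult_pos_pos[OF B[OF that(1)] sin_strict_mono_mult[OF _ _ that(2)]] small[OF that(1)]
    by (simp add: f_def mult.left_commute)
  have nonneg: "0 \<le> f i j" if "(i, j) \<in> edges net" for i j
    using pos[OF that] by (cases "\<eta> $ (i, j) = \<eta>' $ (i, j)") (auto simp: f_def)
  have "0 < (\<Sum>(i, j)\<in>edges net. f i j)"
    by (rule sum_pos2[OF _ e]) (use ne e pos nonneg in \<open>auto split: prod.splits\<close>)
  also have "(\<Sum>(i, j)\<in>edges net. f i j) =
      (\<Sum>(i, j)\<in>edges net. (\<theta> i - \<theta> j) * (line_flow net \<eta> i j - line_flow net \<eta>' i j))"
    by (rule sum.cong) (auto simp: f_def line_flow_def \<theta> right_diff_distrib)
  also have "\<dots> = (\<Sum>j\<in>UNIV. \<theta> j * net_outflow (edges net) (\<lambda>i j. line_flow net \<eta> i j - line_flow net \<eta>' i j) j)"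
    by (rule sum_bus_net_outflow[symmetric])
  also have "\<dots> = 0" by (simp add: net_outflow_diff[symmetric] outflow)
  finally show False by simp
qed

section \<open>The equilibrium and the storage functions of the buses\<close>

lemma eventually_nhds_within_continuous:
  fixes g :: "'a::topological_space \<Rightarrow> real"
  assumes "continuous_on N g" "p \<in> N" "0 < g p"
  shows "\<forall>\<^sub>F z in nhds p. z \<in> N \<longrightarrow> 0 < g z"
proof -
  have "(g \<longlongrightarrow> g p) (at p within N)" using assms by (simp add: continuous_on_def)
  then have "\<forall>\<^sub>F z in at p within N. 0 < g z" using assms(3) by (rule order_tendstoD)
  then show ?thesis unfolding eventually_at_filter
    by (rule eventually_mono) (use assms(3) in auto)
qed

locale passive_network =
  fixes net :: "('n::finite, 'x::euclidean_space) power_network"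
    and \<eta>s :: "real ^ ('n \<times> 'n)" and \<omega>s :: "real ^ 'n" and xMs xcs xus :: "'x ^ 'n"
    and VG :: "'n \<Rightarrow> 'x \<times> 'x \<times> 'x \<Rightarrow> real" and VL :: "'n \<Rightarrow> 'x \<times> 'x \<Rightarrow> real"
  assumes admissible: "admissible_network net"
    and equilibrium: "network_equilibrium net \<eta>s \<omega>s xMs xcs xus"
    and A1: "\<forall>(i, j)\<in>edges net. \<bar>\<eta>s $ (i, j)\<bar> < pi / 2"
    and A2_gen: "\<forall>j\<in>gen_buses net.
      locally_input_strictly_passive (gen_supply net j) (- \<omega>s $ j) (xMs $ j, xcs $ j, xus $ j) (VG j)"
    and A2_load: "\<forall>j\<in>load_buses net.
      locally_input_strictly_passive (load_supply net j) (- \<omega>s $ j) (xcs $ j, xus $ j) (VL j)"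
    and A3_gen: "\<forall>j\<in>gen_buses net.
      strict_local_min_on (io_states (gen_supply net j)) (VG j) (xMs $ j, xcs $ j, xus $ j)"
    and A3_load: "\<forall>j\<in>load_buses net.
      strict_local_min_on (io_states (load_supply net j)) (VL j) (xcs $ j, xus $ j)"
    and A4: "load_freq_determined_near net (\<eta>s, restrict_vec (gen_buses net) \<omega>s, xMs, xcs, xus)"
begin

abbreviation N :: "('n, 'x) config set" where "N \<equiv> network_states net"

definition zs :: "('n, 'x) config" where
  "zs = (\<eta>s, restrict_vec (gen_buses net) \<omega>s, xMs, xcs, xus)"

lemma zs_simps [simp]: "phase zs = \<eta>s" "freq zs = restrict_vec (gen_buses net) \<omega>s"
  "stM zs = xMs" "stC zs = xcs" "stU zs = xus"
  by (simp_all add: zs_def)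

lemma sysM: "j \<in> gen_buses net \<Longrightarrow> admissible_io_system (sysM net j)"
  and sysC: "admissible_io_system (sysC net j)"
  and sysU: "admissible_io_system (sysU net j)"
  and inertia: "j \<in> gen_buses net \<Longrightarrow> 0 < inertia net j"
  and suscept: "(i, k) \<in> edges net \<Longrightarrow> 0 < suscept net i k"
  using admissible unfolding admissible_network_def by auto

lemma equilibriumD:
  shows "(i, k) \<in> edges net \<Longrightarrow> \<omega>s $ i = \<omega>s $ k"
    and "j \<in> gen_buses net \<Longrightarrow> xMs $ j = io_kx (sysM net j) (- \<omega>s $ j)"
    and "j \<notin> gen_buses net \<Longrightarrow> xMs $ j = 0"
    and "xcs $ j = io_kx (sysC net j) (- \<omega>s $ j)"
    and "xus $ j = io_kx (sysU net j) (- \<omega>s $ j)"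
    and "zs \<in> N"
proof -
  have c: "(\<eta>s, \<omega>s, xMs, xcs, xus) \<in> network_configs net"
    using equilibrium unfolding network_equilibrium_def by blast
  then show "j \<notin> gen_buses net \<Longrightarrow> xMs $ j = 0" by (simp add: network_configs_iff)
  from c show "zs \<in> N" unfolding network_states_iff network_configs_iff by (simp add: restrict_vec_def)
qed (use equilibrium in \<open>auto simp: network_equilibrium_def\<close>)

lemma subspace_N: "subspace N"
  using admissible_io_systemD(1)[OF sysM] admissible_io_systemD(1)[OF sysC] admissible_io_systemD(1)[OF sysU]
  by (auto simp: subspace_def network_states_iff network_configs_iff)

lemma with_freq_configs: "z \<in> N \<Longrightarrow> with_freq z \<omega> \<in> network_configs net"
  by (simp add: network_states_iff network_configs_iff)

lemma state_part_N: "c \<in> network_configs net \<Longrightarrow> state_part net c \<in> N"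
  by (simp add: network_states_iff network_configs_iff state_part_def restrict_vec_def)

lemma velocity_N: "c \<in> network_configs net \<Longrightarrow> velocity net c \<in> N"
  using admissible_io_systemD(2)[OF sysM] admissible_io_systemD(2)[OF sysC] admissible_io_systemD(2)[OF sysU]
  by (simp add: network_states_iff network_configs_iff velocity_def)

lemma continuous_on_net_supply: "continuous_on (network_configs net) (\<lambda>c. net_supply net c j)"
proof -
  have "continuous_on (network_configs net) (\<lambda>c. io_out (sysC net j) (stC c $ j) (- freq c $ j))"
    by (rule continuous_on_io[OF sysC]) (auto simp: network_configs_iff intro!: continuous_intros)
  moreover have "continuous_on (network_configs net) (\<lambda>c. io_out (sysU net j) (stU c $ j) (- freq c $ j))"
    by (rule continuous_on_io[OF sysU]) (auto simp: network_configs_iff intro!: continuous_intros)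
  moreover have "continuous_on (network_configs net) (\<lambda>c. io_out (sysM net j) (stM c $ j) (- freq c $ j))"
    if "j \<in> gen_buses net"
    by (rule continuous_on_io[OF sysM[OF that]]) (use that in \<open>auto simp: network_configs_iff intro!: continuous_intros\<close>)
  ultimately show ?thesis unfolding net_supply_def
    by (cases "j \<in> gen_buses net") (auto intro!: continuous_intros)
qed

lemma continuous_on_surplus: "continuous_on (network_configs net) (\<lambda>c. surplus net c j)"
  unfolding surplus_def net_outflow_def line_flow_def
  by (intro continuous_intros continuous_on_net_supply)

lemma continuous_on_velocity: "continuous_on (network_configs net) (velocity net)"
proof -
  have 1: "continuous_on (network_configs net)
      (\<lambda>c. if e \<in> edges net then freq c $ fst e - freq c $ snd e else 0)" for e
    by (cases "e \<in> edges net") (auto intro!: continuous_intros)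
  have 2: "continuous_on (network_configs net)
      (\<lambda>c. if j \<in> gen_buses net then surplus net c j / inertia net j else 0)" for j
    using inertia[of j] by (cases "j \<in> gen_buses net") (auto intro!: continuous_intros continuous_on_surplus)
  have 3: "continuous_on (network_configs net)
      (\<lambda>c. if j \<in> gen_buses net then io_dyn (sysM net j) (stM c $ j) (- freq c $ j) else 0)" for j
  proof (cases "j \<in> gen_buses net")
    case True
    have "continuous_on (network_configs net) (\<lambda>c. io_dyn (sysM net j) (stM c $ j) (- freq c $ j))"
      by (rule continuous_on_io[OF sysM[OF True]]) (use True in \<open>auto simp: network_configs_iff intro!: continuous_intros\<close>)
    then show ?thesis using True by simp
  qed simp
  have 4: "continuous_on (network_configs net) (\<lambda>c. io_dyn (sysC net j) (stC c $ j) (- freq c $ j))" for j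
    by (rule continuous_on_io[OF sysC]) (auto simp: network_configs_iff intro!: continuous_intros)
  have 5: "continuous_on (network_configs net) (\<lambda>c. io_dyn (sysU net j) (stU c $ j) (- freq c $ j))" for j
    by (rule continuous_on_io[OF sysU]) (auto simp: network_configs_iff intro!: continuous_intros)
  show ?thesis unfolding velocity_def[abs_def]
    by (intro continuous_on_Pair continuous_on_vec_lambda 1 2 3 4 5)
qed

lemma continuous_on_surplus_const_freq:
  "continuous_on (N \<times> UNIV) (\<lambda>(z, w). surplus net (with_freq z (vec w)) j)"
proof -
  have "continuous_on (N \<times> UNIV) (\<lambda>p. with_freq (fst p) (vec (snd p)) :: ('n, 'x) config)"
    unfolding with_freq_def vec_def by (intro continuous_intros continuous_on_vec_lambda)
  then have "continuous_on (N \<times> UNIV) (\<lambda>p. surplus net (with_freq (fst p) (vec (snd p))) j)"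
    by (rule continuous_on_compose2[OF continuous_on_surplus]) (auto simp: with_freq_configs)
  then show ?thesis by (simp add: split_beta)
qed

lemma io_ky_gen_supply:
  assumes "j \<in> gen_buses net"
  shows "io_ky (gen_supply net j) (- \<omega>s $ j) = net_supply net (with_freq zs \<omega>s) j"
proof -
  have "is_equilibrium_point (gen_supply net j) u x \<longleftrightarrow>
      x = (io_kx (sysM net j) u, io_kx (sysC net j) u, io_kx (sysU net j) u)" for u x
    using admissible_io_systemD(6)[OF sysM[OF assms], of u "fst x"]
      admissible_io_systemD(6)[OF sysC, of j u "fst (snd x)"] admissible_io_systemD(6)[OF sysU, of j u "snd (snd x)"]
    by (cases x) (auto simp: is_equilibrium_point_def gen_supply_def zero_prod_def)
  then have "io_kx (gen_supply net j) u = (io_kx (sysM net j) u, io_kx (sysC net j) u, io_kx (sysU net j) u)" for u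
    unfolding io_kx_def[of "gen_supply net j"] by (intro the_equality) auto
  then show ?thesis using assms equilibriumD(2,4,5)
    by (simp add: io_ky_def net_supply_def gen_supply_def)
qed

lemma io_ky_load_supply:
  assumes "j \<notin> gen_buses net"
  shows "io_ky (load_supply net j) (- \<omega>s $ j) = net_supply net (with_freq zs \<omega>s) j"
proof -
  have "is_equilibrium_point (load_supply net j) u x \<longleftrightarrow>
      x = (io_kx (sysC net j) u, io_kx (sysU net j) u)" for u x
    using admissible_io_systemD(6)[OF sysC, of j u "fst x"] admissible_io_systemD(6)[OF sysU, of j u "snd x"]
    by (cases x) (auto simp: is_equilibrium_point_def load_supply_def zero_prod_def)
  then have "io_kx (load_supply net j) u = (io_kx (sysC net j) u, io_kx (sysU net j) u)" for u
    unfolding io_kx_def[of "load_supply net j"] by (intro the_equality) auto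
  then show ?thesis using assms equilibriumD(2,4,5)
    by (simp add: io_ky_def net_supply_def load_supply_def)
qed

lemma surplus_equilibrium: "surplus net (with_freq zs \<omega>s) j = 0"
  using equilibrium equilibriumD(2,4,5)
  unfolding network_equilibrium_def surplus_def net_supply_def power_balance_eq
  by (cases "j \<in> gen_buses net") (auto simp: io_ky_def)

text \<open>
  The consequences of passivity for bus \<open>j\<close> on the ball of radius \<open>\<rho>\<close>, with the storage function read as
  a function of the network state. This form does not depend on the kind of bus, although the two
  kinds have supply systems with different state types.
\<close>

definition bus_storage_on :: "'n \<Rightarrow> real \<Rightarrow> (('n, 'x) config \<Rightarrow> real) \<Rightarrow> bool" where
  "bus_storage_on j \<rho> W \<longleftrightarrow>
     continuous_on (N \<inter> cball zs \<rho>) W \<and> W zs = 0 \<and>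
     (\<forall>z\<in>N \<inter> cball zs \<rho>. 0 \<le> W z \<and>
        (W z = 0 \<longrightarrow> stM z $ j = xMs $ j \<and> stC z $ j = xcs $ j \<and> stU z $ j = xus $ j)) \<and>
     (\<forall>I y t \<omega>. y ` I \<subseteq> N \<inter> cball zs \<rho> \<and> t \<in> I \<and> \<bar>\<omega> $ j - \<omega>s $ j\<bar> \<le> \<rho> \<and>
        (y has_vector_derivative velocity net (with_freq (y t) \<omega>)) (at t within I) \<longrightarrow>
        (\<exists>D. ((\<lambda>s. W (y s)) has_real_derivative D) (at t within I) \<and>
          D \<le> - (\<omega> $ j - \<omega>s $ j) * (net_supply net (with_freq (y t) \<omega>) j - net_supply net (with_freq zs \<omega>s) j) \<and>
          (\<omega> $ j \<noteq> \<omega>s $ j \<longrightarrow>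
            D < - (\<omega> $ j - \<omega>s $ j) * (net_supply net (with_freq (y t) \<omega>) j - net_supply net (with_freq zs \<omega>s) j)))) \<and>
     (\<forall>\<omega>. \<bar>\<omega> $ j - \<omega>s $ j\<bar> \<le> \<rho> \<and> \<omega> $ j \<noteq> \<omega>s $ j \<longrightarrow>
        (\<omega> $ j - \<omega>s $ j) * (net_supply net (with_freq zs \<omega>) j - net_supply net (with_freq zs \<omega>s) j) < 0)"

lemma bus_storage_on_antimono:
  assumes W: "bus_storage_on j \<rho> W" and le: "\<rho>' \<le> \<rho>"
  shows "bus_storage_on j \<rho>' W"
proof -
  have sub: "N \<inter> cball zs \<rho>' \<subseteq> N \<inter> cball zs \<rho>" using le by auto
  show ?thesis
    using W unfolding bus_storage_on_def
  proof (elim conjE, intro conjI, goal_cases)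
    case 1
    show ?case by (rule continuous_on_subset[OF 1(1) sub])
  next
    case 2
    show ?case by (rule 2(2))
  next
    case 3
    show ?case using 3(3) sub by (meson subsetD)
  next
    case 4
    show ?case
    proof (intro allI impI)
      fix I y t \<omega>
      assume "y ` I \<subseteq> N \<inter> cball zs \<rho>' \<and> t \<in> I \<and> \<bar>\<omega> $ j - \<omega>s $ j\<bar> \<le> \<rho>' \<and>
          (y has_vector_derivative velocity net (with_freq (y t) \<omega>)) (at t within I)"
      then have "y ` I \<subseteq> N \<inter> cball zs \<rho> \<and> t \<in> I \<and> \<bar>\<omega> $ j - \<omega>s $ j\<bar> \<le> \<rho> \<and>
          (y has_vector_derivative velocity net (with_freq (y t) \<omega>)) (at t within I)"
        using sub le by (meson order_trans)
      from 4(4)[rule_format, OF this]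
      show "\<exists>D. ((\<lambda>s. W (y s)) has_real_derivative D) (at t within I) \<and>
            D \<le> - (\<omega> $ j - \<omega>s $ j) * (net_supply net (with_freq (y t) \<omega>) j - net_supply net (with_freq zs \<omega>s) j) \<and>
            (\<omega> $ j \<noteq> \<omega>s $ j \<longrightarrow>
              D < - (\<omega> $ j - \<omega>s $ j) * (net_supply net (with_freq (y t) \<omega>) j - net_supply net (with_freq zs \<omega>s) j))" .
    qed
  next
    case 5
    show ?case
    proof (intro allI impI)
      fix \<omega> :: "real ^ 'n"
      assume "\<bar>\<omega> $ j - \<omega>s $ j\<bar> \<le> \<rho>' \<and> \<omega> $ j \<noteq> \<omega>s $ j"
      then have "\<bar>\<omega> $ j - \<omega>s $ j\<bar> \<le> \<rho> \<and> \<omega> $ j \<noteq> \<omega>s $ j" using le by simp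
      from 5(5)[rule_format, OF this]
      show "(\<omega> $ j - \<omega>s $ j) * (net_supply net (with_freq zs \<omega>) j - net_supply net (with_freq zs \<omega>s) j) < 0" .
    qed
  qed
qed

lemma bus_storage_onI:
  fixes sys :: "'s::euclidean_space io_system" and \<pi> :: "('n, 'x) config \<Rightarrow> 's"
  assumes psv: "locally_input_strictly_passive sys (- \<omega>s $ j) (\<pi> zs) V"
    and min: "strict_local_min_on (io_states sys) V (\<pi> zs)"
    and sub: "subspace (io_states sys)"
    and dyn: "\<And>x u. x \<in> io_states sys \<Longrightarrow> io_dyn sys x u \<in> io_states sys"
    and lin: "bounded_linear \<pi>" and im: "\<pi> ` N \<subseteq> io_states sys"
    and \<pi>v: "\<And>z \<omega>. \<pi> (velocity net (with_freq z \<omega>)) = io_dyn sys (\<pi> z) (- \<omega> $ j)"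
    and out: "\<And>z \<omega>. io_out sys (\<pi> z) (- \<omega> $ j) = net_supply net (with_freq z \<omega>) j"
    and ky: "io_ky sys (- \<omega>s $ j) = net_supply net (with_freq zs \<omega>s) j"
    and \<pi>_inj: "\<And>z. z \<in> N \<Longrightarrow> \<pi> z = \<pi> zs \<Longrightarrow> stM z $ j = xMs $ j \<and> stC z $ j = xcs $ j \<and> stU z $ j = xus $ j"
  shows "\<exists>\<rho>>0. \<exists>W. bus_storage_on j \<rho> W"
proof (rule passive_storage_near[OF psv min sub dyn lin im refl])
  fix \<rho> :: real
  assume \<rho>: "0 < \<rho>" and cont: "continuous_on (N \<inter> cball zs \<rho>) (\<lambda>z. V (\<pi> z))" and zero: "V (\<pi> zs) = 0"
    and nonneg: "\<And>z. z \<in> N \<inter> cball zs \<rho> \<Longrightarrow> 0 \<le> V (\<pi> z)"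
    and zeroD: "\<And>z. z \<in> N \<inter> cball zs \<rho> \<Longrightarrow> V (\<pi> z) = 0 \<Longrightarrow> \<pi> z = \<pi> zs"
    and diss: "\<And>I y t v u. \<lbrakk>y ` I \<subseteq> N \<inter> cball zs \<rho>; t \<in> I; (y has_vector_derivative v) (at t within I);
        \<pi> v = io_dyn sys (\<pi> (y t)) u; \<bar>u - (- \<omega>s $ j)\<bar> \<le> \<rho>\<rbrakk> \<Longrightarrow>
      \<exists>D. ((\<lambda>s. V (\<pi> (y s))) has_real_derivative D) (at t within I) \<and>
        D \<le> (u - (- \<omega>s $ j)) * (io_out sys (\<pi> (y t)) u - io_ky sys (- \<omega>s $ j)) \<and>
        (u \<noteq> - \<omega>s $ j \<longrightarrow> D < (u - (- \<omega>s $ j)) * (io_out sys (\<pi> (y t)) u - io_ky sys (- \<omega>s $ j)))"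
    and sgn: "\<And>u. \<bar>u - (- \<omega>s $ j)\<bar> \<le> \<rho> \<Longrightarrow> u \<noteq> - \<omega>s $ j \<Longrightarrow>
      0 < (u - (- \<omega>s $ j)) * (io_out sys (\<pi> zs) u - io_ky sys (- \<omega>s $ j))"
  have neg: "- \<omega> $ j - - \<omega>s $ j = - (\<omega> $ j - \<omega>s $ j)" for \<omega> :: "real ^ 'n" by simp
  have "bus_storage_on j \<rho> (\<lambda>z. V (\<pi> z))"
    unfolding bus_storage_on_def
  proof (intro conjI allI impI ballI)
    fix I y t \<omega>
    assume y: "y ` I \<subseteq> N \<inter> cball zs \<rho> \<and> t \<in> I \<and> \<bar>\<omega> $ j - \<omega>s $ j\<bar> \<le> \<rho> \<and>
        (y has_vector_derivative velocity net (with_freq (y t) \<omega>)) (at t within I)"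
    then have "\<bar>- \<omega> $ j - - \<omega>s $ j\<bar> \<le> \<rho>" by (simp add: abs_minus_commute)
    with diss[of y I t _ "- \<omega> $ j", OF _ _ _ \<pi>v] y
    show "\<exists>D. ((\<lambda>s. V (\<pi> (y s))) has_real_derivative D) (at t within I) \<and>
          D \<le> - (\<omega> $ j - \<omega>s $ j) * (net_supply net (with_freq (y t) \<omega>) j - net_supply net (with_freq zs \<omega>s) j) \<and>
          (\<omega> $ j \<noteq> \<omega>s $ j \<longrightarrow>
            D < - (\<omega> $ j - \<omega>s $ j) * (net_supply net (with_freq (y t) \<omega>) j - net_supply net (with_freq zs \<omega>s) j))"
      unfolding out ky neg by simp
  next
    fix \<omega> :: "real ^ 'n"
    assume \<omega>: "\<bar>\<omega> $ j - \<omega>s $ j\<bar> \<le> \<rho> \<and> \<omega> $ j \<noteq> \<omega>s $ j"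
    then have "\<bar>- \<omega> $ j - - \<omega>s $ j\<bar> \<le> \<rho>" by (simp add: abs_minus_commute)
    from sgn[OF this] \<omega>
    have "0 < - (\<omega> $ j - \<omega>s $ j) * (net_supply net (with_freq zs \<omega>) j - net_supply net (with_freq zs \<omega>s) j)"
      unfolding out ky neg by simp
    then show "(\<omega> $ j - \<omega>s $ j) * (net_supply net (with_freq zs \<omega>) j - net_supply net (with_freq zs \<omega>s) j) < 0"
      by (simp only: mult_minus_left)
  next
    fix z assume z: "z \<in> N \<inter> cball zs \<rho>"
    show "0 \<le> V (\<pi> z)" by (rule nonneg[OF z])
    assume "V (\<pi> z) = 0"
    from \<pi>_inj[OF _ zeroD[OF z this]] z
    show "stM z $ j = xMs $ j" "stC z $ j = xcs $ j" "stU z $ j = xus $ j" by blast+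
  qed (fact cont zero)+
  with \<rho> show ?thesis by blast
qed

lemma bus_storage_exists: "\<exists>\<rho>>0. \<exists>W. bus_storage_on j \<rho> W"
proof (cases "j \<in> gen_buses net")
  case True
  show ?thesis
  proof (rule bus_storage_onI[where \<pi> = "\<lambda>z. (stM z $ j, stC z $ j, stU z $ j)"])
    show "subspace (io_states (gen_supply net j))"
      using admissible_io_systemD(1)[OF sysM[OF True]] admissible_io_systemD(1)[OF sysC]
        admissible_io_systemD(1)[OF sysU]
      by (simp add: gen_supply_def subspace_Times)
    show "io_dyn (gen_supply net j) x u \<in> io_states (gen_supply net j)" if "x \<in> io_states (gen_supply net j)" for x u
      using that admissible_io_systemD(2)[OF sysM[OF True]] admissible_io_systemD(2)[OF sysC]
        admissible_io_systemD(2)[OF sysU]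
      by (auto simp: gen_supply_def split_beta)
    show "bounded_linear (\<lambda>z :: ('n, 'x) config. (stM z $ j, stC z $ j, stU z $ j))"
      by (intro bounded_linear_Pair bounded_linear_compose[OF bounded_linear_vec_nth]
        bounded_linear_fst_comp bounded_linear_snd_comp bounded_linear_fst bounded_linear_snd)
  qed (use True A2_gen A3_gen io_ky_gen_supply in
    \<open>auto simp: gen_supply_def velocity_def net_supply_def network_states_iff network_configs_iff\<close>)
next
  case False
  show ?thesis
  proof (rule bus_storage_onI[where \<pi> = "\<lambda>z. (stC z $ j, stU z $ j)"])
    show "subspace (io_states (load_supply net j))"
      using admissible_io_systemD(1)[OF sysC] admissible_io_systemD(1)[OF sysU]
      by (simp add: load_supply_def subspace_Times)
    show "io_dyn (load_supply net j) x u \<in> io_states (load_supply net j)" if "x \<in> io_states (load_supply net j)" for x u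
      using that admissible_io_systemD(2)[OF sysC] admissible_io_systemD(2)[OF sysU]
      by (auto simp: load_supply_def split_beta)
    show "bounded_linear (\<lambda>z :: ('n, 'x) config. (stC z $ j, stU z $ j))"
      by (intro bounded_linear_Pair bounded_linear_compose[OF bounded_linear_vec_nth]
        bounded_linear_fst_comp bounded_linear_snd_comp bounded_linear_fst bounded_linear_snd)
  qed (use False A2_load A3_load io_ky_load_supply equilibriumD(3) in
    \<open>auto simp: load_supply_def velocity_def net_supply_def network_states_iff network_configs_iff\<close>)
qed

text \<open>
  The balance equation of a load bus involves no other load frequency, so uniqueness of the vector of
  load frequencies is uniqueness at each load bus.
\<close>

lemma load_freq_unique_near:
  "\<forall>\<^sub>F z in nhds zs. z \<in> N \<longrightarrow> (\<forall>j\<in>load_buses net. \<exists>!w. surplus net (with_freq z (vec w)) j = 0)"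
proof -
  obtain T where T: "openin (top_of_set N) T" "zs \<in> T"
    "\<forall>(\<eta>, \<omega>G, xM, xc, xu)\<in>T. \<exists>!\<omega>L. (\<forall>j\<in>gen_buses net. \<omega>L $ j = 0) \<and> load_balance net \<eta> \<omega>L xc xu"
    using A4 unfolding load_freq_determined_near_def zs_def[symmetric] by blast
  obtain O' where O': "open O'" "T = N \<inter> O'" using T(1) unfolding openin_open by blast
  have "\<forall>\<^sub>F z in nhds zs. z \<in> O'" using O' T(2) by (intro eventually_nhds_in_open) auto
  then show ?thesis
  proof eventually_elim
    case (elim z)
    show ?case
    proof (intro impI ballI)
      fix j assume "z \<in> N" and j: "j \<in> load_buses net"
      then have "z \<in> T" using elim O' by simp
      then have ex1: "\<exists>!\<omega>L. (\<forall>j\<in>gen_buses net. \<omega>L $ j = 0) \<and> balanced net (with_freq z \<omega>L)"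
        using T(3) load_balance_iff[of net "phase z" _ "stC z" "stU z" "stM z"]
        by (cases z) (fastforce simp: with_freq_def)
      then obtain \<omega>L where \<omega>L: "\<forall>j\<in>gen_buses net. \<omega>L $ j = 0" "balanced net (with_freq z \<omega>L)" by blast
      show "\<exists>!w. surplus net (with_freq z (vec w)) j = 0"
      proof (rule ex1I)
        show "surplus net (with_freq z (vec (\<omega>L $ j))) j = 0"
          using \<omega>L(2) j surplus_with_freq_cong[of "vec (\<omega>L $ j)" j \<omega>L net z] by (simp add: balanced_def)
      next
        fix w assume w: "surplus net (with_freq z (vec w)) j = 0"
        define \<omega>' where "\<omega>' = (\<chi> i. if i = j then w else \<omega>L $ i)"
        have "surplus net (with_freq z \<omega>') i = 0" if "i \<in> load_buses net" for i
        proof (cases "i = j")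
          case True
          then show ?thesis using w surplus_with_freq_cong[of \<omega>' j "vec w" net z] by (simp add: \<omega>'_def)
        next
          case False
          then show ?thesis using that \<omega>L(2) surplus_with_freq_cong[of \<omega>' i \<omega>L net z]
            by (simp add: \<omega>'_def balanced_def)
        qed
        moreover have "\<forall>i\<in>gen_buses net. \<omega>' $ i = 0" using \<omega>L(1) j by (auto simp: \<omega>'_def)
        ultimately have "\<omega>' = \<omega>L" using ex1 \<omega>L by (auto simp: balanced_def)
        moreover have "\<omega>' $ j = w" by (simp add: \<omega>'_def)
        ultimately show "w = \<omega>L $ j" by simp
      qed
    qed
  qed
qed

end

section \<open>A ball on which the network is a differential equation\<close>

lemma restrict_vec_component [simp]: "restrict_vec A v $ j = (if j \<in> A then v $ j else 0)"
  by (simp add: restrict_vec_def)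

text \<open>
  Two radii: \<open>\<rho>\<close> bounds the frequencies for which passivity is available, and \<open>r\<close> is chosen afterwards
  so small that states in the ball of radius \<open>r\<close> have load frequencies within \<open>\<rho>\<close> of the equilibrium. The
  last three assumptions say that a subsystem with equilibrium input has no complete solution near
  the equilibrium other than the equilibrium itself.
\<close>

locale passive_network_ball = passive_network net \<eta>s \<omega>s xMs xcs xus VG VL
  for net :: "('n::finite, 'x::euclidean_space) power_network" and \<eta>s \<omega>s xMs xcs xus VG VL +
  fixes \<rho> r :: real and W :: "'n \<Rightarrow> ('n, 'x) config \<Rightarrow> real"
  assumes r: "0 < r" "r \<le> \<rho>"
    and W: "\<And>j. bus_storage_on j \<rho> (W j)"
    and load_freq: "\<And>z j. z \<in> N \<inter> cball zs r \<Longrightarrow> j \<in> load_buses net \<Longrightarrow>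
      \<exists>w. \<bar>w - \<omega>s $ j\<bar> \<le> \<rho> \<and> surplus net (with_freq z (vec w)) j = 0"
    and load_freq_unique: "\<And>z j. z \<in> N \<inter> cball zs r \<Longrightarrow> j \<in> load_buses net \<Longrightarrow>
      \<exists>!w. surplus net (with_freq z (vec w)) j = 0"
    and phase_small: "\<And>z e. z \<in> N \<inter> cball zs r \<Longrightarrow> e \<in> edges net \<Longrightarrow> \<bar>phase z $ e\<bar> < pi / 2"
    and settled_M: "\<And>j y t. \<lbrakk>j \<in> gen_buses net; solves (\<lambda>x. io_dyn (sysM net j) x (- \<omega>s $ j)) UNIV y;
      \<And>t. y t \<in> io_states (sysM net j); \<And>t. dist (y t) (xMs $ j) \<le> r\<rbrakk> \<Longrightarrow> y t = xMs $ j"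
    and settled_C: "\<And>j y t. \<lbrakk>solves (\<lambda>x. io_dyn (sysC net j) x (- \<omega>s $ j)) UNIV y;
      \<And>t. y t \<in> io_states (sysC net j); \<And>t. dist (y t) (xcs $ j) \<le> r\<rbrakk> \<Longrightarrow> y t = xcs $ j"
    and settled_U: "\<And>j y t. \<lbrakk>solves (\<lambda>x. io_dyn (sysU net j) x (- \<omega>s $ j)) UNIV y;
      \<And>t. y t \<in> io_states (sysU net j); \<And>t. dist (y t) (xus $ j) \<le> r\<rbrakk> \<Longrightarrow> y t = xus $ j"

text \<open>
  At the equilibrium state the surplus of bus \<open>j\<close> is positive at the frequency \<open>\<omega>\<^sub>j* - \<rho>\<close> and negative at
  \<open>\<omega>\<^sub>j* + \<rho>\<close>. These two strict inequalities persist for nearby states, which places a zero between the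
  two frequencies.
\<close>

lemma (in passive_network) passive_network_ball_exists:
  obtains \<rho> r W where "passive_network_ball net \<eta>s \<omega>s xMs xcs xus VG VL \<rho> r W"
proof -
  have "\<forall>j. \<exists>\<rho>. \<rho> > 0 \<and> (\<exists>W. bus_storage_on j \<rho> W)" using bus_storage_exists by blast
  then obtain \<rho>' where \<rho>': "\<And>j. 0 < \<rho>' j" "\<And>j. \<exists>W. bus_storage_on j (\<rho>' j) W" by metis
  define \<rho> where "\<rho> = Min (range \<rho>')"
  have \<rho>: "0 < \<rho>" using \<rho>'(1) by (simp add: \<rho>_def)
  have "\<exists>W. bus_storage_on j \<rho> W" for j
  proof -
    have "\<rho> \<le> \<rho>' j" by (simp add: \<rho>_def)
    then show ?thesis using \<rho>'(2)[of j] bus_storage_on_antimono by blast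
  qed
  then obtain W where W: "\<And>j. bus_storage_on j \<rho> (W j)" by metis
  have zsN: "zs \<in> N" by (rule equilibriumD(6))
  have cont: "continuous_on N (\<lambda>z. surplus net (with_freq z (vec w)) j)" for w j
  proof -
    have "continuous_on N (\<lambda>z. (z, w))" "(\<lambda>z. (z, w)) ` N \<subseteq> N \<times> UNIV" by (auto intro: continuous_intros)
    from continuous_on_compose2[OF continuous_on_surplus_const_freq[of j] this] show ?thesis by simp
  qed
  have surplus_zs: "surplus net (with_freq zs \<omega>) j
      = net_supply net (with_freq zs \<omega>) j - net_supply net (with_freq zs \<omega>s) j" for \<omega> j
    using surplus_equilibrium[of j] by (simp add: surplus_def)
  have sgn: "(\<omega> $ j - \<omega>s $ j) * surplus net (with_freq zs \<omega>) j < 0"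
    if "\<bar>\<omega> $ j - \<omega>s $ j\<bar> \<le> \<rho>" "\<omega> $ j \<noteq> \<omega>s $ j" for \<omega> j
    using W[of j] that unfolding bus_storage_on_def surplus_zs by blast
  have ev_sign: "\<forall>\<^sub>F z in nhds zs. \<forall>j. z \<in> N \<longrightarrow>
      0 < surplus net (with_freq z (vec (\<omega>s $ j - \<rho>))) j \<and> surplus net (with_freq z (vec (\<omega>s $ j + \<rho>))) j < 0"
  proof (rule eventually_all_finite)
    fix j
    have "0 < surplus net (with_freq zs (vec (\<omega>s $ j - \<rho>))) j"
      using sgn[of "vec (\<omega>s $ j - \<rho>)" j] \<rho> by (simp add: mult_less_0_iff zero_less_mult_iff)
    from eventually_nhds_within_continuous[OF cont zsN this]
    have 1: "\<forall>\<^sub>F z in nhds zs. z \<in> N \<longrightarrow> 0 < surplus net (with_freq z (vec (\<omega>s $ j - \<rho>))) j" .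
    have "0 < - surplus net (with_freq zs (vec (\<omega>s $ j + \<rho>))) j"
      using sgn[of "vec (\<omega>s $ j + \<rho>)" j] \<rho> by (simp add: mult_less_0_iff zero_less_mult_iff)
    from eventually_nhds_within_continuous[OF continuous_on_minus[OF cont] zsN this]
    have 2: "\<forall>\<^sub>F z in nhds zs. z \<in> N \<longrightarrow> 0 < - surplus net (with_freq z (vec (\<omega>s $ j + \<rho>))) j" .
    show "\<forall>\<^sub>F z in nhds zs. z \<in> N \<longrightarrow>
      0 < surplus net (with_freq z (vec (\<omega>s $ j - \<rho>))) j \<and> surplus net (with_freq z (vec (\<omega>s $ j + \<rho>))) j < 0"
      using 1 2 by eventually_elim simp
  qed
  have ev_phase: "\<forall>\<^sub>F z in nhds zs. \<forall>e. e \<in> edges net \<longrightarrow> \<bar>phase z $ e\<bar> < pi / 2"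
  proof (rule eventually_all_finite)
    fix e
    show "\<forall>\<^sub>F z in nhds zs. e \<in> edges net \<longrightarrow> \<bar>phase z $ e\<bar> < pi / 2"
    proof (cases "e \<in> edges net")
      case True
      have "open {z :: ('n, 'x) config. \<bar>phase z $ e\<bar> < pi / 2}"
        by (intro open_Collect_less continuous_intros)
      moreover have "zs \<in> {z. \<bar>phase z $ e\<bar> < pi / 2}" using A1 True by (cases e) auto
      ultimately have "\<forall>\<^sub>F z in nhds zs. z \<in> {z. \<bar>phase z $ e\<bar> < pi / 2}" by (rule eventually_nhds_in_open)
      then show ?thesis by eventually_elim simp
    qed simp
  qed
  obtain d where d: "0 < d" "\<And>z. dist z zs < d \<Longrightarrow> z \<in> N \<Longrightarrow>
      (\<forall>j. 0 < surplus net (with_freq z (vec (\<omega>s $ j - \<rho>))) j \<and> surplus net (with_freq z (vec (\<omega>s $ j + \<rho>))) j < 0) \<and>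
      (\<forall>e\<in>edges net. \<bar>phase z $ e\<bar> < pi / 2) \<and>
      (\<forall>j\<in>load_buses net. \<exists>!w. surplus net (with_freq z (vec w)) j = 0)"
  proof -
    have "\<forall>\<^sub>F z in nhds zs. z \<in> N \<longrightarrow>
      (\<forall>j. 0 < surplus net (with_freq z (vec (\<omega>s $ j - \<rho>))) j \<and> surplus net (with_freq z (vec (\<omega>s $ j + \<rho>))) j < 0) \<and>
      (\<forall>e\<in>edges net. \<bar>phase z $ e\<bar> < pi / 2) \<and>
      (\<forall>j\<in>load_buses net. \<exists>!w. surplus net (with_freq z (vec w)) j = 0)"
      using ev_sign ev_phase load_freq_unique_near
    proof eventually_elim
      case (elim z)
      then show ?case by blast
    qed
    then show ?thesis using that unfolding eventually_nhds_metric by blast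
  qed
  define settled where "settled sys u p e \<longleftrightarrow> (\<forall>y t. solves (\<lambda>x. io_dyn sys x u) UNIV y \<and>
      (\<forall>t. y t \<in> io_states sys) \<and> (\<forall>t. dist (y t) p \<le> e) \<longrightarrow> y t = p)"
    for sys :: "'x io_system" and u p e
  have settled: "\<exists>e>0. settled sys u (io_kx sys u) e" if "admissible_io_system sys" for sys u
  proof (rule complete_solution_near_stable_equilibrium[OF that, of u])
    fix e assume "0 < e" and e: "\<And>y t. \<lbrakk>solves (\<lambda>x. io_dyn sys x u) UNIV y; \<And>t. y t \<in> io_states sys;
       \<And>t. dist (y t) (io_kx sys u) \<le> e\<rbrakk> \<Longrightarrow> y t = io_kx sys u"
    have "settled sys u (io_kx sys u) e" unfolding settled_def
    proof (intro allI impI, elim conjE)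
      fix y t assume "solves (\<lambda>x. io_dyn sys x u) UNIV y" "\<forall>t. y t \<in> io_states sys"
        "\<forall>t. dist (y t) (io_kx sys u) \<le> e"
      then show "y t = io_kx sys u" by (intro e) auto
    qed
    with \<open>0 < e\<close> show ?thesis by blast
  qed
  have "\<forall>j. \<exists>e. 0 < e \<and> (j \<in> gen_buses net \<longrightarrow> settled (sysM net j) (- \<omega>s $ j) (xMs $ j) e)"
    using settled[OF sysM] equilibriumD(2) by (metis zero_less_one)
  then obtain eM where eM: "\<And>j. 0 < eM j"
    "\<And>j. j \<in> gen_buses net \<Longrightarrow> settled (sysM net j) (- \<omega>s $ j) (xMs $ j) (eM j)" by metis
  have "\<forall>j. \<exists>e. 0 < e \<and> settled (sysC net j) (- \<omega>s $ j) (xcs $ j) e"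
    using settled[OF sysC] equilibriumD(4) by metis
  then obtain eC where eC: "\<And>j. 0 < eC j" "\<And>j. settled (sysC net j) (- \<omega>s $ j) (xcs $ j) (eC j)" by metis
  have "\<forall>j. \<exists>e. 0 < e \<and> settled (sysU net j) (- \<omega>s $ j) (xus $ j) e"
    using settled[OF sysU] equilibriumD(5) by metis
  then obtain eU where eU: "\<And>j. 0 < eU j" "\<And>j. settled (sysU net j) (- \<omega>s $ j) (xus $ j) (eU j)" by metis
  define S where "S = {\<rho>, d / 2} \<union> range eM \<union> range eC \<union> range eU"
  define r where "r = Min S"
  have S: "finite S" "S \<noteq> {}" by (auto simp: S_def)
  have r: "0 < r" using \<rho> d(1) eM(1) eC(1) eU(1) unfolding r_def Min_gr_iff[OF S] by (auto simp: S_def)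
  have r_le: "r \<le> s" if "s \<in> S" for s using Min_le[OF S(1) that] by (simp add: r_def)
  have le: "r \<le> \<rho>" "r \<le> d / 2" "r \<le> eM j" "r \<le> eC j" "r \<le> eU j" for j
    by (rule r_le, simp add: S_def)+
  have settledD: "y t = p" if "settled sys u p e" "r \<le> e" "solves (\<lambda>x. io_dyn sys x u) UNIV y"
    "\<And>t. y t \<in> io_states sys" "\<And>t. dist (y t) p \<le> r" for sys u p e y t
    using that(1,3,4) order_trans[OF that(5,2)] unfolding settled_def by blast
  have near: "dist z zs < d" if "z \<in> cball zs r" for z
    using that le(2) d(1) by (simp add: dist_commute)
  have "passive_network_ball net \<eta>s \<omega>s xMs xcs xus VG VL \<rho> r W"
  proof
    show "0 < r" by (rule r)
    show "r \<le> \<rho>" by (rule le)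
    show "bus_storage_on j \<rho> (W j)" for j by (rule W)
    show "\<exists>w. \<bar>w - \<omega>s $ j\<bar> \<le> \<rho> \<and> surplus net (with_freq z (vec w)) j = 0"
      if z: "z \<in> N \<inter> cball zs r" "j \<in> load_buses net" for z j
    proof -
      have "continuous_on {\<omega>s $ j - \<rho>..\<omega>s $ j + \<rho>} (\<lambda>w. (z, w))" by (intro continuous_intros)
      from continuous_on_compose2[OF continuous_on_surplus_const_freq[of j] this]
      have "continuous_on {\<omega>s $ j - \<rho>..\<omega>s $ j + \<rho>} (\<lambda>w. surplus net (with_freq z (vec w)) j)"
        using z(1) by auto
      moreover have "surplus net (with_freq z (vec (\<omega>s $ j + \<rho>))) j \<le> 0"
        "0 \<le> surplus net (with_freq z (vec (\<omega>s $ j - \<rho>))) j"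
        using d(2)[OF near, of z] z(1) by (auto intro: less_imp_le)
      ultimately obtain w where "\<omega>s $ j - \<rho> \<le> w" "w \<le> \<omega>s $ j + \<rho>" "surplus net (with_freq z (vec w)) j = 0"
        using IVT2'[of "\<lambda>w. surplus net (with_freq z (vec w)) j" "\<omega>s $ j + \<rho>" 0 "\<omega>s $ j - \<rho>"] \<rho> by auto
      then show ?thesis by (intro exI[of _ w]) (auto simp: abs_le_iff)
    qed
    show "\<exists>!w. surplus net (with_freq z (vec w)) j = 0" if "z \<in> N \<inter> cball zs r" "j \<in> load_buses net" for z j
      using d(2)[OF near, of z] that by blast
    show "\<bar>phase z $ e\<bar> < pi / 2" if "z \<in> N \<inter> cball zs r" "e \<in> edges net" for z e
      using d(2)[OF near, of z] that by blast
  qed (rule settledD[OF eM(2) le(3)] settledD[OF eC(2) le(4)] settledD[OF eU(2) le(5)]; assumption)+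
  then show ?thesis by (rule that)
qed

context passive_network_ball
begin

definition K :: "('n, 'x) config set" where "K = N \<inter> cball zs r"

lemma compact_K: "compact K"
  unfolding K_def using closed_subspace[OF subspace_N] by (simp add: closed_Int_compact)

lemma zs_K: "zs \<in> K" using equilibriumD(6) r by (simp add: K_def)

lemma K_storage: "K \<subseteq> N \<inter> cball zs \<rho>" using r by (auto simp: K_def)

lemma dist_K:
  assumes "z \<in> K"
  shows "dist (freq z) (freq zs) \<le> r" "dist (stM z $ j) (xMs $ j) \<le> r"
    "dist (stC z $ j) (xcs $ j) \<le> r" "dist (stU z $ j) (xus $ j) \<le> r"
proof -
  have z: "dist z zs \<le> r" using assms by (simp add: K_def dist_commute)
  have s: "dist (snd z) (snd zs) \<le> r" using dist_snd_le[of z zs] z by linarith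
  then show "dist (freq z) (freq zs) \<le> r" using dist_fst_le[of "snd z" "snd zs"] by linarith
  have s: "dist (snd (snd z)) (snd (snd zs)) \<le> r" using dist_snd_le[of "snd z" "snd zs"] s by linarith
  then have "dist (stM z) (stM zs) \<le> r" using dist_fst_le[of "snd (snd z)" "snd (snd zs)"] by linarith
  then show "dist (stM z $ j) (xMs $ j) \<le> r" using dist_vec_nth_le[of "stM z" j xMs] by simp
  have s: "dist (snd (snd (snd z))) (snd (snd (snd zs))) \<le> r"
    using dist_snd_le[of "snd (snd z)" "snd (snd zs)"] s by linarith
  then have "dist (stC z) (stC zs) \<le> r" using dist_fst_le[of "snd (snd (snd z))" "snd (snd (snd zs))"] by linarith
  then show "dist (stC z $ j) (xcs $ j) \<le> r" using dist_vec_nth_le[of "stC z" j xcs] by simp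
  have "dist (stU z) (stU zs) \<le> r"
    using dist_snd_le[of "snd (snd (snd z))" "snd (snd (snd zs))"] s by linarith
  then show "dist (stU z $ j) (xus $ j) \<le> r" using dist_vec_nth_le[of "stU z" j xus] by simp
qed

lemma bus_freq_gen: "j \<in> gen_buses net \<Longrightarrow> bus_freq net z $ j = freq z $ j"
  by (simp add: bus_freq_def)

lemma bus_freq_load:
  assumes "z \<in> K" "j \<in> load_buses net"
  shows "surplus net (with_freq z (vec w)) j = 0 \<longleftrightarrow> w = bus_freq net z $ j"
proof -
  have "bus_freq net z $ j = (THE w. surplus net (with_freq z (vec w)) j = 0)"
    using assms(2) by (simp add: bus_freq_def)
  with theI'[OF load_freq_unique] load_freq_unique assms show ?thesis unfolding K_def by metis
qed

lemma bus_freq_near: "z \<in> K \<Longrightarrow> \<bar>bus_freq net z $ j - \<omega>s $ j\<bar> \<le> \<rho>"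
proof (cases "j \<in> gen_buses net")
  case True
  assume "z \<in> K"
  then have "dist (freq z $ j) (freq zs $ j) \<le> r" using dist_K(1) dist_vec_nth_le order_trans by blast
  then show ?thesis using True r by (simp add: bus_freq_gen dist_real_def)
next
  case False
  assume "z \<in> K"
  then show ?thesis using load_freq[of z j] bus_freq_load[of z j] False by (auto simp: K_def)
qed

lemma balanced_iff:
  assumes "z \<in> K" "\<And>j. j \<in> gen_buses net \<Longrightarrow> \<omega> $ j = freq z $ j"
  shows "balanced net (with_freq z \<omega>) \<longleftrightarrow> \<omega> = bus_freq net z"
proof -
  have "surplus net (with_freq z \<omega>) j = 0 \<longleftrightarrow> \<omega> $ j = bus_freq net z $ j" if "j \<in> load_buses net" for j
    using bus_freq_load[OF assms(1) that, of "\<omega> $ j"] surplus_with_freq_cong[of "vec (\<omega> $ j)" j \<omega> net z] by simp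
  then show ?thesis using assms(2) bus_freq_gen[of _ z]
    by (auto simp: balanced_def vec_eq_iff)
qed

text \<open>
  At a load bus the graph is the zero set of the continuous surplus in the product of \<open>K\<close> with a compact
  interval.
\<close>

lemma continuous_on_bus_freq: "continuous_on K (bus_freq net)"
proof -
  have "continuous_on K (\<lambda>z. bus_freq net z $ j)" for j
  proof (cases "j \<in> gen_buses net")
    case True
    then show ?thesis by (simp add: bus_freq_gen) (intro continuous_intros)
  next
    case False
    let ?I = "{\<omega>s $ j - \<rho>..\<omega>s $ j + \<rho>}"
    have im: "bus_freq net z $ j \<in> ?I" if "z \<in> K" for z
      using bus_freq_near[OF that, of j] by (auto simp: abs_le_iff)
    show ?thesis
    proof (rule continuous_from_closed_graph)
      show "(\<lambda>z. bus_freq net z $ j) \<in> K \<rightarrow> ?I" using im by blast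
      have "continuous_on (K \<times> ?I) (\<lambda>(z, w). surplus net (with_freq z (vec w)) j)"
        by (rule continuous_on_subset[OF continuous_on_surplus_const_freq]) (auto simp: K_def)
      moreover have "closed (K \<times> ?I)" using compact_K by (simp add: closed_Times compact_imp_closed)
      ultimately have "closed {p \<in> K \<times> ?I. (\<lambda>(z, w). surplus net (with_freq z (vec w)) j) p = 0}"
        by (rule continuous_closed_preimage_constant)
      moreover have "(\<lambda>z. (z, bus_freq net z $ j)) ` K
          = {p \<in> K \<times> ?I. (\<lambda>(z, w). surplus net (with_freq z (vec w)) j) p = 0}"
        using bus_freq_load[of _ j] im False by auto
      ultimately show "closed ((\<lambda>z. (z, bus_freq net z $ j)) ` K)" by simp
    qed simp
  qed
  then have "continuous_on K (\<lambda>z. \<chi> j. bus_freq net z $ j)" by (rule continuous_on_vec_lambda)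
  then show ?thesis by simp
qed

lemma continuous_on_config: "continuous_on K (\<lambda>z. with_freq z (bus_freq net z))"
  unfolding with_freq_def by (intro continuous_intros continuous_on_bus_freq)

lemma continuous_on_vector_field: "continuous_on K (vector_field net)"
  unfolding vector_field_def[abs_def]
  by (rule continuous_on_compose2[OF continuous_on_velocity continuous_on_config])
     (auto simp: K_def with_freq_configs)

lemma vector_field_N: "z \<in> N \<Longrightarrow> vector_field net z \<in> N"
  unfolding vector_field_def by (intro velocity_N with_freq_configs)

section \<open>The energy function\<close>

definition phase_energy :: "('n, 'x) config \<Rightarrow> real" where
  "phase_energy z = (\<Sum>(i, j)\<in>edges net. suscept net i j *
     (cos (\<eta>s $ (i, j)) - cos (phase z $ (i, j)) - sin (\<eta>s $ (i, j)) * (phase z $ (i, j) - \<eta>s $ (i, j))))"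

definition kinetic_energy :: "('n, 'x) config \<Rightarrow> real" where
  "kinetic_energy z = (\<Sum>j\<in>gen_buses net. inertia net j / 2 * (freq z $ j - \<omega>s $ j)\<^sup>2)"

definition energy :: "('n, 'x) config \<Rightarrow> real" where
  "energy z = kinetic_energy z + phase_energy z + (\<Sum>j\<in>UNIV. W j z)"

lemma continuous_on_energy: "continuous_on K energy"
proof -
  have "continuous_on K (W j)" for j
    using W[of j] continuous_on_subset[OF _ K_storage] unfolding bus_storage_on_def by blast
  then show ?thesis
    unfolding energy_def[abs_def] kinetic_energy_def phase_energy_def split_beta
    by (intro continuous_intros) auto
qed

lemma energy_zs: "energy zs = 0"
  using W unfolding energy_def kinetic_energy_def phase_energy_def bus_storage_on_def
  by (simp add: split_beta)

lemma phase_term_pos: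
  assumes "z \<in> K" "(i, j) \<in> edges net"
  shows "0 \<le> suscept net i j * (cos (\<eta>s $ (i, j)) - cos (phase z $ (i, j)) - sin (\<eta>s $ (i, j)) * (phase z $ (i, j) - \<eta>s $ (i, j)))"
    and "phase z $ (i, j) \<noteq> \<eta>s $ (i, j) \<Longrightarrow>
      0 < suscept net i j * (cos (\<eta>s $ (i, j)) - cos (phase z $ (i, j)) - sin (\<eta>s $ (i, j)) * (phase z $ (i, j) - \<eta>s $ (i, j)))"
proof -
  have "\<bar>\<eta>s $ (i, j)\<bar> < pi / 2" using A1 assms(2) by auto
  moreover have "\<bar>phase z $ (i, j)\<bar> < pi / 2" using phase_small assms by (simp add: K_def)
  ultimately show pos: "phase z $ (i, j) \<noteq> \<eta>s $ (i, j) \<Longrightarrow>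
      0 < suscept net i j * (cos (\<eta>s $ (i, j)) - cos (phase z $ (i, j)) - sin (\<eta>s $ (i, j)) * (phase z $ (i, j) - \<eta>s $ (i, j)))"
    by (intro mult_pos_pos suscept assms phase_potential_pos)
  show "0 \<le> suscept net i j * (cos (\<eta>s $ (i, j)) - cos (phase z $ (i, j)) - sin (\<eta>s $ (i, j)) * (phase z $ (i, j) - \<eta>s $ (i, j)))"
    using pos by (cases "phase z $ (i, j) = \<eta>s $ (i, j)") auto
qed

lemma energy_pos:
  assumes z: "z \<in> K" "z \<noteq> zs"
  shows "0 < energy z"
proof (rule ccontr)
  assume "\<not> 0 < energy z"
  have W0: "0 \<le> W j z" "W j z = 0 \<Longrightarrow> stM z $ j = xMs $ j \<and> stC z $ j = xcs $ j \<and> stU z $ j = xus $ j" for j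
    using W[of j] z(1) K_storage unfolding bus_storage_on_def by blast+
  have kin_term: "0 \<le> inertia net j / 2 * (freq z $ j - \<omega>s $ j)\<^sup>2" if "j \<in> gen_buses net" for j
    using inertia[OF that] by (intro mult_nonneg_nonneg) auto
  then have kin: "0 \<le> kinetic_energy z" unfolding kinetic_energy_def by (intro sum_nonneg)
  have pha: "0 \<le> phase_energy z" unfolding phase_energy_def
    using phase_term_pos(1)[OF z(1)] by (intro sum_nonneg) auto
  have sto: "0 \<le> (\<Sum>j\<in>UNIV. W j z)" using W0(1) by (intro sum_nonneg)
  have zero: "kinetic_energy z = 0" "phase_energy z = 0" "(\<Sum>j\<in>UNIV. W j z) = 0"
    using \<open>\<not> 0 < energy z\<close> kin pha sto unfolding energy_def by linarith+
  have "W j z = 0" for j using zero(3) W0(1) by (simp add: sum_nonneg_eq_0_iff)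
  then have "stM z = stM zs" "stC z = stC zs" "stU z = stU zs" using W0(2) by (simp_all add: vec_eq_iff)
  moreover have "freq z $ j = freq zs $ j" for j
  proof (cases "j \<in> gen_buses net")
    case True
    have "\<forall>j\<in>gen_buses net. inertia net j / 2 * (freq z $ j - \<omega>s $ j)\<^sup>2 = 0"
      using zero(1) kin_term unfolding kinetic_energy_def
      by (subst (asm) sum_nonneg_eq_0_iff) auto
    then show ?thesis using True inertia[OF True] by auto
  next
    case False
    then show ?thesis using z(1) by (simp add: K_def network_states_iff)
  qed
  moreover have "phase z $ e = phase zs $ e" for e
  proof (cases "e \<in> edges net")
    case True
    obtain i j where e: "e = (i, j)" by (cases e)
    have "\<forall>(i, j)\<in>edges net. suscept net i j *
     (cos (\<eta>s $ (i, j)) - cos (phase z $ (i, j)) - sin (\<eta>s $ (i, j)) * (phase z $ (i, j) - \<eta>s $ (i, j))) = 0"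
      using zero(2) phase_term_pos(1)[OF z(1)] unfolding phase_energy_def
      by (subst (asm) sum_nonneg_eq_0_iff) auto
    then show ?thesis using True phase_term_pos(2)[OF z(1)] unfolding e by force
  next
    case False
    have "z \<in> N" using z(1) by (simp add: K_def)
    then have "phase z $ e = 0" "phase zs $ e = 0"
      using False equilibriumD(6) unfolding network_states_iff network_configs_iff by blast+
    then show ?thesis by simp
  qed
  ultimately have "z = zs" by (intro prod_eqI) (auto simp: vec_eq_iff)
  then show False using z(2) by simp
qed

text \<open>
  The power balance at the buses, multiplied with the frequency deviations and summed: load
  buses contribute nothing on the left since their surplus is zero, and the flows recombine by summation
  by parts. The equilibrium frequencies drop out of the edge differences as they agree along edges.
\<close>

lemma energy_balance:
  assumes z: "z \<in> K"
  defines "c \<equiv> with_freq z (bus_freq net z)"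
  shows "(\<Sum>j\<in>gen_buses net. (freq z $ j - \<omega>s $ j) * surplus net c j)
      + (\<Sum>(i, j)\<in>edges net. (line_flow net (phase z) i j - line_flow net \<eta>s i j) * (freq c $ i - freq c $ j))
      = (\<Sum>j\<in>UNIV. (freq c $ j - \<omega>s $ j) * (net_supply net c j - net_supply net (with_freq zs \<omega>s) j))"
proof -
  let ?p = "line_flow net (phase z)" and ?q = "line_flow net \<eta>s" and ?E = "edges net"
  define \<theta> where "\<theta> j = freq c $ j - \<omega>s $ j" for j
  have bal: "balanced net c" unfolding c_def using balanced_iff[OF z, of "bus_freq net z"] bus_freq_gen by blast
  have "(\<Sum>j\<in>gen_buses net. (freq z $ j - \<omega>s $ j) * surplus net c j) = (\<Sum>j\<in>gen_buses net. \<theta> j * surplus net c j)"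
    by (rule sum.cong) (auto simp: \<theta>_def c_def bus_freq_gen)
  also have "\<dots> = (\<Sum>j\<in>UNIV. \<theta> j * surplus net c j)"
    using bal by (intro sum.mono_neutral_left) (auto simp: balanced_def)
  also have "\<dots> = (\<Sum>j\<in>UNIV. \<theta> j * (net_supply net c j - net_supply net (with_freq zs \<omega>s) j)
      - \<theta> j * net_outflow ?E (\<lambda>i k. ?p i k - ?q i k) j)"
  proof (rule sum.cong[OF refl])
    fix j
    have "surplus net c j = surplus net c j - surplus net (with_freq zs \<omega>s) j" by (simp add: surplus_equilibrium)
    also have "\<dots> = (net_supply net c j - net_supply net (with_freq zs \<omega>s) j)
        - (net_outflow ?E ?p j - net_outflow ?E ?q j)" by (simp add: surplus_def c_def)
    finally show "\<theta> j * surplus net c j = \<theta> j * (net_supply net c j - net_supply net (with_freq zs \<omega>s) j)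
      - \<theta> j * net_outflow ?E (\<lambda>i k. ?p i k - ?q i k) j" by (simp add: net_outflow_diff right_diff_distrib)
  qed
  also have "\<dots> = (\<Sum>j\<in>UNIV. \<theta> j * (net_supply net c j - net_supply net (with_freq zs \<omega>s) j))
      - (\<Sum>(i, j)\<in>?E. (\<theta> i - \<theta> j) * (?p i j - ?q i j))"
    by (simp add: sum_subtractf sum_bus_net_outflow)
  also have "(\<Sum>(i, j)\<in>?E. (\<theta> i - \<theta> j) * (?p i j - ?q i j))
      = (\<Sum>(i, j)\<in>?E. (?p i j - ?q i j) * (freq c $ i - freq c $ j))"
    using equilibriumD(1) by (intro sum.cong) (auto simp: \<theta>_def mult.commute)
  finally show ?thesis by (simp add: \<theta>_def)
qed

lemma energy_derivative:
  assumes y: "y ` I \<subseteq> K" "t \<in> I" "(y has_vector_derivative vector_field net (y t)) (at t within I)"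
  shows "\<exists>D. ((\<lambda>s. energy (y s)) has_real_derivative D) (at t within I) \<and> D \<le> 0 \<and>
    (bus_freq net (y t) \<noteq> \<omega>s \<longrightarrow> D < 0)"
proof -
  define z where "z = y t"
  define c where "c = with_freq z (bus_freq net z)"
  have zK: "z \<in> K" using y by (auto simp: z_def)
  have comp: "((\<lambda>s. h (y s)) has_vector_derivative h (velocity net c)) (at t within I)" if "bounded_linear h" for h :: "('n, 'x) config \<Rightarrow> real"
    using bounded_linear.has_vector_derivative[OF that y(3)] by (simp add: vector_field_def c_def z_def)
  have d\<omega>: "((\<lambda>s. freq (y s) $ j) has_real_derivative surplus net c j / inertia net j) (at t within I)"
    if "j \<in> gen_buses net" for j
    using comp[of "\<lambda>z. freq z $ j"] that
    by (simp add: velocity_def has_real_derivative_iff_has_vector_derivative bounded_linear_compose[OF bounded_linear_vec_nth]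
      bounded_linear_fst_comp bounded_linear_snd)
  have d\<eta>: "((\<lambda>s. phase (y s) $ (i, j)) has_real_derivative freq c $ i - freq c $ j) (at t within I)"
    if "(i, j) \<in> edges net" for i j
    using comp[of "\<lambda>z. phase z $ (i, j)"] that
    by (simp add: velocity_def has_real_derivative_iff_has_vector_derivative bounded_linear_compose[OF bounded_linear_vec_nth]
      bounded_linear_fst)
  have "\<exists>D. ((\<lambda>s. W j (y s)) has_real_derivative D) (at t within I) \<and>
      D \<le> - (freq c $ j - \<omega>s $ j) * (net_supply net c j - net_supply net (with_freq zs \<omega>s) j) \<and>
      (freq c $ j \<noteq> \<omega>s $ j \<longrightarrow>
        D < - (freq c $ j - \<omega>s $ j) * (net_supply net c j - net_supply net (with_freq zs \<omega>s) j))" for j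
  proof -
    have "y ` I \<subseteq> N \<inter> cball zs \<rho> \<and> t \<in> I \<and> \<bar>bus_freq net z $ j - \<omega>s $ j\<bar> \<le> \<rho> \<and>
        (y has_vector_derivative velocity net (with_freq (y t) (bus_freq net z))) (at t within I)"
      using y K_storage bus_freq_near[OF zK] by (auto simp: vector_field_def z_def)
    then show ?thesis using W[of j] unfolding bus_storage_on_def c_def with_freq_simps z_def by blast
  qed
  then obtain D where D: "\<And>j. ((\<lambda>s. W j (y s)) has_real_derivative D j) (at t within I)"
    "\<And>j. D j \<le> - (freq c $ j - \<omega>s $ j) * (net_supply net c j - net_supply net (with_freq zs \<omega>s) j)"
    "\<And>j. freq c $ j \<noteq> \<omega>s $ j \<Longrightarrow>
        D j < - (freq c $ j - \<omega>s $ j) * (net_supply net c j - net_supply net (with_freq zs \<omega>s) j)"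
    by metis
  define Dkin where "Dkin = (\<Sum>j\<in>gen_buses net. (freq z $ j - \<omega>s $ j) * surplus net c j)"
  define Dpha where "Dpha = (\<Sum>(i, j)\<in>edges net. (line_flow net (phase z) i j - line_flow net \<eta>s i j) * (freq c $ i - freq c $ j))"
  have kin: "((\<lambda>s. kinetic_energy (y s)) has_real_derivative Dkin) (at t within I)"
    unfolding kinetic_energy_def Dkin_def
  proof (rule DERIV_sum)
    fix j assume j: "j \<in> gen_buses net"
    show "((\<lambda>s. inertia net j / 2 * (freq (y s) $ j - \<omega>s $ j)\<^sup>2) has_real_derivative
        (freq z $ j - \<omega>s $ j) * surplus net c j) (at t within I)"
      using inertia[OF j] by (auto intro!: derivative_eq_intros d\<omega>[OF j] simp: z_def)
  qed
  have pha: "((\<lambda>s. phase_energy (y s)) has_real_derivative Dpha) (at t within I)"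
    unfolding phase_energy_def Dpha_def split_beta
  proof (rule DERIV_sum)
    fix e assume "e \<in> edges net"
    then have e: "(fst e, snd e) \<in> edges net" by simp
    show "((\<lambda>s. suscept net (fst e) (snd e) * (cos (\<eta>s $ (fst e, snd e)) - cos (phase (y s) $ (fst e, snd e))
          - sin (\<eta>s $ (fst e, snd e)) * (phase (y s) $ (fst e, snd e) - \<eta>s $ (fst e, snd e)))) has_real_derivative
        (line_flow net (phase z) (fst e) (snd e) - line_flow net \<eta>s (fst e) (snd e)) * (freq c $ fst e - freq c $ snd e))
        (at t within I)"
      by (auto intro!: derivative_eq_intros d\<eta>[OF e] simp: line_flow_def z_def algebra_simps simp del: prod.collapse)
  qed
  have deriv: "((\<lambda>s. energy (y s)) has_real_derivative Dkin + Dpha + (\<Sum>j\<in>UNIV. D j)) (at t within I)"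
    unfolding energy_def by (intro DERIV_add DERIV_sum kin pha D)
  have eq: "Dkin + Dpha + (\<Sum>j\<in>UNIV. - (freq c $ j - \<omega>s $ j) * (net_supply net c j - net_supply net (with_freq zs \<omega>s) j)) = 0"
    using energy_balance[OF zK] unfolding Dkin_def Dpha_def c_def mult_minus_left sum_negf by simp
  have "(\<Sum>j\<in>UNIV. D j) \<le> (\<Sum>j\<in>UNIV. - (freq c $ j - \<omega>s $ j) * (net_supply net c j - net_supply net (with_freq zs \<omega>s) j))"
    by (intro sum_mono D)
  moreover have "(\<Sum>j\<in>UNIV. D j) < (\<Sum>j\<in>UNIV. - (freq c $ j - \<omega>s $ j) * (net_supply net c j - net_supply net (with_freq zs \<omega>s) j))"
    if "bus_freq net z \<noteq> \<omega>s"
  proof (rule sum_strict_mono_ex1)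
    obtain j where "bus_freq net z $ j \<noteq> \<omega>s $ j" using \<open>bus_freq net z \<noteq> \<omega>s\<close> by (auto simp: vec_eq_iff)
    then have "freq c $ j \<noteq> \<omega>s $ j" by (simp add: c_def)
    from D(3)[OF this]
    show "\<exists>j\<in>UNIV. D j < - (freq c $ j - \<omega>s $ j) * (net_supply net c j - net_supply net (with_freq zs \<omega>s) j)" by blast
  qed (use D(2) in auto)
  ultimately show ?thesis using deriv eq unfolding z_def[symmetric]
    by (intro exI[of _ "Dkin + Dpha + (\<Sum>j\<in>UNIV. D j)"]) auto
qed

end

section \<open>Convergence\<close>

context passive_network_ball
begin

lemma energy_decreasing:
  assumes y: "solves (vector_field net) I y" "y ` I \<subseteq> K" and I: "is_interval I" "a \<in> I" "b \<in> I" "a \<le> b"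
  shows "energy (y b) \<le> energy (y a)"
proof (rule DERIV_nonpos_imp_decreasing_open[OF \<open>a \<le> b\<close>])
  have sub: "{a..b} \<subseteq> I" by (rule Icc_subset_interval[OF I(1-3)])
  have sol: "solves (vector_field net) {a..b} y" by (rule solves_subset[OF y(1) sub])
  have yK: "y ` {a..b} \<subseteq> K" using y(2) sub by blast
  show "continuous_on {a..b} (\<lambda>s. energy (y s))"
    by (rule continuous_on_compose2[OF continuous_on_energy solves_continuous_on[OF sol] yK])
  fix x assume x: "a < x" "x < b"
  then have "x \<in> {a..b}" by simp
  moreover from this sol have "(y has_vector_derivative vector_field net (y x)) (at x within {a..b})"
    unfolding solves_def by blast
  ultimately have "\<exists>D. ((\<lambda>s. energy (y s)) has_real_derivative D) (at x within {a..b}) \<and> D \<le> 0"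
    using energy_derivative[OF yK] by blast
  moreover have "at x within {a..b} = at x" using x by (intro at_within_interior) auto
  ultimately show "\<exists>D. ((\<lambda>s. energy (y s)) has_real_derivative D) (at x) \<and> D \<le> 0" by simp
qed

text \<open>
  Constant energy forces the equilibrium frequencies. The subsystems then receive constant inputs, and
  a constant generator frequency means a zero surplus.
\<close>

lemma constant_energy_solution:
  assumes y: "solves (vector_field net) UNIV y" "\<And>t. y t \<in> K" "\<And>t. energy (y t) = energy (y 0)"
  shows "bus_freq net (y 0) = \<omega>s" "stM (y 0) = xMs" "stC (y 0) = xcs" "stU (y 0) = xus"
    and "surplus net (with_freq (y 0) \<omega>s) j = 0"
proof -
  have deriv: "(y has_vector_derivative vector_field net (y t)) (at t)" for t
    using y(1) by (simp add: solves_def)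
  have \<omega>: "bus_freq net (y t) = \<omega>s" for t
  proof (rule ccontr)
    assume "bus_freq net (y t) \<noteq> \<omega>s"
    then obtain D where "((\<lambda>s. energy (y s)) has_real_derivative D) (at t)" "D < 0"
      using energy_derivative[of y UNIV t] y(2) deriv by blast
    moreover have "((\<lambda>s. energy (y s)) has_real_derivative 0) (at t)"
      by (subst y(3)) simp
    ultimately show False using DERIV_unique by blast
  qed
  then show "bus_freq net (y 0) = \<omega>s" by blast
  have vf: "vector_field net (y t) = velocity net (with_freq (y t) \<omega>s)" for t
    by (simp add: vector_field_def \<omega>)
  have yN: "y t \<in> N" for t using y(2) by (simp add: K_def)
  have comp: "((\<lambda>s. h (y s)) has_vector_derivative h (velocity net (with_freq (y t) \<omega>s))) (at t)"
    if "bounded_linear h" for h :: "('n, 'x) config \<Rightarrow> 'z::real_normed_vector" and t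
    using bounded_linear.has_vector_derivative[OF that deriv] by (simp add: vf)
  have M: "stM (y t) $ j = xMs $ j" for t j
  proof (cases "j \<in> gen_buses net")
    case True
    show ?thesis
    proof (rule settled_M[OF True])
      have "bounded_linear (\<lambda>z :: ('n, 'x) config. stM z $ j)"
        by (intro bounded_linear_compose[OF bounded_linear_vec_nth] bounded_linear_fst_comp bounded_linear_snd_comp
          bounded_linear_snd)
      from comp[OF this] show "solves (\<lambda>x. io_dyn (sysM net j) x (- \<omega>s $ j)) UNIV (\<lambda>t. stM (y t) $ j)"
        using True by (simp add: solves_def velocity_def)
      show "stM (y t) $ j \<in> io_states (sysM net j)" for t
        using yN[of t] True by (simp add: network_states_iff network_configs_iff)
      show "dist (stM (y t) $ j) (xMs $ j) \<le> r" for t by (rule dist_K[OF y(2)])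
    qed
  next
    case False
    then show ?thesis using yN[of t] equilibriumD(3)[OF False] by (simp add: network_states_iff network_configs_iff)
  qed
  have C: "stC (y t) $ j = xcs $ j" for t j
  proof (rule settled_C)
    have "bounded_linear (\<lambda>z :: ('n, 'x) config. stC z $ j)"
      by (intro bounded_linear_compose[OF bounded_linear_vec_nth] bounded_linear_fst_comp bounded_linear_snd_comp
        bounded_linear_snd)
    from comp[OF this] show "solves (\<lambda>x. io_dyn (sysC net j) x (- \<omega>s $ j)) UNIV (\<lambda>t. stC (y t) $ j)"
      by (simp add: solves_def velocity_def)
    show "stC (y t) $ j \<in> io_states (sysC net j)" for t
      using yN[of t] by (simp add: network_states_iff network_configs_iff)
    show "dist (stC (y t) $ j) (xcs $ j) \<le> r" for t by (rule dist_K[OF y(2)])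
  qed
  have U: "stU (y t) $ j = xus $ j" for t j
  proof (rule settled_U)
    have "bounded_linear (\<lambda>z :: ('n, 'x) config. stU z $ j)"
      by (intro bounded_linear_compose[OF bounded_linear_vec_nth] bounded_linear_fst_comp bounded_linear_snd_comp
        bounded_linear_snd)
    from comp[OF this] show "solves (\<lambda>x. io_dyn (sysU net j) x (- \<omega>s $ j)) UNIV (\<lambda>t. stU (y t) $ j)"
      by (simp add: solves_def velocity_def)
    show "stU (y t) $ j \<in> io_states (sysU net j)" for t
      using yN[of t] by (simp add: network_states_iff network_configs_iff)
    show "dist (stU (y t) $ j) (xus $ j) \<le> r" for t by (rule dist_K[OF y(2)])
  qed
  from M C U show "stM (y 0) = xMs" "stC (y 0) = xcs" "stU (y 0) = xus" by (simp_all add: vec_eq_iff)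
  show "surplus net (with_freq (y 0) \<omega>s) j = 0"
  proof (cases "j \<in> gen_buses net")
    case True
    have "bounded_linear (\<lambda>z :: ('n, 'x) config. freq z $ j)"
      by (intro bounded_linear_compose[OF bounded_linear_vec_nth] bounded_linear_fst_comp bounded_linear_snd)
    from comp[OF this, of 0]
    have "((\<lambda>s. freq (y s) $ j) has_vector_derivative surplus net (with_freq (y 0) \<omega>s) j / inertia net j) (at 0)"
      using True by (simp add: velocity_def)
    moreover have "freq (y s) $ j = \<omega>s $ j" for s
      using \<omega>[of s] bus_freq_gen[OF True, of "y s"] by simp
    ultimately have "((\<lambda>s. \<omega>s $ j) has_vector_derivative surplus net (with_freq (y 0) \<omega>s) j / inertia net j) (at 0)"
      by simp
    then have "surplus net (with_freq (y 0) \<omega>s) j / inertia net j = 0"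
      by (rule vector_derivative_unique_at[OF _ has_vector_derivative_const])
    then show ?thesis using inertia[OF True] by simp
  next
    case False
    have "balanced net (with_freq (y 0) (bus_freq net (y 0)))"
      using balanced_iff[OF y(2)] bus_freq_gen by blast
    then show ?thesis using False \<omega> by (simp add: balanced_def)
  qed
qed

text \<open>
  The range of the transposed incidence matrix, as a condition on the phase component.
\<close>

definition potential_phases :: "('n, 'x) config set" where
  "potential_phases = {z. \<exists>\<theta>. \<forall>i j. (i, j) \<in> edges net \<longrightarrow> phase z $ (i, j) = \<theta> i - \<theta> j}"

lemma subspace_potential_phases: "subspace potential_phases"
proof (rule subspaceI)
  show "0 \<in> potential_phases" unfolding potential_phases_def by (auto intro: exI[of _ "\<lambda>_. 0"])
next
  fix x y :: "('n, 'x) config"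
  assume "x \<in> potential_phases" "y \<in> potential_phases"
  then obtain \<theta> \<theta>' where "\<forall>i j. (i, j) \<in> edges net \<longrightarrow> phase x $ (i, j) = \<theta> i - \<theta> j"
    "\<forall>i j. (i, j) \<in> edges net \<longrightarrow> phase y $ (i, j) = \<theta>' i - \<theta>' j"
    unfolding potential_phases_def by blast
  then show "x + y \<in> potential_phases" unfolding potential_phases_def
    by (intro CollectI exI[of _ "\<lambda>i. \<theta> i + \<theta>' i"]) auto
next
  fix a and x :: "('n, 'x) config"
  assume "x \<in> potential_phases"
  then obtain \<theta> where "\<forall>i j. (i, j) \<in> edges net \<longrightarrow> phase x $ (i, j) = \<theta> i - \<theta> j"
    unfolding potential_phases_def by blast
  then show "a *\<^sub>R x \<in> potential_phases" unfolding potential_phases_def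
    by (intro CollectI exI[of _ "\<lambda>i. a * \<theta> i"]) (auto simp: right_diff_distrib)
qed

lemma vector_field_potential_phases: "vector_field net z \<in> potential_phases"
  unfolding potential_phases_def vector_field_def velocity_def
  by (intro CollectI exI[of _ "\<lambda>j. bus_freq net z $ j"]) simp

text \<open>
  Limit points \<open>q\<close> are equilibria whose phases differ from the initial ones by differences of bus
  angles; there is only one of this kind.
\<close>

lemma solution_converges:
  assumes z: "solves (vector_field net) {0..} z" "z ` {0..} \<subseteq> K"
  obtains q where "(z \<longlongrightarrow> q) at_top" "q \<in> K" "bus_freq net q = \<omega>s"
    "stM q = xMs" "stC q = xcs" "stU q = xus" "\<And>j. surplus net (with_freq q \<omega>s) j = 0"
proof -
  have zK: "z t \<in> K" if "0 \<le> t" for t using z(2) that by auto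
  have dec: "energy (z t) \<le> energy (z s)" if "0 \<le> s" "s \<le> t" for s t
    by (rule energy_decreasing[OF z]) (use that in \<open>auto simp: is_interval_ci\<close>)
  define limit where "limit q \<longleftrightarrow> (\<exists>\<sigma>. filterlim \<sigma> at_top sequentially \<and> (\<lambda>n. z (\<sigma> n)) \<longlonglongrightarrow> q)" for q
  have lim: "q \<in> K \<and> bus_freq net q = \<omega>s \<and> stM q = xMs \<and> stC q = xcs \<and> stU q = xus \<and>
      (\<forall>j. surplus net (with_freq q \<omega>s) j = 0)" if q: "limit q" for q
  proof -
    obtain \<sigma> where \<sigma>: "filterlim \<sigma> at_top sequentially" "(\<lambda>n. z (\<sigma> n)) \<longlonglongrightarrow> q"
      using q unfolding limit_def by blast
    show ?thesis
    proof (rule omega_limit_complete_solution[OF continuous_on_vector_field compact_K z continuous_on_energy dec \<sigma>])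
      fix y
      assume y: "solves (vector_field net) UNIV y" "y 0 = q" "\<And>t. y t \<in> K" "\<And>t. energy (y t) = energy q"
      then have "energy (y t) = energy (y 0)" for t by simp
      from constant_energy_solution[OF y(1,3) this] y(2,3) show ?thesis by metis
    qed
  qed
  have pot: "q - z 0 \<in> potential_phases" if q: "limit q" for q
  proof -
    obtain \<sigma> where \<sigma>: "filterlim \<sigma> at_top sequentially" "(\<lambda>n. z (\<sigma> n)) \<longlonglongrightarrow> q"
      using q unfolding limit_def by blast
    show ?thesis
    proof (rule Lim_in_closed_set)
      show "closed potential_phases" by (rule closed_subspace[OF subspace_potential_phases])
      show "(\<lambda>n. z (\<sigma> n) - z 0) \<longlonglongrightarrow> q - z 0" by (intro tendsto_intros \<sigma>)
      have "\<forall>\<^sub>F n in sequentially. 0 \<le> \<sigma> n" using \<sigma>(1) unfolding filterlim_at_top by blast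
      then show "\<forall>\<^sub>F n in sequentially. z (\<sigma> n) - z 0 \<in> potential_phases"
      proof eventually_elim
        case (elim n)
        show ?case
          by (rule solves_increment_in_subspace[OF z(1) _ _ _ subspace_potential_phases vector_field_potential_phases])
             (use elim in \<open>auto simp: is_interval_ci\<close>)
      qed
    qed simp
  qed
  have uniq: "q = q'" if "limit q" "limit q'" for q q'
  proof -
    note q = lim[OF that(1)] and q' = lim[OF that(2)]
    have N: "q \<in> N" "q' \<in> N" using q q' by (auto simp: K_def)
    have "(q - z 0) - (q' - z 0) \<in> potential_phases"
      by (rule subspace_diff[OF subspace_potential_phases pot[OF that(1)] pot[OF that(2)]])
    then obtain \<theta> where \<theta>: "\<And>i j. (i, j) \<in> edges net \<Longrightarrow> phase q $ (i, j) - phase q' $ (i, j) = \<theta> i - \<theta> j"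
      unfolding potential_phases_def by auto
    have "net_supply net (with_freq q \<omega>s) j = net_supply net (with_freq q' \<omega>s) j" for j
      using q q' by (simp add: net_supply_def)
    moreover have "surplus net (with_freq q \<omega>s) j = surplus net (with_freq q' \<omega>s) j" for j
      using q q' by simp
    ultimately have flow: "net_outflow (edges net) (line_flow net (phase q)) j
        = net_outflow (edges net) (line_flow net (phase q')) j" for j
      unfolding surplus_def with_freq_simps by simp
    have "phase q $ e = phase q' $ e" for e
    proof (cases "e \<in> edges net")
      case True
      show ?thesis
        by (rule phase_difference_unique[OF suscept _ flow \<theta> True]) (use phase_small q q' in \<open>auto simp: K_def\<close>)
    next
      case False
      then show ?thesis using N unfolding network_states_iff network_configs_iff by metis
    qed
    moreover have "freq q $ j = freq q' $ j" for j
      using N bus_freq_gen[of j q] bus_freq_gen[of j q'] q q' unfolding network_states_iff by (metis ComplI)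
    ultimately show ?thesis using q q' by (intro prod_eqI) (auto simp: vec_eq_iff)
  qed
  have "\<exists>q. limit q"
  proof -
    have "\<forall>n. z (real n) \<in> K" using zK by simp
    then obtain q k where k: "strict_mono (k :: nat \<Rightarrow> nat)" "((\<lambda>n. z (real n)) \<circ> k) \<longlonglongrightarrow> q"
      using compact_K unfolding compact_def by meson
    have "filterlim (\<lambda>n. real (k n)) at_top sequentially"
      by (rule filterlim_compose[OF filterlim_real_sequentially filterlim_subseq[OF k(1)]])
    then show ?thesis using k(2) unfolding limit_def o_def by blast
  qed
  then obtain q where q: "limit q" by blast
  have "(z \<longlongrightarrow> q) at_top"
  proof (rule tendsto_if_unique_limit_point[OF compact_K zK])
    fix \<sigma> q'
    assume "filterlim \<sigma> at_top sequentially" "(\<lambda>n. z (\<sigma> n)) \<longlonglongrightarrow> q'"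
    then have "limit q'" unfolding limit_def by blast
    then show "q' = q" by (rule uniq[OF _ q])
  qed
  with lim[OF q] show ?thesis using that by blast
qed

lemma equilibrium_if_surplus_zero:
  assumes q: "q \<in> K" "stM q = xMs" "stC q = xcs" "stU q = xus" "\<And>j. surplus net (with_freq q \<omega>s) j = 0"
  shows "network_equilibrium net (phase q) \<omega>s xMs xcs xus"
proof -
  have N: "q \<in> N" using q(1) by (simp add: K_def)
  have "(phase q, \<omega>s, xMs, xcs, xus) \<in> network_configs net"
    using with_freq_configs[OF N, of \<omega>s] q(2-4) unfolding network_configs_iff by simp
  moreover have bal: "0 = power_balance net (phase q) j (if j \<in> gen_buses net then io_ky (sysM net j) (- \<omega>s $ j) else 0)
      (io_ky (sysC net j) (- \<omega>s $ j)) (io_ky (sysU net j) (- \<omega>s $ j))" for j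
    using q(5)[of j] q(2-4) equilibriumD(2)[of j] equilibriumD(4,5)
    by (cases "j \<in> gen_buses net") (simp_all add: surplus_def net_supply_def power_balance_eq io_ky_def)
  ultimately show ?thesis
    unfolding network_equilibrium_def
  proof (intro conjI ballI allI)
    show "case e of (i, j) \<Rightarrow> \<omega>s $ i = \<omega>s $ j" if "e \<in> edges net" for e
      using that equilibriumD(1) by (cases e) blast
    show "0 = power_balance net (phase q) j (io_ky (sysM net j) (- \<omega>s $ j)) (io_ky (sysC net j) (- \<omega>s $ j))
        (io_ky (sysU net j) (- \<omega>s $ j))" if "j \<in> gen_buses net" for j
      using bal[of j] that by simp
    show "0 = power_balance net (phase q) j 0 (io_ky (sysC net j) (- \<omega>s $ j)) (io_ky (sysU net j) (- \<omega>s $ j))"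
      if "j \<in> load_buses net" for j
      using bal[of j] that by simp
  qed (simp_all add: equilibriumD(2), (rule equilibriumD)+)
qed

text \<open>
  As long as the state stays in \<open>K\<close>, the balance equations leave no choice for the load frequencies.
\<close>

lemma network_solution_in_ball:
  assumes c: "c \<in> network_configs net" "balanced net c" "state_part net c \<in> K"
  shows "c = with_freq (state_part net c) (bus_freq net (state_part net c))"
    and "velocity net c = vector_field net (state_part net c)"
proof -
  have "freq c = bus_freq net (state_part net c)"
    using balanced_iff[OF c(3), of "freq c"] c(2) by (simp add: state_part_def)
  then show eq: "c = with_freq (state_part net c) (bus_freq net (state_part net c))"
    by (metis state_part_def with_freq_simps(6,7))
  then show "velocity net c = vector_field net (state_part net c)" by (simp add: vector_field_def)
qed

lemma state_part_with_bus_freq: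
  assumes "z \<in> N"
  shows "state_part net (with_freq z (bus_freq net z)) = z"
proof -
  have "restrict_vec (gen_buses net) (bus_freq net z) = freq z"
    using assms bus_freq_gen[of _ z] by (simp add: network_states_iff vec_eq_iff)
  then show ?thesis by (simp add: state_part_def)
qed

lemma solution_yields_network_solution:
  assumes T: "0 < \<tau>" and w: "solves (vector_field net) (time_interval \<tau>) w" "w ` time_interval \<tau> \<subseteq> K"
  defines "c \<equiv> \<lambda>t. with_freq (w t) (bus_freq net (w t))"
  shows "network_solution net \<tau> (\<lambda>t. phase (c t)) (\<lambda>t. freq (c t)) (\<lambda>t. stM (c t)) (\<lambda>t. stC (c t)) (\<lambda>t. stU (c t))"
proof (rule network_solution_iff[where c = c, OF inertia, THEN iffD2], assumption, intro conjI ballI T)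
  fix t assume t: "t \<in> time_interval \<tau>"
  have wK: "w s \<in> K" if "s \<in> time_interval \<tau>" for s using w(2) that by blast
  then have wN: "w s \<in> N" if "s \<in> time_interval \<tau>" for s using that by (simp add: K_def)
  show "c t \<in> network_configs net" unfolding c_def by (rule with_freq_configs[OF wN[OF t]])
  show "balanced net (c t)" unfolding c_def using balanced_iff[OF wK[OF t]] bus_freq_gen by blast
  have "(w has_vector_derivative velocity net (c t)) (at t within time_interval \<tau>)"
    using w(1) t unfolding solves_def vector_field_def c_def by blast
  then show "((\<lambda>s. state_part net (c s)) has_vector_derivative velocity net (c t)) (at t within time_interval \<tau>)"
    by (rule has_vector_derivative_transform[OF t, rotated])
       (simp add: c_def state_part_with_bus_freq[OF wN])
qed

text \<open>
  The neighbourhood is a sublevel set of the energy in the open ball. It traps solutions, so a maximal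
  solution is defined for all times; otherwise \<open>solution_continuation\<close> would extend it.
\<close>

theorem convergence_near_equilibrium:
  obtains S where "openin (top_of_set N) S" "zs \<in> S"
    "\<And>\<tau> c. \<lbrakk>maximal_network_solution net \<tau> (\<lambda>t. phase (c t)) (\<lambda>t. freq (c t)) (\<lambda>t. stM (c t)) (\<lambda>t. stC (c t)) (\<lambda>t. stU (c t));
       state_part net (c 0) \<in> S\<rbrakk> \<Longrightarrow>
     \<tau> = \<infinity> \<and> (\<exists>\<eta>e. network_equilibrium net \<eta>e \<omega>s xMs xcs xus \<and>
       (c \<longlongrightarrow> (\<eta>e, \<omega>s, xMs, xcs, xus)) at_top)"
proof -
  have closed_N: "closed N" by (rule closed_subspace[OF subspace_N])
  have VK: "continuous_on (N \<inter> cball zs r) energy" using continuous_on_energy by (simp add: K_def)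
  have pos: "energy zs < energy z" if "z \<in> N \<inter> cball zs r" "z \<noteq> zs" for z
    using energy_pos[of z] that by (simp add: K_def energy_zs)
  show ?thesis
  proof (rule lyapunov_trapping[OF closed_N VK pos r(1)])
    fix m
    assume m: "energy zs < m" "\<And>u. u \<in> N \<inter> cball zs r \<Longrightarrow> energy u < m \<Longrightarrow> u \<in> ball zs r"
      and trap: "\<And>(T::real) z. \<lbrakk>0 \<le> T; continuous_on {0..T} z; z ` {0..T} \<subseteq> N; z 0 \<in> ball zs r; energy (z 0) < m;
         \<And>s. 0 \<le> s \<Longrightarrow> s \<le> T \<Longrightarrow> z ` {0..s} \<subseteq> cball zs r \<Longrightarrow> energy (z s) \<le> energy (z 0)\<rbrakk>
        \<Longrightarrow> z T \<in> ball zs r \<and> energy (z T) \<le> energy (z 0)"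
    define S where "S = {z \<in> N \<inter> ball zs r. energy z < m}"
    have "openin (top_of_set (N \<inter> ball zs r)) S"
    proof -
      have "continuous_on (N \<inter> ball zs r) energy" by (rule continuous_on_subset[OF VK]) auto
      then have "openin (top_of_set (N \<inter> ball zs r)) (N \<inter> ball zs r \<inter> energy -` {..<m})"
        by (rule continuous_openin_preimage_gen) simp
      moreover have "N \<inter> ball zs r \<inter> energy -` {..<m} = S" unfolding S_def by blast
      ultimately show ?thesis by (simp only:)
    qed
    then have "openin (top_of_set N) S" by (rule openin_trans) (simp add: openin_open_Int)
    moreover have "zs \<in> S" using equilibriumD(6) r(1) m(1) by (simp add: S_def)
    moreover have "\<tau> = \<infinity> \<and> (\<exists>\<eta>e. network_equilibrium net \<eta>e \<omega>s xMs xcs xus \<and>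
         (c \<longlongrightarrow> (\<eta>e, \<omega>s, xMs, xcs, xus)) at_top)"
      if max: "maximal_network_solution net \<tau> (\<lambda>t. phase (c t)) (\<lambda>t. freq (c t)) (\<lambda>t. stM (c t)) (\<lambda>t. stC (c t)) (\<lambda>t. stU (c t))"
        and init: "state_part net (c 0) \<in> S" for \<tau> c
    proof -
      have sol: "0 < \<tau>" "\<And>t. t \<in> time_interval \<tau> \<Longrightarrow> c t \<in> network_configs net"
        "\<And>t. t \<in> time_interval \<tau> \<Longrightarrow> balanced net (c t)"
        "\<And>t. t \<in> time_interval \<tau> \<Longrightarrow>
          ((\<lambda>s. state_part net (c s)) has_vector_derivative velocity net (c t)) (at t within time_interval \<tau>)"
        using max network_solution_iff[OF inertia, where c = c and \<tau> = \<tau>] unfolding maximal_network_solution_def by blast+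
      define z where "z t = state_part net (c t)" for t
      have dz: "(z has_vector_derivative velocity net (c t)) (at t within time_interval \<tau>)" if "t \<in> time_interval \<tau>" for t
        using sol(4)[OF that] unfolding z_def[abs_def] .
      have zN: "z t \<in> N" if "t \<in> time_interval \<tau>" for t
        unfolding z_def by (rule state_part_N[OF sol(2)[OF that]])
      have down: "{0..t} \<subseteq> time_interval \<tau>" if "t \<in> time_interval \<tau>" for t
        using that unfolding time_interval_def by (auto intro: le_less_trans[of "ereal _" "ereal t"])
      have zc: "continuous_on (time_interval \<tau>) z"
        using dz has_vector_derivative_continuous unfolding continuous_on_eq_continuous_within by blast
      have vf: "velocity net (c t) = vector_field net (z t)" "c t = with_freq (z t) (bus_freq net (z t))"
        if "t \<in> time_interval \<tau>" "z t \<in> K" for t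
        using network_solution_in_ball[OF sol(2,3)[OF that(1)]] that(2) unfolding z_def by blast+
      have in_ball: "z t \<in> ball zs r \<and> energy (z t) \<le> energy (z 0)" if t: "t \<in> time_interval \<tau>" for t
      proof (rule trap)
        show "0 \<le> t" using t by (simp add: time_interval_def)
        show "continuous_on {0..t} z" by (rule continuous_on_subset[OF zc down[OF t]])
        show "z ` {0..t} \<subseteq> N" using zN down[OF t] by blast
        show "z 0 \<in> ball zs r" "energy (z 0) < m" using init by (auto simp: S_def z_def)
        fix s assume s: "0 \<le> s" "s \<le> t" "z ` {0..s} \<subseteq> cball zs r"
        have sub: "{0..s} \<subseteq> time_interval \<tau>" using down[OF t] s(2) by auto
        have sK: "z ` {0..s} \<subseteq> K" using s(3) zN sub by (auto simp: K_def)
        have "solves (vector_field net) {0..s} z"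
          unfolding solves_def
        proof
          fix u assume u: "u \<in> {0..s}"
          then have "(z has_vector_derivative velocity net (c u)) (at u within {0..s})"
            using has_vector_derivative_within_subset[OF dz sub] sub by blast
          moreover have "u \<in> time_interval \<tau>" "z u \<in> K" using u sub sK by blast+
          ultimately show "(z has_vector_derivative vector_field net (z u)) (at u within {0..s})"
            using vf(1)[of u] by simp
        qed
        then show "energy (z s) \<le> energy (z 0)"
          by (rule energy_decreasing[OF _ sK]) (use s(1) in auto)
      qed
      have zK: "z t \<in> K" if "t \<in> time_interval \<tau>" for t
        using in_ball[OF that] zN[OF that] by (simp add: K_def)
      have zsol: "solves (vector_field net) (time_interval \<tau>) z"
        using dz vf(1) zK unfolding solves_def by simp
      have "\<tau> = \<infinity>"
      proof (rule ccontr)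
        assume "\<tau> \<noteq> \<infinity>"
        then obtain T where T: "\<tau> = ereal T" "0 < T" using sol(1) by (cases \<tau>) auto
        have ti: "time_interval (ereal b) = {0..<b}" for b by (auto simp: time_interval_def)
        define C where "C = {u \<in> K. energy u \<le> energy (z 0)}"
        have C: "compact C"
        proof -
          have "closed C" unfolding C_def
            by (intro continuous_on_closed_Collect_le continuous_on_energy continuous_on_const compact_imp_closed compact_K)
          moreover have "C = C \<inter> K" by (auto simp: C_def)
          ultimately show ?thesis using compact_K by (metis closed_Int_compact)
        qed
        have C_sub: "C \<subseteq> N \<inter> ball zs r"
        proof
          fix u assume "u \<in> C"
          then have "u \<in> N \<inter> cball zs r" "energy u < m" using init by (auto simp: C_def K_def S_def z_def)
          with m(2) show "u \<in> N \<inter> ball zs r" by blast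
        qed
        have sol_T: "solves (vector_field net) {0..<T} z" using zsol unfolding T(1) ti .
        have "z t \<in> C" if "t \<in> time_interval \<tau>" for t using zK[OF that] in_ball[OF that] by (simp add: C_def)
        then have C_T: "z ` {0..<T} \<subseteq> C" unfolding T(1) ti by blast
        have cont: "continuous_on (N \<inter> cball zs r) (vector_field net)" "vector_field net ` (N \<inter> cball zs r) \<subseteq> N"
          using continuous_on_vector_field vector_field_N by (auto simp: K_def)
        show False
        proof (rule solution_continuation[OF subspace_N cont C C_sub T(2) sol_T C_T])
          fix w d
          assume w: "0 < d" "solves (vector_field net) {0..<T+d} w"
            "\<And>t. t \<in> {0..<T} \<Longrightarrow> w t = z t" "w ` {0..<T+d} \<subseteq> N \<inter> ball zs r"
          define c' where "c' t = with_freq (w t) (bus_freq net (w t))" for t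
          have "w ` {0..<T+d} \<subseteq> K" using w(4) ball_subset_cball unfolding K_def by blast
          then have ext: "network_solution net (ereal (T + d)) (\<lambda>t. phase (c' t)) (\<lambda>t. freq (c' t)) (\<lambda>t. stM (c' t))
              (\<lambda>t. stC (c' t)) (\<lambda>t. stU (c' t))"
            unfolding c'_def using w(1,2) T(2) by (intro solution_yields_network_solution) (simp_all add: ti)
          have "c' t = c t" if "t \<in> time_interval \<tau>" for t
          proof -
            have "w t = z t" using that w(3) unfolding T(1) ti by blast
            then show ?thesis using vf(2)[OF that zK[OF that]] by (simp add: c'_def)
          qed
          then have agree: "\<forall>t\<in>time_interval \<tau>. (phase (c' t), freq (c' t), stM (c' t), stC (c' t), stU (c' t))
              = (phase (c t), freq (c t), stM (c t), stC (c t), stU (c t))" by simp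
          have lt: "\<tau> < ereal (T + d)" using w(1) by (simp add: T(1))
          have "\<not> (\<exists>\<tau>' \<eta>' \<omega>' xM' xc' xu'. \<tau> < \<tau>' \<and> network_solution net \<tau>' \<eta>' \<omega>' xM' xc' xu' \<and>
            (\<forall>t\<in>time_interval \<tau>. (\<eta>' t, \<omega>' t, xM' t, xc' t, xu' t)
              = (phase (c t), freq (c t), stM (c t), stC (c t), stU (c t))))"
            using max unfolding maximal_network_solution_def by (rule conjunct2)
          then show False
            by (elim notE, intro exI conjI) (rule lt, rule ext, rule agree)
        qed
      qed
      then have ti: "time_interval \<tau> = {0..}" by (auto simp: time_interval_def)
      have "z ` {0..} \<subseteq> K" using zK unfolding ti by blast
      then obtain q where q: "(z \<longlongrightarrow> q) at_top" "q \<in> K" "bus_freq net q = \<omega>s"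
        "stM q = xMs" "stC q = xcs" "stU q = xus" "\<And>j. surplus net (with_freq q \<omega>s) j = 0"
        by (rule solution_converges[OF zsol[unfolded ti]]) iprover
      have "((\<lambda>t. with_freq (z t) (bus_freq net (z t))) \<longlongrightarrow> with_freq q (bus_freq net q)) at_top"
        by (rule continuous_on_tendsto_compose[OF continuous_on_config q(1,2)])
           (use zK ti in \<open>auto simp: eventually_at_top_linorder intro!: exI[of _ 0]\<close>)
      then have "(c \<longlongrightarrow> with_freq q (bus_freq net q)) at_top"
        by (rule Lim_transform_eventually)
           (use vf(2) zK ti in \<open>auto simp: eventually_at_top_linorder intro!: exI[of _ 0]\<close>)
      moreover have "with_freq q (bus_freq net q) = (phase q, \<omega>s, xMs, xcs, xus)"
        using q(3-6) by (intro prod_eqI) simp_all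
      ultimately show ?thesis using equilibrium_if_surplus_zero[OF q(2,4-7)] \<open>\<tau> = \<infinity>\<close> by metis
    qed
    ultimately show ?thesis using that by blast
  qed
qed

end

theorem theorem1:
  fixes net :: "('n::finite, 'x::euclidean_space) power_network"
    and \<eta>s :: "real ^ ('n \<times> 'n)" and \<omega>s :: "real ^ 'n" and xMs xcs xus :: "'x ^ 'n"
    and VG :: "'n \<Rightarrow> 'x \<times> 'x \<times> 'x \<Rightarrow> real" and VL :: "'n \<Rightarrow> 'x \<times> 'x \<Rightarrow> real"
  assumes "admissible_network net"
    and "network_equilibrium net \<eta>s \<omega>s xMs xcs xus"
    and A1: "\<forall>(i, j)\<in>edges net. \<bar>\<eta>s $ (i, j)\<bar> < pi / 2"
    and A2_gen: "\<forall>j\<in>gen_buses net.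
      locally_input_strictly_passive (gen_supply net j) (- \<omega>s $ j) (xMs $ j, xcs $ j, xus $ j) (VG j)"
    and A2_load: "\<forall>j\<in>load_buses net.
      locally_input_strictly_passive (load_supply net j) (- \<omega>s $ j) (xcs $ j, xus $ j) (VL j)"
    and A3_gen: "\<forall>j\<in>gen_buses net.
      strict_local_min_on (io_states (gen_supply net j)) (VG j) (xMs $ j, xcs $ j, xus $ j)"
    and A3_load: "\<forall>j\<in>load_buses net.
      strict_local_min_on (io_states (load_supply net j)) (VL j) (xcs $ j, xus $ j)"
    and A4: "load_freq_determined_near net (\<eta>s, restrict_vec (gen_buses net) \<omega>s, xMs, xcs, xus)"
  shows "\<exists>S. openin (top_of_set (network_states net)) S \<and>
    (\<eta>s, restrict_vec (gen_buses net) \<omega>s, xMs, xcs, xus) \<in> S \<and>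
    (\<forall>\<tau> \<eta> \<omega> xM xc xu.
       maximal_network_solution net \<tau> \<eta> \<omega> xM xc xu \<and>
       (\<eta> 0, restrict_vec (gen_buses net) (\<omega> 0), xM 0, xc 0, xu 0) \<in> S \<longrightarrow>
       \<tau> = \<infinity> \<and>
       (\<exists>\<eta>e \<omega>e xMe xce xue.
          network_equilibrium net \<eta>e \<omega>e xMe xce xue \<and>
          ((\<lambda>t. (\<eta> t, \<omega> t, xM t, xc t, xu t)) \<longlongrightarrow> (\<eta>e, \<omega>e, xMe, xce, xue)) at_top))"
proof -
  interpret passive_network net \<eta>s \<omega>s xMs xcs xus VG VL by unfold_locales (fact assms)+
  obtain \<rho> r W where ball: "passive_network_ball net \<eta>s \<omega>s xMs xcs xus VG VL \<rho> r W"
    by (rule passive_network_ball_exists)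
  interpret ball: passive_network_ball net \<eta>s \<omega>s xMs xcs xus VG VL \<rho> r W by (rule ball)
  obtain S where S: "openin (top_of_set (network_states net)) S" "zs \<in> S"
    and conv: "\<And>\<tau> c. \<lbrakk>maximal_network_solution net \<tau> (\<lambda>t. phase (c t)) (\<lambda>t. freq (c t)) (\<lambda>t. stM (c t)) (\<lambda>t. stC (c t)) (\<lambda>t. stU (c t));
       state_part net (c 0) \<in> S\<rbrakk> \<Longrightarrow>
     \<tau> = \<infinity> \<and> (\<exists>\<eta>e. network_equilibrium net \<eta>e \<omega>s xMs xcs xus \<and>
       (c \<longlongrightarrow> (\<eta>e, \<omega>s, xMs, xcs, xus)) at_top)"
    by (rule ball.convergence_near_equilibrium) blast
  show ?thesis
  proof (intro exI[of _ S] conjI allI impI)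
    show "(\<eta>s, restrict_vec (gen_buses net) \<omega>s, xMs, xcs, xus) \<in> S" using S(2) by (simp add: zs_def)
    fix \<tau> \<eta> \<omega> xM xc xu
    assume "maximal_network_solution net \<tau> \<eta> \<omega> xM xc xu \<and>
       (\<eta> 0, restrict_vec (gen_buses net) (\<omega> 0), xM 0, xc 0, xu 0) \<in> S"
    then have *: "\<tau> = \<infinity> \<and> (\<exists>\<eta>e. network_equilibrium net \<eta>e \<omega>s xMs xcs xus \<and>
       ((\<lambda>t. (\<eta> t, \<omega> t, xM t, xc t, xu t)) \<longlongrightarrow> (\<eta>e, \<omega>s, xMs, xcs, xus)) at_top)"
      using conv[of \<tau> "\<lambda>t. (\<eta> t, \<omega> t, xM t, xc t, xu t)"] by (simp add: state_part_def with_freq_def)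
    then show "\<tau> = \<infinity>" by blast
    from * show "\<exists>\<eta>e \<omega>e xMe xce xue. network_equilibrium net \<eta>e \<omega>e xMe xce xue \<and>
          ((\<lambda>t. (\<eta> t, \<omega> t, xM t, xc t, xu t)) \<longlongrightarrow> (\<eta>e, \<omega>e, xMe, xce, xue)) at_top" by blast
  qed (rule S(1))
qed

end
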